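(* Let $T$ be polynomial in $n$ and let $\hat\rho=(\hat\rho_1,\ldots,\hat\rho_T)$ be a $d$-delayed prediction with $k$ outliers for the $\#s$-$\triangle$ problem. (i) There is an algorithm solving the $\#s$-$\triangle$ problem given $\hat\rho$ with polynomial preprocessing time $P(n)$, update time $U(n)=O(d+k)$ and query time $Q(n)=O(1)$. (ii) There is an algorithm solving the $\#s$-$\triangle$ problem given $\hat\rho$ with polynomial preprocessing time $P(n)$, update time $U(n)=O(1)$ and query time $Q(n)=O((d+k)^2)$.
   Context: The $\#s$-$\triangle$ problem: a dynamic undirected graph on $n$ vertices with fixed vertex $s$, given initially; each update flips an edge (inserts it if absent, deletes it if present); each query asks for the number of triangles containing $s$ in the current graph; requests arrive online and queries must be answered before the next request. For $I\subseteq[T]$, $\rho_I=(\rho_i)_{i\in I}$. A permutation $\pi$ of $[T']$ acts by $\pi(\sigma)=(\sigma_{\pi(1)},\ldots,\sigma_{\pi(T')})$ and is $d$-close to the identity if $|\pi^{-1}(j)-j|\le d$ for all $j$. $\hat\rho$ is $d$-delayed with $k$ outliers for the actual request sequence $\rho$ of length $T$ if there exist $I,\hat I\subseteq[T]$ both of size $T'\ge T-k$ and a permutation $\pi$ of $[T']$, $d$-close to the identity, with $\pi(\rho_I)=\hat\rho_{\hat I}$. The algorithm receives the initial graph and $\hat\rho$ during preprocessing. *)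

theory Defs
  imports
    "HOL-Library.Ramsey"
    "HOL-Library.Log_Nat"
    "HOL-Library.Landau_Symbols"
    "HOL-Combinatorics.Permutations"
begin

section \<open>Counting triangles through a fixed vertex in a dynamic graph\<close>

text \<open>
  The vertices are \<^term>\<open>{..<n}\<close>. Edges are unordered pairs, so two requests to flip the
  same edge are equal however the endpoints are listed.
\<close>

datatype request = Update "nat set" | Query

definition is_graph :: "nat \<Rightarrow> nat set set \<Rightarrow> bool" where
  "is_graph n E \<longleftrightarrow> E \<subseteq> nsets {..<n} 2"

definition valid_requests :: "nat \<Rightarrow> request list \<Rightarrow> bool" where
  "valid_requests n rs \<longleftrightarrow> (\<forall>e. Update e \<in> set rs \<longrightarrow> e \<in> nsets {..<n} 2)"

definition flip :: "nat set \<Rightarrow> nat set set \<Rightarrow> nat set set" where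
  "flip e E = (if e \<in> E then E - {e} else insert e E)"

definition triangles_at :: "nat \<Rightarrow> nat \<Rightarrow> nat set set \<Rightarrow> nat" where
  "triangles_at n s E = card {V \<in> nsets {..<n} 3. s \<in> V \<and> nsets V 2 \<subseteq> E}"


section \<open>Delayed predictions with outliers\<close>

text \<open>Positions are counted from 0; \<^term>\<open>nths \<rho> I\<close> is the subsequence of \<open>\<rho>\<close> indexed by \<open>I\<close>.\<close>

definition close_to_id :: "nat \<Rightarrow> nat \<Rightarrow> (nat \<Rightarrow> nat) \<Rightarrow> bool" where
  "close_to_id d m \<pi> \<longleftrightarrow> (\<forall>j<m. \<bar>int (inv \<pi> j) - int j\<bar> \<le> int d)"

definition delayed_prediction ::
  "nat \<Rightarrow> nat \<Rightarrow> 'a list \<Rightarrow> 'a list \<Rightarrow> bool" where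
  "delayed_prediction d k \<rho> \<rho>' \<longleftrightarrow>
     length \<rho>' = length \<rho> \<and>
     (\<exists>I I' m \<pi>.
        I \<subseteq> {..<length \<rho>} \<and> I' \<subseteq> {..<length \<rho>} \<and>
        card I = m \<and> card I' = m \<and> length \<rho> \<le> m + k \<and>
        \<pi> permutes {..<m} \<and> close_to_id d m \<pi> \<and>
        permute_list \<pi> (nths \<rho> I) = nths \<rho>' I')"


section \<open>Word RAM\<close>

text \<open>
  A word RAM with word length \<open>w\<close>, programmed by structured control flow. Registers and memory
  cells hold numbers below \<open>2 ^ w\<close>, which are also the only memory addresses. Subtraction is
  cut off at 0 and division by 0 yields 0; addition and multiplication wrap around.
  Evaluating an expression costs one unit for each of its nodes.
\<close>

datatype binop = Add | Sub | Mul | Div | Mod | Less | Equal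

datatype expr = Const nat | Reg nat | Load expr | Bin binop expr expr

datatype com =
    Skip
  | Assign nat expr
  | Store expr expr
  | Seq com com
  | If expr com com
  | While expr com

text \<open>The register contents and the memory contents.\<close>

type_synonym ram_state = "(nat \<Rightarrow> nat) \<times> (nat \<Rightarrow> nat)"

fun apply_binop :: "binop \<Rightarrow> nat \<Rightarrow> nat \<Rightarrow> nat" where
  "apply_binop Add x y = x + y"
| "apply_binop Sub x y = x - y"
| "apply_binop Mul x y = x * y"
| "apply_binop Div x y = x div y"
| "apply_binop Mod x y = x mod y"
| "apply_binop Less x y = (if x < y then 1 else 0)"
| "apply_binop Equal x y = (if x = y then 1 else 0)"

fun eval_expr :: "nat \<Rightarrow> expr \<Rightarrow> ram_state \<Rightarrow> nat" where
  "eval_expr w (Const c) st = c mod 2 ^ w"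
| "eval_expr w (Reg r) st = fst st r"
| "eval_expr w (Load a) st = snd st (eval_expr w a st)"
| "eval_expr w (Bin f a b) st = apply_binop f (eval_expr w a st) (eval_expr w b st) mod 2 ^ w"

fun expr_cost :: "expr \<Rightarrow> nat" where
  "expr_cost (Const c) = 1"
| "expr_cost (Reg r) = 1"
| "expr_cost (Load a) = 1 + expr_cost a"
| "expr_cost (Bin f a b) = 1 + expr_cost a + expr_cost b"

text \<open>
  \<open>exec w p st t st'\<close>: started in \<open>st\<close>, the program \<open>p\<close> terminates after \<open>t\<close> time units in \<open>st'\<close>.
\<close>

inductive exec :: "nat \<Rightarrow> com \<Rightarrow> ram_state \<Rightarrow> nat \<Rightarrow> ram_state \<Rightarrow> bool" for w where
  Skip: "exec w Skip st 1 st"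
| Assign: "exec w (Assign r a) st (1 + expr_cost a)
     ((fst st)(r := eval_expr w a st), snd st)"
| Store: "exec w (Store a b) st (1 + expr_cost a + expr_cost b)
     (fst st, (snd st)(eval_expr w a st := eval_expr w b st))"
| Seq: "exec w p st t st' \<Longrightarrow> exec w q st' t' st'' \<Longrightarrow> exec w (Seq p q) st (t + t') st''"
| IfTrue: "eval_expr w b st \<noteq> 0 \<Longrightarrow> exec w p st t st' \<Longrightarrow>
     exec w (If b p q) st (1 + expr_cost b + t) st'"
| IfFalse: "eval_expr w b st = 0 \<Longrightarrow> exec w q st t st' \<Longrightarrow>
     exec w (If b p q) st (1 + expr_cost b + t) st'"
| WhileFalse: "eval_expr w b st = 0 \<Longrightarrow> exec w (While b p) st (1 + expr_cost b) st"
| WhileTrue: "eval_expr w b st \<noteq> 0 \<Longrightarrow> exec w p st t st' \<Longrightarrow> exec w (While b p) st' t' st'' \<Longrightarrow>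
     exec w (While b p) st (1 + expr_cost b + t + t') st''"


section \<open>Dynamic algorithms with predictions\<close>

record dyn_algorithm =
  preprocess_prog :: com
  update_prog :: com
  query_prog :: com

text \<open>Word length \<open>c\<close> times the number of binary digits of \<open>n\<close>.\<close>

definition word_length :: "nat \<Rightarrow> nat \<Rightarrow> nat" where
  "word_length c n = c * floorlog 2 n"

fun encode_request :: "request \<Rightarrow> nat list" where
  "encode_request (Update e) = [1, Min e, Max e]"
| "encode_request Query = [0, 0, 0]"

text \<open>
  The preprocessing input: \<open>n\<close>, \<open>s\<close> and the length of the prediction, then the adjacency
  matrix of the initial graph row by row, then the prediction.
\<close>

definition encode_input :: "nat \<Rightarrow> nat \<Rightarrow> nat set set \<Rightarrow> request list \<Rightarrow> nat list" where
  "encode_input n s E \<rho>' =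
     [n, s, length \<rho>'] @
     concat (map (\<lambda>u. map (\<lambda>v. if {u, v} \<in> E then 1 else 0) [0..<n]) [0..<n]) @
     concat (map encode_request \<rho>')"

definition initial_state :: "nat list \<Rightarrow> ram_state" where
  "initial_state xs = (\<lambda>r. 0, \<lambda>a. if a < length xs then xs ! a else 0)"

text \<open>The endpoints of the edge to be flipped are passed in registers 0 and 1.\<close>

definition pass_edge :: "nat set \<Rightarrow> ram_state \<Rightarrow> ram_state" where
  "pass_edge e st = ((fst st)(0 := Min e, 1 := Max e), snd st)"

text \<open>
  Starting from machine state \<open>st\<close> and current graph \<open>E\<close>, the requests are served one at a time,
  each before the next one is revealed; every single update takes time at most \<open>U\<close>, and every
  single query takes time at most \<open>Q\<close> and leaves the correct answer in register 0.
\<close>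

fun serves ::
  "nat \<Rightarrow> dyn_algorithm \<Rightarrow> nat \<Rightarrow> nat \<Rightarrow> nat \<Rightarrow> nat \<Rightarrow>
   nat set set \<Rightarrow> ram_state \<Rightarrow> request list \<Rightarrow> bool" where
  "serves w A n s U Q E st [] \<longleftrightarrow> True"
| "serves w A n s U Q E st (Update e # \<rho>) \<longleftrightarrow>
     (\<exists>t st'. exec w (update_prog A) (pass_edge e st) t st' \<and> t \<le> U \<and>
        serves w A n s U Q (flip e E) st' \<rho>)"
| "serves w A n s U Q E st (Query # \<rho>) \<longleftrightarrow>
     (\<exists>t st'. exec w (query_prog A) st t st' \<and> t \<le> Q \<and> fst st' 0 = triangles_at n s E \<and>
        serves w A n s U Q E st' \<rho>)"

text \<open>
  \<open>A\<close> solves the problem on instances with \<open>n\<close> vertices and \<open>T n\<close> requests, given a prediction,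
  in preprocessing time \<open>P n\<close>, and update time \<open>U n d k\<close> and query time \<open>Q n d k\<close> whenever the
  prediction is \<open>d\<close>-delayed with \<open>k\<close> outliers. The algorithm is not told \<open>d\<close> and \<open>k\<close>, and every
  prediction has \<open>T n\<close> outliers at most, so correctness does not rely on the prediction. The
  words must be long enough to hold and to address the input.
\<close>

definition solves_with_prediction ::
  "dyn_algorithm \<Rightarrow> nat \<Rightarrow> (nat \<Rightarrow> nat) \<Rightarrow> (nat \<Rightarrow> nat) \<Rightarrow>
   (nat \<Rightarrow> nat \<Rightarrow> nat \<Rightarrow> nat) \<Rightarrow> (nat \<Rightarrow> nat \<Rightarrow> nat \<Rightarrow> nat) \<Rightarrow> bool" where
  "solves_with_prediction A c T P U Q \<longleftrightarrow>
     (\<forall>n s E \<rho> \<rho>' d k.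
        s < n \<longrightarrow> is_graph n E \<longrightarrow>
        length \<rho> = T n \<longrightarrow> valid_requests n \<rho> \<longrightarrow> valid_requests n \<rho>' \<longrightarrow>
        delayed_prediction d k \<rho> \<rho>' \<longrightarrow>
        (let w = word_length c n; xs = encode_input n s E \<rho>' in
           length xs \<le> 2 ^ w \<and> set xs \<subseteq> {..<2 ^ w} \<and>
           (\<exists>t st. exec w (preprocess_prog A) (initial_state xs) t st \<and> t \<le> P n \<and>
              serves w A n s (U n d k) (Q n d k) E st \<rho>)))"

definition polynomially_bounded :: "(nat \<Rightarrow> nat) \<Rightarrow> bool" where
  "polynomially_bounded f \<longleftrightarrow> (\<exists>a. (\<lambda>n. real (f n)) \<in> O(\<lambda>n. real n ^ a))"

text \<open>
  \<open>F(n) = O(g(d, k))\<close> with a constant independent of \<open>n\<close>, \<open>d\<close> and \<open>k\<close>. As usual for running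
  times, a bound \<open>g(d, k) = 0\<close> (which occurs for \<open>d = k = 0\<close>) is read as constant time.
\<close>

definition time_bigo :: "(nat \<Rightarrow> nat \<Rightarrow> nat \<Rightarrow> nat) \<Rightarrow> (nat \<Rightarrow> nat \<Rightarrow> nat) \<Rightarrow> bool" where
  "time_bigo F g \<longleftrightarrow> (\<exists>C. \<forall>n d k. F n d k \<le> C * max 1 (g d k))"

end

theory Submission
  imports Defs
begin

text \<open>
  After \<open>t\<close> requests, the actual graph and the graph predicted for time \<open>t\<close> differ in at most
  \<open>2 (d + k)\<close> edges: apart from at most \<open>k + d\<close> requests, the first \<open>t\<close> actual requests occur among
  the first \<open>t\<close> predicted ones and vice versa. Both algorithms keep these edges in a list that
  supports constant-time insertion and deletion, next to the actual adjacency matrix. During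
  preprocessing they tabulate, for every time \<open>t\<close> and every vertex \<open>v\<close>, the number of common
  neighbours of \<open>s\<close> and \<open>v\<close> in the predicted graph, and the number of triangles through \<open>s\<close>.

  Flipping an edge that avoids \<open>s\<close> changes the number of triangles by at most one, which is read off the
  adjacency matrix. Flipping \<open>{s, v}\<close> changes it by the number of common neighbours of \<open>s\<close> and \<open>v\<close>.
  That number is obtained from the table by correcting the listed edges one at a time, which takes
  time linear in the length of the list. The first algorithm does this at every update. The second one
  starts each query from the tabulated count of the predicted graph and flips all listed edges in
  turn, at quadratic cost.
\<close>

section \<open>Polynomial bounds\<close>

text \<open>The programs never see \<open>d\<close> or \<open>k\<close>. They maintain the exact
  symmetric difference of the actual and the predicted graph, and its size alone drives the running
  time; the factor 2 counts the unmatched actual and the unmatched predicted requests.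

  The obstacle is that a correction pass runs through intermediate graphs that cannot be stored,
  although each step asks for the presence of an arbitrary edge in the current one. The order of the
  list resolves this: an intermediate graph has exactly a prefix of the list corrected, so comparing
  the stored position of an edge with the length of that prefix answers the question in constant
  time.

  The word RAM adds wraparound and truncated subtraction. The word length is therefore chosen so
  large that all addresses and counts of an instance fit into a word, and every signed change is
  written as \<open>r + g * (1 - m) - g * m\<close> with a bit \<open>m\<close>, which is exact on
  natural numbers. The numerical time constants are generous estimates of instruction
  counts.\<close>

lemma polynomially_bounded_iff:
  "polynomially_bounded f \<longleftrightarrow> (\<exists>C a. \<forall>n. f n \<le> C * (n + 1) ^ a)"
proof
  assume "polynomially_bounded f"
  then obtain a where "(\<lambda>n. real (f n)) \<in> O(\<lambda>n. real n ^ a)"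
    unfolding polynomially_bounded_def by blast
  then obtain c where "c > 0" "eventually (\<lambda>n. norm (real (f n)) \<le> c * norm (real n ^ a)) at_top"
    by (rule landau_o.bigE)
  then obtain N where N: "\<And>n. n \<ge> N \<Longrightarrow> real (f n) \<le> c * real n ^ a"
    by (auto simp: eventually_at_top_linorder)
  \<comment> \<open>The sum absorbs the finitely many values below \<open>N\<close>, about which the
    asymptotic bound says nothing.\<close>
  define C where "C = nat \<lceil>c\<rceil> + (\<Sum>i<N. f i)"
  have "f n \<le> C * (n + 1) ^ a" for n
  proof (cases "n < N")
    case True
    then have "f n \<le> (\<Sum>i<N. f i)"
      by (intro member_le_sum) auto
    also have "\<dots> \<le> C" by (simp add: C_def)
    also have "\<dots> \<le> C * (n + 1) ^ a" by simp
    finally show ?thesis .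
  next
    case False
    then have "real (f n) \<le> c * real n ^ a" using N by simp
    also have "\<dots> \<le> real C * real (n + 1) ^ a"
    proof (intro mult_mono power_mono)
      have "c \<le> real (nat \<lceil>c\<rceil>)" by linarith
      then show "c \<le> real C" unfolding C_def by linarith
    qed auto
    finally show ?thesis
      by (metis of_nat_le_iff of_nat_mult of_nat_power)
  qed
  then show "\<exists>C a. \<forall>n. f n \<le> C * (n + 1) ^ a" by blast
next
  assume "\<exists>C a. \<forall>n. f n \<le> C * (n + 1) ^ a"
  then obtain C a where C: "\<And>n. f n \<le> C * (n + 1) ^ a" by blast
  have "real (f n) \<le> (real C * 2 ^ a) * real n ^ a" if "n \<ge> 1" for n
  proof -
    have "real (f n) \<le> real C * real (n + 1) ^ a"
      using C[of n] by (metis of_nat_le_iff of_nat_mult of_nat_power)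
    also have "\<dots> \<le> real C * (2 * real n) ^ a"
      using that by (intro mult_left_mono power_mono) auto
    finally show ?thesis by (simp add: power_mult_distrib)
  qed
  then have "(\<lambda>n. real (f n)) \<in> O(\<lambda>n. real n ^ a)"
    by (intro bigoI[where c = "real C * 2 ^ a"]) (auto simp: eventually_at_top_linorder)
  then show "polynomially_bounded f"
    unfolding polynomially_bounded_def by blast
qed

lemma polynomially_bounded_const: "polynomially_bounded (\<lambda>n. c)"
  unfolding polynomially_bounded_iff by (rule exI[of _ c], rule exI[of _ 0]) simp

lemma polynomially_bounded_id: "polynomially_bounded (\<lambda>n. n)"
  unfolding polynomially_bounded_iff by (rule exI[of _ 1], rule exI[of _ 1]) simp

lemma polynomially_bounded_add:
  assumes "polynomially_bounded f" "polynomially_bounded g"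
  shows "polynomially_bounded (\<lambda>n. f n + g n)"
proof -
  obtain C a D b where f: "\<And>n. f n \<le> C * (n + 1) ^ a" and g: "\<And>n. g n \<le> D * (n + 1) ^ b"
    using assms unfolding polynomially_bounded_iff by blast
  have "f n + g n \<le> (C + D) * (n + 1) ^ (a + b)" for n
  proof -
    have "C * (n + 1) ^ a \<le> C * (n + 1) ^ (a + b)" "D * (n + 1) ^ b \<le> D * (n + 1) ^ (a + b)"
      by (intro mult_left_mono power_increasing; simp)+
    then show ?thesis using f[of n] g[of n] by (simp only: add_mult_distrib)
  qed
  then show ?thesis unfolding polynomially_bounded_iff by blast
qed

lemma polynomially_bounded_mult:
  assumes "polynomially_bounded f" "polynomially_bounded g"
  shows "polynomially_bounded (\<lambda>n. f n * g n)"
proof -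
  obtain C a D b where f: "\<And>n. f n \<le> C * (n + 1) ^ a" and g: "\<And>n. g n \<le> D * (n + 1) ^ b"
    using assms unfolding polynomially_bounded_iff by blast
  have "f n * g n \<le> (C * D) * (n + 1) ^ (a + b)" for n
    using mult_mono[OF f[of n] g[of n]] by (simp add: power_add mult_ac)
  then show ?thesis unfolding polynomially_bounded_iff by blast
qed

lemmas polynomially_bounded_intros =
  polynomially_bounded_const polynomially_bounded_id
  polynomially_bounded_add polynomially_bounded_mult

text \<open>For positive \<open>n\<close>, the number \<open>n + 1\<close> is at most 2 to the
  number of binary digits of \<open>n\<close>, so a word of length \<open>word_length c n\<close>
  has room for \<open>(n + 1) ^ c\<close>. The constant \<open>C\<close> is turned into further
  factors \<open>n + 1\<close>, each at least 2. For \<open>n = 0\<close> the word length is 0,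
  hence the restriction.\<close>

lemma polynomially_bounded_word_length:
  assumes "polynomially_bounded f"
  shows "\<exists>c. \<forall>n\<ge>1. f n < 2 ^ word_length c n"
proof -
  obtain C a where f: "\<And>n. f n \<le> C * (n + 1) ^ a"
    using assms unfolding polynomially_bounded_iff by blast
  have "f n < 2 ^ word_length (C + a) n" if "n \<ge> 1" for n
  proof -
    have *: "n + 1 \<le> 2 ^ floorlog 2 n"
      using that floorlog_bounds[of n 2] by simp
    have "C < 2 ^ C" by simp
    also have "\<dots> \<le> (n + 1) ^ C" using that by (intro power_mono) auto
    finally have "C * (n + 1) ^ a < (n + 1) ^ C * (n + 1) ^ a" by simp
    also have "\<dots> = (n + 1) ^ (C + a)" by (simp add: power_add)
    also have "\<dots> \<le> (2 ^ floorlog 2 n) ^ (C + a)" by (rule power_mono[OF *]) simp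
    also have "\<dots> = 2 ^ word_length (C + a) n"
      by (simp add: word_length_def power_mult[symmetric] mult.commute)
    finally show ?thesis using f[of n] by linarith
  qed
  then show ?thesis by blast
qed

section \<open>Prefixes of delayed predictions\<close>

fun serve_request :: "request \<Rightarrow> nat set set \<Rightarrow> nat set set" where
  "serve_request (Update e) E = flip e E"
| "serve_request Query E = E"

lemma mem_flip: "x \<in> flip e E \<longleftrightarrow> (x \<in> E) \<noteq> (x = e)"
  by (auto simp: flip_def)

text \<open>Flips of different edges do not interact and two flips of one edge cancel, so only the
  parity of the number of flips counts. The order of requests becomes irrelevant, and prefixes can
  be compared as multisets.\<close>

lemma mem_fold_serve_request:
  "e \<in> fold serve_request rs E \<longleftrightarrow> (e \<in> E) \<noteq> odd (count (mset rs) (Update e))"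
proof (induction rs arbitrary: E)
  case (Cons r rs)
  then show ?case by (cases r) (auto simp: mem_flip)
qed simp

lemma card_set_mset_le_size: "card (set_mset A) \<le> size A"
proof (induction A)
  case (add x A)
  then show ?case by (simp add: card_insert_if)
qed simp

lemma mset_nths_subset: "mset (nths xs I) \<subseteq># mset xs"
proof (induction xs arbitrary: I)
  case (Cons x xs)
  have "mset (nths xs {j. Suc j \<in> I}) \<subseteq># add_mset x (mset xs)"
    using Cons subset_mset.order_trans by (metis mset_subset_eq_add_left add_mset_add_single)
  with Cons show ?case by (simp add: nths_Cons)
qed simp

lemma take_nths: "take (card (I \<inter> {..<t})) (nths xs I) = nths (take t xs) I"
  if "I \<subseteq> {..<length xs}" for I :: "nat set"
proof -
  have "nths xs I = nths (take t xs) I @ nths (drop t xs) {j. j + length (take t xs) \<in> I}"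
    by (metis append_take_drop_id nths_append)
  moreover have "length (nths (take t xs) I) = card (I \<inter> {..<t})"
  proof -
    have "{i. i < length (take t xs) \<and> i \<in> I} = I \<inter> {..<t}" using that by auto
    then show ?thesis by (simp only: length_nths)
  qed
  ultimately show ?thesis by simp
qed

text \<open>At most \<open>length xs - t\<close> indices of \<open>I\<close> are \<open>t\<close> or
  larger, so at least \<open>t - k\<close> are smaller; hence the first \<open>t - k\<close>
  selected entries all come from the first \<open>t\<close> entries of \<open>xs\<close>.\<close>

lemma mset_take_nths_subset:
  assumes "I \<subseteq> {..<length xs}" "length xs \<le> card I + k" "t \<le> length xs"
  shows "mset (take (t - k) (nths xs I)) \<subseteq># mset (take t xs)"
proof -
  have fin: "finite I" using assms(1) finite_subset by blast
  have "card I = card (I \<inter> {..<t}) + card (I - {..<t})"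
    using card_Int_Diff[OF fin] .
  moreover have "card (I - {..<t}) \<le> card {t..<length xs}"
    using assms(1) by (intro card_mono) auto
  ultimately have le: "t - k \<le> card (I \<inter> {..<t})" using assms by simp
  have "take (t - k) (nths xs I) = take (t - k) (nths (take t xs) I)"
    unfolding take_nths[OF assms(1), symmetric] using le by (simp add: min_absorb1)
  moreover have "mset (take (t - k) (nths (take t xs) I)) \<subseteq># mset (nths (take t xs) I)"
    by (metis append_take_drop_id mset_append mset_subset_eq_add_left)
  moreover have "mset (nths (take t xs) I) \<subseteq># mset (take t xs)"
    by (rule mset_nths_subset)
  ultimately show ?thesis by (metis subset_mset.order_trans)
qed

text \<open>Entry \<open>j\<close> of \<open>xs\<close> reappears at position
  \<open>inv \<pi> j\<close> of the permuted list, which exceeds \<open>j\<close> by at most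
  \<open>d\<close>. Injectivity of \<open>inv \<pi>\<close> makes this an inclusion of
  multisets.\<close>

lemma mset_take_permute_subset:
  assumes "\<pi> permutes {..<length xs}" "close_to_id d (length xs) \<pi>"
  shows "mset (take (t - d) xs) \<subseteq># mset (take t (permute_list \<pi> xs))"
proof -
  define m where "m = length xs"
  \<comment> \<open>A prefix is written as the image of its index set, which reduces the inclusion
    of multisets to one of index sets.\<close>
  have *: "mset (take i ys) = image_mset ((!) ys) (mset_set {..<min i (length ys)})"
    for i and ys :: "'a list"
  proof -
    have "take i ys = map ((!) ys) [0..<min i (length ys)]"
      by (rule nth_equalityI) auto
    then have "mset (take i ys) = image_mset ((!) ys) (mset [0..<min i (length ys)])"
      by (metis mset_map)
    also have "mset [0..<min i (length ys)] = mset_set {..<min i (length ys)}"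
      by (metis atLeast0LessThan mset_upt)
    finally show ?thesis .
  qed
  let ?A = "{..<min (t - d) m}" and ?B = "{..<min t m}"
  have perm: "\<pi> permutes {..<m}" using assms m_def by simp
  have sub: "inv \<pi> ` ?A \<subseteq> ?B"
  proof
    fix x assume "x \<in> inv \<pi> ` ?A"
    then obtain j where j: "j < t - d" "j < m" "x = inv \<pi> j" by auto
    then have "\<bar>int x - int j\<bar> \<le> int d" using assms(2) by (simp add: close_to_id_def m_def)
    moreover have "x < m" using permutes_in_image[OF permutes_inv[OF perm], of j] j by simp
    ultimately show "x \<in> ?B" using j by auto
  qed
  have inj: "inj_on (inv \<pi>) ?A"
    using permutes_inj_on[OF permutes_inv[OF perm]] .
  have "mset (take (t - d) xs) = image_mset ((!) xs) (mset_set ?A)"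
    unfolding * m_def ..
  also have "\<dots> = image_mset (\<lambda>i. permute_list \<pi> xs ! i) (mset_set (inv \<pi> ` ?A))"
  proof -
    have "image_mset (\<lambda>i. permute_list \<pi> xs ! i) (mset_set (inv \<pi> ` ?A)) =
      image_mset ((\<lambda>i. permute_list \<pi> xs ! i) \<circ> inv \<pi>) (mset_set ?A)"
      using image_mset_mset_set[OF inj] by (metis multiset.map_comp)
    also have "\<dots> = image_mset ((!) xs) (mset_set ?A)"
    proof (rule image_mset_cong)
      fix j assume "j \<in># mset_set ?A"
      then have "j < m" by simp
      then have "inv \<pi> j < m" using permutes_in_image[OF permutes_inv[OF perm], of j] by simp
      then show "((\<lambda>i. permute_list \<pi> xs ! i) \<circ> inv \<pi>) j = xs ! j"
        using permutes_inverses(1)[OF perm] assms(1)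
        by (simp add: permute_list_nth m_def)
    qed
    finally show ?thesis ..
  qed
  also have "\<dots> \<subseteq># image_mset (\<lambda>i. permute_list \<pi> xs ! i) (mset_set ?B)"
    using sub by (intro image_mset_subseteq_mono) (simp add: subset_imp_msubset_mset_set)
  also have "\<dots> = mset (take t (permute_list \<pi> xs))"
    unfolding * m_def by simp
  finally show ?thesis .
qed

text \<open>The first \<open>t - k - d\<close> retained requests, in the order of
  \<open>\<rho>\<close>, lie in both prefixes: in \<open>\<rho>\<close> the omissions cost a shift
  of \<open>k\<close>, in \<open>\<rho>'\<close> the permutation costs \<open>d\<close> and the
  omissions cost \<open>k\<close>. Removing this common part leaves at most \<open>d + k\<close>
  requests of either prefix.\<close>

lemma delayed_prediction_prefix:
  assumes "delayed_prediction d k \<rho> \<rho>'" "t \<le> length \<rho>"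
  shows "size (mset (take t \<rho>) - mset (take t \<rho>')) \<le> d + k"
    and "size (mset (take t \<rho>') - mset (take t \<rho>)) \<le> d + k"
proof -
  obtain I I' m \<pi> where len: "length \<rho>' = length \<rho>" and I: "I \<subseteq> {..<length \<rho>}"
    "I' \<subseteq> {..<length \<rho>}" "card I = m" "card I' = m" "length \<rho> \<le> m + k"
    and \<pi>: "\<pi> permutes {..<m}" "close_to_id d m \<pi>" "permute_list \<pi> (nths \<rho> I) = nths \<rho>' I'"
    using assms(1) unfolding delayed_prediction_def by blast
  define X where "X = nths \<rho> I"
  have lenX: "length X = m"
  proof -
    have "{i. i < length \<rho> \<and> i \<in> I} = I" using I by auto
    then show ?thesis using I by (simp add: X_def length_nths)
  qed
  define C where "C = mset (take (t - k - d) X)"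
  have sC: "size C = t - k - d" using lenX I assms(2) by (simp add: C_def)
  have "C \<subseteq># mset (take (t - k) X)"
    unfolding C_def by (metis append_take_drop_id mset_append mset_subset_eq_add_left
        take_take min.absorb1 diff_le_self)
  also have "\<dots> \<subseteq># mset (take t \<rho>)"
    unfolding X_def using I assms(2) by (intro mset_take_nths_subset) auto
  finally have C1: "C \<subseteq># mset (take t \<rho>)" .
  have "C \<subseteq># mset (take (t - k) (permute_list \<pi> X))"
    unfolding C_def using \<pi> lenX by (intro mset_take_permute_subset) auto
  also have "\<dots> \<subseteq># mset (take t \<rho>')"
    unfolding X_def \<pi>(3) using I assms(2) len by (intro mset_take_nths_subset) auto
  finally have C2: "C \<subseteq># mset (take t \<rho>')" .
  have "size (mset (take t \<rho>) - mset (take t \<rho>')) \<le> size (mset (take t \<rho>) - C)"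
    using C2 by (intro size_mset_mono) (auto simp: subseteq_mset_def intro: diff_le_mono2)
  also have "\<dots> \<le> d + k" using size_Diff_submset[OF C1] sC assms(2) by simp
  finally show "size (mset (take t \<rho>) - mset (take t \<rho>')) \<le> d + k" .
  have "size (mset (take t \<rho>') - mset (take t \<rho>)) \<le> size (mset (take t \<rho>') - C)"
    using C1 by (intro size_mset_mono) (auto simp: subseteq_mset_def intro: diff_le_mono2)
  also have "\<dots> \<le> d + k" using size_Diff_submset[OF C2] sC assms(2) len by simp
  finally show "size (mset (take t \<rho>') - mset (take t \<rho>)) \<le> d + k" .
qed

text \<open>An edge on which the graphs disagree is flipped a different number of times in the two
  prefixes, so its request survives in one of the two multiset differences. \<open>D\<close> is
  given by its membership condition, so that the bound applies directly to the set of listed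
  edges.\<close>

lemma card_graph_difference_le:
  assumes "delayed_prediction d k \<rho> \<rho>'" "t \<le> length \<rho>"
    and D: "\<And>e. e \<in> D \<longleftrightarrow> (e \<in> fold serve_request (take t \<rho>) E) \<noteq>
                    (e \<in> fold serve_request (take t \<rho>') E)"
  shows "card D \<le> 2 * (d + k)"
proof -
  let ?A = "mset (take t \<rho>)" and ?B = "mset (take t \<rho>')"
  have "Update ` D \<subseteq> set_mset (?A - ?B) \<union> set_mset (?B - ?A)"
  proof
    fix x assume "x \<in> Update ` D"
    then obtain e where "e \<in> D" "x = Update e" by blast
    then have "count ?A x \<noteq> count ?B x"
      using D[of e] unfolding mem_fold_serve_request by metis
    then have "count ?A x > count ?B x \<or> count ?B x > count ?A x" by linarith
    then show "x \<in> set_mset (?A - ?B) \<union> set_mset (?B - ?A)"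
      by (auto simp: in_diff_count)
  qed
  then have "card (Update ` D) \<le> card (set_mset (?A - ?B) \<union> set_mset (?B - ?A))"
    by (intro card_mono) auto
  also have "\<dots> \<le> card (set_mset (?A - ?B)) + card (set_mset (?B - ?A))"
    by (rule card_Un_le)
  also have "\<dots> \<le> size (?A - ?B) + size (?B - ?A)"
    by (intro add_mono) (simp_all add: card_set_mset_le_size)
  also have "\<dots> \<le> 2 * (d + k)"
    using delayed_prediction_prefix[OF assms(1,2)] by simp
  finally show ?thesis by (simp add: card_image inj_on_def)
qed

section \<open>Triangles and common neighbours\<close>

definition codegree :: "nat \<Rightarrow> nat set set \<Rightarrow> nat \<Rightarrow> nat \<Rightarrow> nat" where
  "codegree n H u v = card {x \<in> {..<n}. {u, x} \<in> H \<and> {v, x} \<in> H}"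

lemma edgeE:
  assumes "e \<in> nsets {..<n} 2"
  obtains a b where "e = {a, b}" "a < b" "b < n" "Min e = a" "Max e = b"
proof -
  have "finite e" "card e = 2" "e \<subseteq> {..<n}" using assms by (auto simp: nsets_def)
  then obtain x y where xy: "e = {x, y}" "x \<noteq> y" by (meson card_2_iff)
  then show ?thesis
  proof (cases "x < y")
    case True
    then show ?thesis using xy \<open>e \<subseteq> {..<n}\<close> by (intro that[of x y]) auto
  next
    case False
    then show ?thesis using xy \<open>e \<subseteq> {..<n}\<close> by (intro that[of y x]) (auto simp: insert_commute)
  qed
qed

lemma doubleton_in_nsets: "{a, b} \<in> nsets {..<n} 2 \<longleftrightarrow> a < n \<and> b < n \<and> a \<noteq> b"
  by (auto simp: nsets_def card_insert_if)

lemma is_graph_flip: "is_graph n H \<Longrightarrow> e \<in> nsets {..<n} 2 \<Longrightarrow> is_graph n (flip e H)"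
  by (auto simp: is_graph_def flip_def)

lemma is_graph_no_loop: "is_graph n H \<Longrightarrow> {u} \<notin> H"
  by (auto simp: is_graph_def nsets_def)

lemma codegree_le: "codegree n H u v \<le> n"
proof -
  have "codegree n H u v \<le> card {..<n}"
    unfolding codegree_def by (intro card_mono) auto
  then show ?thesis by simp
qed

lemma codegree_commute: "codegree n H u v = codegree n H v u"
  unfolding codegree_def by (metis (no_types, lifting) conj_commute)

text \<open>The form in which the inner loop of the preprocessing accumulates this number.\<close>

lemma codegree_sum: "codegree n H u v = (\<Sum>x<n. of_bool ({u, x} \<in> H) * of_bool ({v, x} \<in> H))"
proof -
  have "(\<Sum>x<n. of_bool ({u, x} \<in> H) * of_bool ({v, x} \<in> H)) =
        (\<Sum>x<n. of_bool ({u, x} \<in> H \<and> {v, x} \<in> H) :: nat)"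
    by (intro sum.cong) auto
  also have "\<dots> = codegree n H u v"
    unfolding codegree_def by (simp add: sum.inter_filter[symmetric] of_bool_def Int_def)
  finally show ?thesis ..
qed

text \<open>The flip affects the single candidate \<open>x\<close>, which counts only if
  \<open>{x, v}\<close> is present. One of the two correction terms is 0, and the subtracted one is
  1 only if \<open>x\<close> was counted before, so truncation loses nothing. The right-hand side
  has the shape computed by \<open>add_signed\<close>.\<close>

lemma codegree_flip:
  assumes "is_graph n H" "u \<noteq> v" "x < n" "x \<noteq> u"
  shows "codegree n (flip {u, x} H) u v =
    codegree n H u v + of_bool ({x, v} \<in> H) * (1 - of_bool ({u, x} \<in> H))
      - of_bool ({x, v} \<in> H) * of_bool ({u, x} \<in> H)"
proof -
  define A where "A = {y \<in> {..<n}. {u, y} \<in> flip {u, x} H \<and> {v, y} \<in> flip {u, x} H}"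
  define B where "B = {y \<in> {..<n}. {u, y} \<in> H \<and> {v, y} \<in> H}"
  have loop: "{y} \<notin> H" for y using is_graph_no_loop assms(1) by blast
  have eq: "y \<in> A \<longleftrightarrow> y \<in> B" if "y \<noteq> x" for y
    using assms loop that by (auto simp: A_def B_def mem_flip doubleton_eq_iff)
  have x: "x \<in> A \<longleftrightarrow> {u, x} \<notin> H \<and> {x, v} \<in> H"
    using assms loop by (auto simp: A_def mem_flip doubleton_eq_iff insert_commute)
  have x': "x \<in> B \<longleftrightarrow> {u, x} \<in> H \<and> {x, v} \<in> H"
    using assms by (auto simp: B_def insert_commute)
  have fin: "finite B" by (auto simp: B_def)
  have cd: "codegree n (flip {u, x} H) u v = card A" "codegree n H u v = card B"
    by (simp_all add: codegree_def A_def B_def)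
  show ?thesis
  proof (cases "{x, v} \<in> H")
    case False
    then have "y \<in> A \<longleftrightarrow> y \<in> B" for y using eq[of y] x x' by (cases "y = x") auto
    then have "A = B" by blast
    then show ?thesis using False by (simp add: cd)
  next
    case True
    show ?thesis
    proof (cases "{u, x} \<in> H")
      case m: True
      have "y \<in> A \<longleftrightarrow> y \<in> B - {x}" for y using eq[of y] x m by (cases "y = x") auto
      then have "A = B - {x}" by blast
      then show ?thesis using True m x' fin by (simp add: cd)
    next
      case m: False
      have "y \<in> A \<longleftrightarrow> y \<in> insert x B" for y using eq[of y] x m True by (cases "y = x") auto
      then have "A = insert x B" by blast
      then show ?thesis using True m x' fin by (simp add: cd)
    qed
  qed
qed

lemma codegree_flip_other:
  assumes "u \<notin> e" "v \<notin> e"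
  shows "codegree n (flip e H) u v = codegree n H u v"
proof -
  have "{u, x} \<noteq> e" "{v, x} \<noteq> e" for x using assms by auto
  then show ?thesis by (simp add: codegree_def mem_flip)
qed

text \<open>A triangle through \<open>s\<close> is determined by its two other vertices, and
  \<open>x < v\<close> selects one of their two orders. That both differ from \<open>s\<close>
  follows from the absence of loops.\<close>

lemma triangles_at_sum:
  assumes "is_graph n H" "s < n"
  shows "triangles_at n s H =
    (\<Sum>v<n. \<Sum>x<n. of_bool ({s, x} \<in> H) * of_bool ({v, x} \<in> H) * of_bool ({s, v} \<in> H) * of_bool (x < v))"
proof -
  define P where "P = {(v, x). v < n \<and> x < v \<and> {s, x} \<in> H \<and> {v, x} \<in> H \<and> {s, v} \<in> H}"
  have Psub: "P \<subseteq> {..<n} \<times> {..<n}" by (auto simp: P_def)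
  have "(\<Sum>v<n. \<Sum>x<n. of_bool ({s, x} \<in> H) * of_bool ({v, x} \<in> H) * of_bool ({s, v} \<in> H) * of_bool (x < v))
     = (\<Sum>p\<in>{..<n} \<times> {..<n}. of_bool (p \<in> P) :: nat)"
    unfolding sum.cartesian_product by (intro sum.cong) (auto simp: P_def)
  also have "\<dots> = card P"
  proof -
    have "{p \<in> {..<n} \<times> {..<n}. p \<in> P} = P" using Psub by blast
    then show ?thesis by (simp add: sum.inter_filter[symmetric] of_bool_def)
  qed
  also have "\<dots> = card {V \<in> nsets {..<n} 3. s \<in> V \<and> nsets V 2 \<subseteq> H}"
  proof (rule bij_betw_same_card[where f = "\<lambda>(v, x). {s, v, x}"], unfold bij_betw_def, intro conjI)
    have ns: "x \<noteq> s" "v \<noteq> s" if "(v, x) \<in> P" for v x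
      using that is_graph_no_loop[OF assms(1), of s] by (auto simp: P_def)
    show "inj_on (\<lambda>(v, x). {s, v, x}) P"
    proof (rule inj_onI, clarify)
      fix v x v' x' assume *: "(v, x) \<in> P" "(v', x') \<in> P" "{s, v, x} = {s, v', x'}"
      then have "{v, x} = {v', x'}" using ns[OF *(1)] ns[OF *(2)] by auto
      moreover have "x < v" "x' < v'" using * by (auto simp: P_def)
      ultimately show "v = v' \<and> x = x'" by (auto simp: doubleton_eq_iff)
    qed
    show "(\<lambda>(v, x). {s, v, x}) ` P = {V \<in> nsets {..<n} 3. s \<in> V \<and> nsets V 2 \<subseteq> H}"
    proof (intro equalityI subsetI)
      fix V assume "V \<in> (\<lambda>(v, x). {s, v, x}) ` P"
      then obtain v x where V: "V = {s, v, x}" "(v, x) \<in> P" by auto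
      have d: "x \<noteq> s" "v \<noteq> s" "x < v" "v < n" "{s, x} \<in> H" "{v, x} \<in> H" "{s, v} \<in> H"
        using ns[OF V(2)] V(2) by (auto simp: P_def)
      have "nsets V 2 \<subseteq> H"
      proof
        fix e assume "e \<in> nsets V 2"
        then obtain p q where "e = {p, q}" "p \<noteq> q" "p \<in> V" "q \<in> V"
          by (auto simp: nsets_def card_2_iff)
        then show "e \<in> H" using V(1) d by (auto simp: insert_commute)
      qed
      then show "V \<in> {V \<in> nsets {..<n} 3. s \<in> V \<and> nsets V 2 \<subseteq> H}"
        using V(1) d assms(2) by (auto simp: nsets_def)
    next
      fix V assume "V \<in> {V \<in> nsets {..<n} 3. s \<in> V \<and> nsets V 2 \<subseteq> H}"
      then have V: "V \<subseteq> {..<n}" "finite V" "card V = 3" "s \<in> V" and sub: "nsets V 2 \<subseteq> H"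
        by (auto simp: nsets_def)
      then have "card (V - {s}) = 2" by simp
      then obtain p q where pq: "V - {s} = {p, q}" "p \<noteq> q" by (meson card_2_iff)
      then have VV: "V = {s, p, q}" "p \<noteq> s" "q \<noteq> s" using V(4) by auto
      have "{y, z} \<in> H" if "y \<in> V" "z \<in> V" "y \<noteq> z" for y z
      proof -
        have "{y, z} \<in> nsets V 2" using that by (simp add: nsets_def)
        then show ?thesis using sub by blast
      qed
      then have e: "{s, p} \<in> H" "{s, q} \<in> H" "{p, q} \<in> H" "{q, p} \<in> H"
        using VV pq(2) by auto
      show "V \<in> (\<lambda>(v, x). {s, v, x}) ` P"
      proof (cases "q < p")
        case True
        then have "(p, q) \<in> P" using e V(1) VV by (auto simp: P_def)
        then show ?thesis unfolding VV(1) by (rule rev_image_eqI) simp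
      next
        case False
        then have "(q, p) \<in> P" using e V(1) VV pq(2) by (auto simp: P_def)
        then show ?thesis unfolding VV(1) by (rule rev_image_eqI) auto
      qed
    qed
  qed
  finally show ?thesis by (simp add: triangles_at_def)
qed

lemma triangles_at_le:
  assumes "is_graph n H" "s < n"
  shows "triangles_at n s H \<le> n * n"
proof -
  have "triangles_at n s H \<le> (\<Sum>v<n. \<Sum>x<n. 1)"
    unfolding triangles_at_sum[OF assms] by (intro sum_mono) auto
  then show ?thesis by simp
qed

text \<open>For \<open>a \<noteq> b\<close>, the number of triangles through \<open>s\<close> that
  have \<open>{a, b}\<close> as a side as soon as this edge is present. If \<open>s\<close> is not
  an endpoint, it must be the third vertex.\<close>

definition flip_gain :: "nat \<Rightarrow> nat \<Rightarrow> nat set set \<Rightarrow> nat \<Rightarrow> nat \<Rightarrow> nat" where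
  "flip_gain n s H a b = (if a = s then codegree n H s b else if b = s then codegree n H s a
     else of_bool ({s, a} \<in> H) * of_bool ({s, b} \<in> H))"

lemma flip_gain_le: "s < n \<Longrightarrow> flip_gain n s H a b \<le> n"
  using codegree_le by (auto simp: flip_gain_def)

text \<open>Every new triangle has \<open>{a, b}\<close> as a side and is determined by its third
  vertex. This vertex is a common neighbour of \<open>a\<close> and \<open>b\<close>, and it is
  \<open>s\<close> itself unless \<open>s\<close> is an endpoint.\<close>

lemma triangles_at_insert:
  assumes "is_graph n H" "s < n" "a < n" "b < n" "a \<noteq> b" "{a, b} \<notin> H"
  shows "triangles_at n s (insert {a, b} H) = triangles_at n s H + flip_gain n s H a b"
proof -
  let ?T = "\<lambda>H. {V \<in> nsets {..<n} 3. s \<in> V \<and> nsets V 2 \<subseteq> H}"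
  define N where "N = ?T (insert {a, b} H) - ?T H"
  have fin: "finite (?T H')" for H'
  proof (rule finite_subset)
    show "?T H' \<subseteq> Pow {..<n}" by (auto simp: nsets_def)
  qed simp
  have "finite N" using fin by (simp add: N_def)
  have "?T (insert {a, b} H) = ?T H \<union> N" by (auto simp: N_def)
  then have "card (?T (insert {a, b} H)) = card (?T H \<union> N)" by (rule arg_cong)
  also have "\<dots> = card (?T H) + card N"
    by (rule card_Un_disjoint[OF fin \<open>finite N\<close>]) (auto simp: N_def)
  finally have "card (?T (insert {a, b} H)) = card (?T H) + card N" .
  moreover have "card N = flip_gain n s H a b"
  proof -
    define X where "X = {x. x < n \<and> x \<noteq> a \<and> x \<noteq> b \<and> {a, x} \<in> H \<and> {b, x} \<in> H \<and> s \<in> {a, b, x}}"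
    have inN: "V \<in> N \<longleftrightarrow> (\<exists>x\<in>X. V = {a, b, x})" for V
    proof
      assume VN: "V \<in> N"
      then have V: "V \<subseteq> {..<n}" "card V = 3" "finite V" "s \<in> V" "nsets V 2 \<subseteq> insert {a, b} H"
        "\<not> nsets V 2 \<subseteq> H" by (auto simp: N_def nsets_def)
      then have "{a, b} \<in> nsets V 2" by blast
      then have ab: "a \<in> V" "b \<in> V" by (auto simp: nsets_def)
      have "card (V - {a, b}) = 1" using V ab assms(5) by (simp add: card_Diff_subset)
      then obtain x where x: "V - {a, b} = {x}" by (meson card_1_singletonE)
      then have VV: "V = {a, b, x}" "x \<noteq> a" "x \<noteq> b" using ab by auto
      have "{a, x} \<in> nsets V 2" "{b, x} \<in> nsets V 2" using VV by (auto simp: nsets_def)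
      then have "{a, x} \<in> insert {a, b} H" "{b, x} \<in> insert {a, b} H" using V(5) by blast+
      then have "{a, x} \<in> H" "{b, x} \<in> H" using VV assms(5) by (auto simp: doubleton_eq_iff)
      then show "\<exists>x\<in>X. V = {a, b, x}" using VV V by (auto simp: X_def)
    next
      assume "\<exists>x\<in>X. V = {a, b, x}"
      then obtain x where x: "x \<in> X" "V = {a, b, x}" by blast
      then have d: "x < n" "x \<noteq> a" "x \<noteq> b" "{a, x} \<in> H" "{b, x} \<in> H" "s \<in> V"
        by (auto simp: X_def)
      have "nsets V 2 \<subseteq> insert {a, b} H"
      proof
        fix e assume "e \<in> nsets V 2"
        then obtain p q where "e = {p, q}" "p \<noteq> q" "p \<in> V" "q \<in> V"
          by (auto simp: nsets_def card_2_iff)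
        then show "e \<in> insert {a, b} H" using x(2) d by (auto simp: insert_commute)
      qed
      moreover have "{a, b} \<in> nsets V 2" using x(2) assms(5) by (auto simp: nsets_def)
      moreover have "V \<in> nsets {..<n} 3" using x(2) d assms by (auto simp: nsets_def)
      ultimately show "V \<in> N" using assms(6) \<open>s \<in> V\<close> unfolding N_def by blast
    qed
    have "N = (\<lambda>x. {a, b, x}) ` X" using inN by blast
    moreover have "inj_on (\<lambda>x. {a, b, x}) X"
      by (rule inj_onI) (auto simp: X_def)
    ultimately have cN: "card N = card X" by (simp add: card_image)
    have loop: "{y} \<notin> H" for y using is_graph_no_loop assms(1) by blast
    show ?thesis
    proof (cases "s = a \<or> s = b")
      case True
      \<comment> \<open>A common neighbour of \<open>a\<close> and \<open>b\<close> that equals one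
        of them would yield a loop, so the inequalities in \<open>X\<close> hold
        automatically.\<close>
      then have "X = {x \<in> {..<n}. {a, x} \<in> H \<and> {b, x} \<in> H}"
        using loop assms(6) by (auto simp: X_def insert_commute)
      then have "card X = codegree n H a b" by (simp add: codegree_def)
      then show ?thesis using cN True by (auto simp: flip_gain_def codegree_commute)
    next
      case False
      then have "X = (if {s, a} \<in> H \<and> {s, b} \<in> H then {s} else {})"
        using assms by (auto simp: X_def insert_commute)
      then show ?thesis using cN False by (auto simp: flip_gain_def)
    qed
  qed
  ultimately show ?thesis by (simp add: triangles_at_def)
qed

text \<open>The gain does not depend on the edge \<open>{a, b}\<close> itself, since a candidate
  equal to an endpoint would require a loop. This allows a deletion to be read as an insertion
  undone.\<close>

lemma flip_gain_flip:
  assumes "is_graph n H" "a \<noteq> b"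
  shows "flip_gain n s (flip {a, b} H) a b = flip_gain n s H a b"
proof -
  have loop: "{y} \<notin> H" for y using is_graph_no_loop assms(1) by blast
  have *: "codegree n (flip {p, q} H) p q = codegree n H p q" if "p \<noteq> q" for p q
  proof -
    have "{p, x} \<in> flip {p, q} H \<and> {q, x} \<in> flip {p, q} H \<longleftrightarrow> {p, x} \<in> H \<and> {q, x} \<in> H" for x
      using loop that by (auto simp: mem_flip doubleton_eq_iff)
    then show ?thesis by (simp add: codegree_def)
  qed
  show ?thesis
    using *[of a b] *[of b a] assms(2)
    by (auto simp: flip_gain_def mem_flip doubleton_eq_iff insert_commute)
qed

lemma triangles_at_flip:
  assumes "is_graph n H" "s < n" "a < n" "b < n" "a \<noteq> b"
  shows "triangles_at n s (flip {a, b} H) =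
    triangles_at n s H + flip_gain n s H a b * (1 - of_bool ({a, b} \<in> H))
      - flip_gain n s H a b * of_bool ({a, b} \<in> H)"
proof (cases "{a, b} \<in> H")
  case False
  then show ?thesis using triangles_at_insert[OF assms] by (simp add: flip_def)
next
  case True
  \<comment> \<open>The graph without the edge serves as the starting point of an insertion that
    leads back to \<open>H\<close>.\<close>
  let ?H = "flip {a, b} H"
  have "is_graph n ?H" using assms by (simp add: is_graph_flip doubleton_in_nsets)
  moreover have "{a, b} \<notin> ?H" using True by (simp add: flip_def)
  moreover have "insert {a, b} ?H = H" using True by (auto simp: flip_def)
  ultimately have "triangles_at n s H = triangles_at n s ?H + flip_gain n s ?H a b"
    using triangles_at_insert[of n ?H s a b] assms by simp
  then show ?thesis using True flip_gain_flip[OF assms(1,5)] by simp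
qed

section \<open>Running word RAM programs\<close>

text \<open>A total-correctness Hoare triple with a time budget, where a concrete initial state
  takes the place of the precondition.\<close>

definition runs :: "nat \<Rightarrow> com \<Rightarrow> ram_state \<Rightarrow> nat \<Rightarrow> (ram_state \<Rightarrow> bool) \<Rightarrow> bool" where
  "runs w p st b Q \<longleftrightarrow> (\<exists>t st'. exec w p st t st' \<and> t \<le> b \<and> Q st')"

section \<open>Loop-free programs as functions on states\<close>

fun straight :: "com \<Rightarrow> bool" where
  "straight Skip = True"
| "straight (Assign r a) = True"
| "straight (Store a b) = True"
| "straight (Seq p q) = (straight p \<and> straight q)"
| "straight (If b p q) = (straight p \<and> straight q)"
| "straight (While b p) = False"

fun cost :: "com \<Rightarrow> nat" where
  "cost Skip = 1"
| "cost (Assign r a) = 1 + expr_cost a"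
| "cost (Store a b) = 1 + expr_cost a + expr_cost b"
| "cost (Seq p q) = cost p + cost q"
| "cost (If b p q) = 1 + expr_cost b + max (cost p) (cost q)"
| "cost (While b p) = 0"

fun sem :: "nat \<Rightarrow> com \<Rightarrow> ram_state \<Rightarrow> ram_state" where
  "sem w Skip st = st"
| "sem w (Assign r a) st = ((fst st)(r := eval_expr w a st), snd st)"
| "sem w (Store a b) st = (fst st, (snd st)(eval_expr w a st := eval_expr w b st))"
| "sem w (Seq p q) st = sem w q (sem w p st)"
| "sem w (If b p q) st = (if eval_expr w b st \<noteq> 0 then sem w p st else sem w q st)"
| "sem w (While b p) st = st"

text \<open>Lets the simplifier execute loop-free code. \<open>cost\<close> charges the more
  expensive branch, hence the inequality; the \<open>While\<close> clauses of \<open>cost\<close>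
  and \<open>sem\<close> are placeholders that \<open>straight\<close> excludes.\<close>

lemma straight_exec: "straight p \<Longrightarrow> \<exists>t\<le>cost p. exec w p st t (sem w p st)"
proof (induction p arbitrary: st)
  case (Seq p q)
  obtain t1 where "t1 \<le> cost p" "exec w p st t1 (sem w p st)"
    using Seq.IH(1)[of st] Seq.prems by auto
  moreover obtain t2 where "t2 \<le> cost q" "exec w q (sem w p st) t2 (sem w q (sem w p st))"
    using Seq.IH(2)[of "sem w p st"] Seq.prems by auto
  ultimately show ?case by (intro exI[of _ "t1 + t2"]) (auto intro: exec.Seq)
next
  case (If b p q)
  show ?case
  proof (cases "eval_expr w b st = 0")
    case True
    obtain t where "t \<le> cost q" "exec w q st t (sem w q st)"
      using If.IH(2)[of st] If.prems by auto
    then show ?thesis using True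
      by (intro exI[of _ "1 + expr_cost b + t"]) (auto intro: exec.IfFalse simp del: One_nat_def)
  next
    case False
    obtain t where "t \<le> cost p" "exec w p st t (sem w p st)"
      using If.IH(1)[of st] If.prems by auto
    then show ?thesis using False
      by (intro exI[of _ "1 + expr_cost b + t"]) (auto intro: exec.IfTrue simp del: One_nat_def)
  qed
next
  case Skip
  show ?case by (intro exI[of _ 1]) (simp add: exec.Skip[unfolded One_nat_def])
next
  case (Assign r a)
  show ?case using exec.Assign[of w r a st] by (intro exI[of _ "1 + expr_cost a"]) simp
next
  case (Store a b)
  show ?case using exec.Store[of w a b st] by (intro exI[of _ "1 + expr_cost a + expr_cost b"]) simp
qed simp

lemma runs_straight:
  assumes "straight p" "cost p \<le> b" "Q (sem w p st)"
  shows "runs w p st b Q"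
proof -
  obtain t where "t \<le> cost p" "exec w p st t (sem w p st)" using straight_exec[OF assms(1)] by blast
  then have "exec w p st t (sem w p st) \<and> t \<le> b \<and> Q (sem w p st)" using assms by simp
  then show ?thesis unfolding runs_def by blast
qed

section \<open>Composition rules for timed triples\<close>

lemma runs_mono:
  assumes "runs w p st b Q" "b \<le> b'" "\<And>st'. Q st' \<Longrightarrow> Q' st'"
  shows "runs w p st b' Q'"
proof -
  obtain t st' where "exec w p st t st'" "t \<le> b" "Q st'" using assms(1) unfolding runs_def by blast
  then have "exec w p st t st' \<and> t \<le> b' \<and> Q' st'" using assms by simp
  then show ?thesis unfolding runs_def by blast
qed

lemma runs_Seq:
  assumes "runs w p st b1 Q1" "\<And>st'. Q1 st' \<Longrightarrow> runs w q st' b2 Q" "b1 + b2 \<le> b"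
  shows "runs w (Seq p q) st b Q"
proof -
  obtain t1 st1 where 1: "exec w p st t1 st1" "t1 \<le> b1" "Q1 st1"
    using assms(1) unfolding runs_def by blast
  obtain t2 st2 where 2: "exec w q st1 t2 st2" "t2 \<le> b2" "Q st2"
    using assms(2)[OF 1(3)] unfolding runs_def by blast
  have "t1 + t2 \<le> b" using 1 2 assms(3) by simp
  then show ?thesis unfolding runs_def using exec.Seq[OF 1(1) 2(1)] 2(3) by blast
qed

lemma runs_If:
  assumes "eval_expr w c st \<noteq> 0 \<Longrightarrow> runs w p st t Q" "eval_expr w c st = 0 \<Longrightarrow> runs w q st t Q"
    "1 + expr_cost c + t \<le> b"
  shows "runs w (If c p q) st b Q"
proof -
  obtain t' st' where "exec w (If c p q) st (1 + expr_cost c + t') st'" "t' \<le> t" "Q st'"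
    using assms(1,2) exec.IfTrue exec.IfFalse unfolding runs_def by metis
  then show ?thesis unfolding runs_def using assms(3) by (meson add_left_mono order_trans)
qed

text \<open>The invariant is indexed by the number of finished rounds, of which there are exactly
  \<open>N\<close>; this settles termination along with correctness. The last summand of the budget
  pays for the final, failing test.\<close>

lemma runs_While:
  assumes "I 0 st"
    and step: "\<And>i st. i < N \<Longrightarrow> I i st \<Longrightarrow> eval_expr w c st \<noteq> 0 \<and> runs w p st t (I (Suc i))"
    and fin: "\<And>st. I N st \<Longrightarrow> eval_expr w c st = 0"
    and post: "\<And>st. I N st \<Longrightarrow> Q st"
    and b: "N * (1 + expr_cost c + t) + (1 + expr_cost c) \<le> b"
  shows "runs w (While c p) st b Q"
proof -
  \<comment> \<open>Generalised to the last \<open>k\<close> rounds, entered with invariant index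
    \<open>i\<close>.\<close>
  have "runs w (While c p) st (k * (1 + expr_cost c + t) + (1 + expr_cost c)) (I N)"
    if "i + k = N" "I i st" for i k st
    using that
  proof (induction k arbitrary: i st)
    case 0
    then have "I N st" by simp
    then show ?case unfolding runs_def
      using exec.WhileFalse[OF fin[of st], of p] by (intro exI[of _ "1 + expr_cost c"] exI[of _ st]) simp
  next
    case (Suc k)
    then have "eval_expr w c st \<noteq> 0" "runs w p st t (I (Suc i))" using step[of i st] by auto
    then obtain t1 st1 where 1: "exec w p st t1 st1" "t1 \<le> t" "I (Suc i) st1"
      unfolding runs_def by blast
    have "runs w (While c p) st1 (k * (1 + expr_cost c + t) + (1 + expr_cost c)) (I N)"
      using Suc.IH[of "Suc i" st1] Suc.prems 1(3) by simp
    then obtain t2 st2 where 2: "exec w (While c p) st1 t2 st2"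
      "t2 \<le> k * (1 + expr_cost c + t) + (1 + expr_cost c)" "I N st2"
      unfolding runs_def by blast
    have "exec w (While c p) st (1 + expr_cost c + t1 + t2) st2"
      by (rule exec.WhileTrue[OF \<open>eval_expr w c st \<noteq> 0\<close> 1(1) 2(1)])
    moreover have "1 + expr_cost c + t1 + t2 \<le> Suc k * (1 + expr_cost c + t) + (1 + expr_cost c)"
      using 1(2) 2(2) by simp
    ultimately show ?case unfolding runs_def using 2(3) by blast
  qed
  from this[of 0 N st] have "runs w (While c p) st (N * (1 + expr_cost c + t) + (1 + expr_cost c)) (I N)"
    using assms(1) by simp
  then show ?thesis using b post by (rule runs_mono)
qed

section \<open>The programs\<close>

text \<open>
  Registers 2 to 8 hold \<open>n\<close>, \<open>s\<close>, \<open>T\<close> and the base addresses of the prediction, the position matrix,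
  the list of differences and the table; 9 to 11 the time, the length of the list and the triangle
  count. Subroutines take their arguments in 12 to 15, and from 16 on everything is scratch.
\<close>

abbreviation (input) "rn \<equiv> 2 :: nat"
abbreviation (input) "rs \<equiv> 3 :: nat"
abbreviation (input) "rT \<equiv> 4 :: nat"
abbreviation (input) "rP \<equiv> 5 :: nat"
abbreviation (input) "rD \<equiv> 6 :: nat"
abbreviation (input) "rL \<equiv> 7 :: nat"
abbreviation (input) "rX \<equiv> 8 :: nat"
abbreviation (input) "rt \<equiv> 9 :: nat"
abbreviation (input) "rm \<equiv> 10 :: nat"
abbreviation (input) "rcnt \<equiv> 11 :: nat"
abbreviation (input) "ra \<equiv> 12 :: nat"
abbreviation (input) "rb \<equiv> 13 :: nat"
abbreviation (input) "rv \<equiv> 14 :: nat"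
abbreviation (input) "rj \<equiv> 15 :: nat"
abbreviation (input) "rc \<equiv> 16 :: nat"
abbreviation (input) "rq \<equiv> 17 :: nat"
abbreviation (input) "rx \<equiv> 18 :: nat"
abbreviation (input) "ry \<equiv> 19 :: nat"
abbreviation (input) "rz \<equiv> 20 :: nat"
abbreviation (input) "rp \<equiv> 21 :: nat"
abbreviation (input) "rp' \<equiv> 22 :: nat"

text \<open>The adjacency matrix is kept where the input has placed it, behind the three header
  words \<open>n\<close>, \<open>s\<close> and \<open>T\<close>.\<close>

definition adjA :: "nat \<Rightarrow> nat \<Rightarrow> expr" where
  "adjA u v = Bin Add (Const 3) (Bin Add (Bin Mul (Reg u) (Reg rn)) (Reg v))"
definition prdA :: "nat \<Rightarrow> nat \<Rightarrow> expr" where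
  "prdA q i = Bin Add (Reg rP) (Bin Add (Bin Mul (Const 3) (Reg q)) (Const i))"
definition posA :: "nat \<Rightarrow> nat \<Rightarrow> expr" where
  "posA u v = Bin Add (Reg rD) (Bin Add (Bin Mul (Reg u) (Reg rn)) (Reg v))"
definition lstA :: "nat \<Rightarrow> expr" where
  "lstA q = Bin Add (Reg rL) (Reg q)"
text \<open>A row has \<open>n + 1\<close> entries: one common neighbour count for each vertex, and
  the triangle count in column \<open>n\<close>.\<close>

definition tabA :: "nat \<Rightarrow> nat \<Rightarrow> expr" where
  "tabA t v = Bin Add (Reg rX) (Bin Add (Bin Mul (Reg t) (Bin Add (Reg rn) (Const 1))) (Reg v))"

text \<open>
  Whether the edge lies in the predicted graph after the first \<open>q\<close> listed differences have been
  corrected: the matrix describes the fully corrected graph, and an edge whose one-based list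
  position exceeds \<open>q\<close> has still to be flipped back. Position 0 means that the edge is not listed.
\<close>

definition memE :: "nat \<Rightarrow> nat \<Rightarrow> nat \<Rightarrow> expr" where
  "memE u v q = Bin Sub (Const 1) (Bin Equal (Load (adjA u v)) (Bin Less (Reg q) (Load (posA u v))))"

text \<open>Adding before subtracting keeps the truncated subtraction exact.\<close>

definition add_signed :: "nat \<Rightarrow> expr \<Rightarrow> expr \<Rightarrow> com" where
  "add_signed r g m = Assign r (Bin Sub (Bin Add (Reg r) (Bin Mul g (Bin Sub (Const 1) m))) (Bin Mul g m))"

definition load_edge :: "nat \<Rightarrow> nat \<Rightarrow> nat \<Rightarrow> com" where
  "load_edge q u v = Seq (Assign rz (Load (lstA q)))
     (Seq (Assign u (Bin Div (Reg rz) (Reg rn))) (Assign v (Bin Mod (Reg rz) (Reg rn))))"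

text \<open>
  Flipping \<open>{p, p'}\<close> affects the common neighbours of \<open>s\<close> and \<open>v\<close> only through the edge \<open>{x, y}\<close>
  selected here; if it does not affect them at all, the loop \<open>{s, s}\<close> is selected, which is never present.
\<close>

definition codegree_select :: com where
  "codegree_select =
     If (Bin Equal (Reg rp) (Reg rs)) (Seq (Assign rx (Reg rp')) (Assign ry (Reg rv)))
    (If (Bin Equal (Reg rp') (Reg rs)) (Seq (Assign rx (Reg rp)) (Assign ry (Reg rv)))
    (If (Bin Equal (Reg rp) (Reg rv)) (Seq (Assign rx (Reg rp')) (Assign ry (Reg rs)))
    (If (Bin Equal (Reg rp') (Reg rv)) (Seq (Assign rx (Reg rp)) (Assign ry (Reg rs)))
        (Seq (Assign rx (Reg rs)) (Assign ry (Reg rs))))))"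

definition codegree_body :: com where
  "codegree_body = Seq (load_edge rq rp rp') (Seq codegree_select
     (Seq (add_signed rc (memE rx ry rq) (memE rp rp' rq)) (Assign rq (Bin Add (Reg rq) (Const 1)))))"

definition codegree_prog :: com where
  "codegree_prog = Seq (Seq (Assign rc (Load (tabA rt rv))) (Assign rq (Const 0)))
     (While (Bin Less (Reg rq) (Reg rj)) codegree_body)"

text \<open>Works on the graph in which the first \<open>rj\<close> differences are corrected. An
  update calls it with the full list length, hence on the actual graph; a query calls it with
  increasing values.\<close>

definition count_flip_prog :: com where
  "count_flip_prog = Seq
     (If (Bin Equal (Reg ra) (Reg rs)) (Seq (Assign rv (Reg rb)) codegree_prog)
     (If (Bin Equal (Reg rb) (Reg rs)) (Seq (Assign rv (Reg ra)) codegree_prog)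
         (Assign rc (Bin Mul (memE rs ra rj) (memE rs rb rj)))))
     (add_signed rcnt (Reg rc) (memE ra rb rj))"

text \<open>An unlisted edge is appended; a listed one is overwritten by the last entry, since the
  order of the list carries no meaning between requests. Clearing the positions of the deleted edge
  comes last on purpose.\<close>

definition toggle_prog :: com where
  "toggle_prog = Seq (Assign rp (Load (posA ra rb)))
     (If (Bin Equal (Reg rp) (Const 0))
       (Seq (Store (lstA rm) (Bin Add (Bin Mul (Reg ra) (Reg rn)) (Reg rb)))
       (Seq (Assign rm (Bin Add (Reg rm) (Const 1)))
       (Seq (Store (posA ra rb) (Reg rm)) (Store (posA rb ra) (Reg rm)))))
       (Seq (Assign rm (Bin Sub (Reg rm) (Const 1)))
       (Seq (load_edge rm rx ry)
       (Seq (Assign rp' (Bin Sub (Reg rp) (Const 1)))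
       (Seq (Store (lstA rp') (Reg rz))
       (Seq (Store (posA rx ry) (Reg rp))
       (Seq (Store (posA ry rx) (Reg rp))
       (Seq (Store (posA ra rb) (Const 0)) (Store (posA rb ra) (Const 0))))))))))"

definition advance_prog :: com where
  "advance_prog = Seq
     (If (Load (prdA rt 0))
        (Seq (Seq (Assign ra (Load (prdA rt 1))) (Assign rb (Load (prdA rt 2)))) toggle_prog) Skip)
     (Assign rt (Bin Add (Reg rt) (Const 1)))"

text \<open>Writes the exclusive or of the matrix entry and the bit \<open>c\<close>. With the tag
  of a request as \<open>c\<close>, a predicted query, encoded by zeros, rewrites the entry
  \<open>(0, 0)\<close> with its own value, so queries and flips share the same code.\<close>

definition flip_prog :: "expr \<Rightarrow> com" where
  "flip_prog c = Seq (Assign rz (Bin Sub (Const 1) (Bin Equal (Load (adjA ra rb)) c)))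
     (Seq (Store (adjA ra rb) (Reg rz)) (Store (adjA rb ra) (Reg rz)))"

definition load_args :: com where
  "load_args = Seq (Assign ra (Reg 0)) (Assign rb (Reg 1))"

definition record_update :: com where
  "record_update = Seq toggle_prog (Seq (flip_prog (Const 1)) advance_prog)"

definition replay_prog :: com where
  "replay_prog = Seq (Seq (Assign rcnt (Load (tabA rt rn))) (Assign rj (Const 0)))
     (While (Bin Less (Reg rj) (Reg rm))
        (Seq (load_edge rj ra rb) (Seq count_flip_prog (Assign rj (Bin Add (Reg rj) (Const 1))))))"

definition predicted_flip :: com where
  "predicted_flip = Seq (Seq (Assign ra (Load (prdA rt 1))) (Assign rb (Load (prdA rt 2))))
     (flip_prog (Load (prdA rt 0)))"

text \<open>One scan over the vertices yields both the common neighbours of \<open>s\<close> and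
  \<open>v\<close>, in \<open>rc\<close>, and the triangles through \<open>s\<close> whose larger
  other vertex is \<open>v\<close>, added to \<open>rcnt\<close>.\<close>

definition entry_prog :: com where
  "entry_prog = Seq (Seq (Assign rc (Const 0)) (Assign rx (Const 0)))
     (Seq (While (Bin Less (Reg rx) (Reg rn))
       (Seq (Assign rz (Bin Mul (Load (adjA rs rx)) (Load (adjA rv rx))))
       (Seq (Assign rc (Bin Add (Reg rc) (Reg rz)))
       (Seq (Assign rcnt (Bin Add (Reg rcnt)
              (Bin Mul (Bin Mul (Reg rz) (Load (adjA rs rv))) (Bin Less (Reg rx) (Reg rv)))))
            (Assign rx (Bin Add (Reg rx) (Const 1)))))))
     (Seq (Store (tabA rt rv) (Reg rc)) (Assign rv (Bin Add (Reg rv) (Const 1)))))"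

definition row_prog :: com where
  "row_prog = Seq (Seq (Assign rcnt (Const 0)) (Assign rv (Const 0)))
     (Seq (While (Bin Less (Reg rv) (Reg rn)) entry_prog) (Store (tabA rt rn) (Reg rcnt)))"

definition setup_prog :: com where
  "setup_prog = Seq (Assign rn (Load (Const 0))) (Seq (Assign rs (Load (Const 1)))
     (Seq (Assign rT (Load (Const 2)))
     (Seq (Assign rP (Bin Add (Const 3) (Bin Mul (Reg rn) (Reg rn))))
     (Seq (Assign rD (Bin Add (Reg rP) (Bin Mul (Const 3) (Reg rT))))
     (Seq (Assign rL (Bin Add (Reg rD) (Bin Mul (Reg rn) (Reg rn))))
          (Assign rX (Bin Add (Reg rL) (Bin Mul (Reg rn) (Reg rn)))))))))"

text \<open>A single matrix suffices: the forward loop carries it to the final predicted graph, and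
  the backward loop undoes the requests while filling the rows. It ends with the initial graph in
  the matrix, time 0, and, if there are requests at all, the initial triangle count in
  \<open>rcnt\<close>, just as the first request expects.\<close>

definition table_prog :: com where
  "table_prog = Seq setup_prog
     (Seq (While (Bin Less (Reg rt) (Reg rT))
            (Seq predicted_flip (Assign rt (Bin Add (Reg rt) (Const 1)))))
          (While (Bin Less (Const 0) (Reg rt))
            (Seq (Assign rt (Bin Sub (Reg rt) (Const 1))) (Seq predicted_flip row_prog))))"

text \<open>The count is adjusted before the edge is recorded, while the list still describes the
  difference at the current time.\<close>

definition fast_query_algorithm :: dyn_algorithm where
  "fast_query_algorithm = \<lparr>preprocess_prog = table_prog,
     update_prog = Seq (Seq load_args (Assign rj (Reg rm))) (Seq count_flip_prog record_update),
     query_prog = Seq (Assign 0 (Reg rcnt)) advance_prog\<rparr>"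

definition fast_update_algorithm :: dyn_algorithm where
  "fast_update_algorithm = \<lparr>preprocess_prog = table_prog,
     update_prog = Seq load_args record_update,
     query_prog = Seq replay_prog (Seq (Assign 0 (Reg rcnt)) advance_prog)\<rparr>"

lemmas expr_defs = adjA_def prdA_def posA_def lstA_def tabA_def memE_def add_signed_def load_edge_def

section \<open>Memory layout\<close>

text \<open>Symbolic addresses: with \<open>addr\<close> injective on valid cells, aliasing is
  decided by the constructors and their arguments.\<close>

datatype cell = Adj nat nat | Prd nat nat | Pos nat nat | Lst nat | Tab nat nat

text \<open>\<open>big\<close> leaves room for all memory blocks, all counters and all counts; the
  summand 10 makes literals below 10 exact.\<close>

locale ram_instance =
  fixes n s T w W :: nat and E :: "nat set set" and pr :: "request list"
  assumes W: "W = 2 ^ w" and big: "10 + 3 * (n * n) + 3 * T + (T + 1) * (n + 1) \<le> W"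
    and s: "s < n" and E: "is_graph n E"
    and pr: "length pr = T" "valid_requests n pr"
begin

primrec addr :: "cell \<Rightarrow> nat" where
  "addr (Adj u v) = 3 + (u * n + v)"
| "addr (Prd q i) = 3 + n * n + (3 * q + i)"
| "addr (Pos u v) = 3 + n * n + 3 * T + (u * n + v)"
| "addr (Lst q) = 3 + 2 * (n * n) + 3 * T + q"
| "addr (Tab t v) = 3 + 3 * (n * n) + 3 * T + (t * (n + 1) + v)"

primrec valid_cell :: "cell \<Rightarrow> bool" where
  "valid_cell (Adj u v) \<longleftrightarrow> u < n \<and> v < n"
| "valid_cell (Prd q i) \<longleftrightarrow> q < T \<and> i < 3"
| "valid_cell (Pos u v) \<longleftrightarrow> u < n \<and> v < n"
| "valid_cell (Lst q) \<longleftrightarrow> q < n * n"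
| "valid_cell (Tab t v) \<longleftrightarrow> t < T \<and> v \<le> n"

lemma (in -) pair_less: "u < a \<Longrightarrow> v < b \<Longrightarrow> u * b + v < a * (b :: nat)"
proof -
  assume "u < a" "v < b"
  then have "Suc u * b \<le> a * b" by (intro mult_right_mono) auto
  with \<open>v < b\<close> show ?thesis by simp
qed

lemma (in -) pair_inject:
  assumes "u * b + v = u' * b + v'" "v < b" "v' < (b :: nat)"
  shows "u = u' \<and> v = v'"
proof -
  have "(u * b + v) div b = u" "(u' * b + v') div b = u'" using assms(2,3) by simp_all
  then have "u = u'" using assms(1) by metis
  then show ?thesis using assms(1) by simp
qed

lemma addr_bounds:
  assumes "valid_cell c"
  shows "case c of
      Adj _ _ \<Rightarrow> 3 \<le> addr c \<and> addr c < 3 + n * n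
    | Prd _ _ \<Rightarrow> 3 + n * n \<le> addr c \<and> addr c < 3 + n * n + 3 * T
    | Pos _ _ \<Rightarrow> 3 + n * n + 3 * T \<le> addr c \<and> addr c < 3 + 2 * (n * n) + 3 * T
    | Lst _ \<Rightarrow> 3 + 2 * (n * n) + 3 * T \<le> addr c \<and> addr c < 3 + 3 * (n * n) + 3 * T
    | Tab _ _ \<Rightarrow> 3 + 3 * (n * n) + 3 * T \<le> addr c \<and> addr c < 3 + 3 * (n * n) + 3 * T + T * (n + 1)"
proof (cases c)
  case (Adj u v)
  then show ?thesis using assms pair_less[of u n v n] by simp
next
  case (Pos u v)
  then show ?thesis using assms pair_less[of u n v n] by simp
next
  case (Tab t v)
  then show ?thesis using assms pair_less[of t T v "n + 1"] by (simp del: mult_Suc_right)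
qed (use assms in auto)

text \<open>Cells of different kinds lie in disjoint consecutive blocks, and within a
  two-dimensional block the coordinates are recovered by division. As a simplification rule it
  resolves reads after writes.\<close>

lemma addr_eq_iff [simp]:
  assumes "valid_cell c" "valid_cell c'"
  shows "addr c = addr c' \<longleftrightarrow> c = c'"
proof
  assume eq: "addr c = addr c'"
  show "c = c'"
  proof (cases "\<exists>t v. c = Tab t v")
    case True
    then obtain t v where c: "c = Tab t v" by blast
    show ?thesis
    proof (cases c')
      case (Tab t' v')
      then show ?thesis using c eq assms pair_inject[of t "n + 1" v t' v'] by simp
    qed (use assms eq c addr_bounds[OF assms(1)] addr_bounds[OF assms(2)] in \<open>simp_all del: addr.simps\<close>)
  next
    case False
    show ?thesis
    proof (cases c)
      case (Adj u v)
      then show ?thesis using assms eq addr_bounds[OF assms(2)] pair_less[of u n v n] pair_inject[of u n v]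
        by (cases c') auto
    next
      case (Prd q i)
      show ?thesis
      proof (cases c')
        case (Prd q' i')
        then show ?thesis using \<open>c = Prd q i\<close> assms eq pair_inject[of q 3 i q' i'] by (simp add: mult.commute)
      qed (use assms eq \<open>c = Prd q i\<close> addr_bounds[OF assms(1)] addr_bounds[OF assms(2)] in
          \<open>simp_all del: addr.simps\<close>)
    next
      case (Pos u v)
      then show ?thesis using assms eq addr_bounds[OF assms(2)] pair_less[of u n v n] pair_inject[of u n v]
        by (cases c') auto
    next
      case (Lst q)
      then show ?thesis using assms eq addr_bounds[OF assms(2)]
        by (cases c') auto
    qed (use False in auto)
  qed
qed simp

lemma addr_less:
  assumes "valid_cell c"
  shows "addr c < W"
proof -
  have "addr c < 3 + 3 * (n * n) + 3 * T + (T + 1) * (n + 1)"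
    using addr_bounds[OF assms] by (cases c) (simp_all del: addr.simps)
  then show ?thesis using big by linarith
qed

definition env :: "(nat \<Rightarrow> nat) \<Rightarrow> bool" where
  "env R \<longleftrightarrow> R rn = n \<and> R rs = s \<and> R rT = T \<and> R rP = 3 + n * n \<and> R rD = 3 + n * n + 3 * T \<and>
     R rL = 3 + 2 * (n * n) + 3 * T \<and> R rX = 3 + 3 * (n * n) + 3 * T"

lemma env_upd [simp]: "r < 2 \<or> 8 < r \<Longrightarrow> env (R(r := x)) = env R"
  by (auto simp: env_def)

lemma env_regs: "env R \<Longrightarrow> R 2 = n" "env R \<Longrightarrow> R 3 = s" "env R \<Longrightarrow> R 4 = T"
  by (auto simp: env_def)

lemma W_less: "n < W" "n + 1 < W" "s < W" "T < W" "T + 1 < W" "n * n + n < W" "10 \<le> W" "0 < W" "1 < W"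
proof -
  have e: "(T + 1) * (n + 1) = T * n + T + n + 1" by simp
  show "n < W" "n + 1 < W" "s < W" "T < W" "T + 1 < W" "n * n + n < W" "10 \<le> W" "0 < W" "1 < W"
    using big s unfolding e by linarith+
qed

section \<open>Arithmetic without wraparound\<close>

declare eval_expr.simps(1,4) [simp del]

lemma eval_Const [simp]: "c < 10 \<Longrightarrow> eval_expr w (Const c) st = c"
  using W_less by (simp add: eval_expr.simps flip: W)

text \<open>These rules remove the reduction modulo \<open>2 ^ w\<close>. Differences, quotients and
  remainders do not exceed their first argument, so only that one has to be bounded; comparisons
  yield 0 or 1.\<close>

lemma eval_Add: "eval_expr w a st + eval_expr w b st < W \<Longrightarrow>
    eval_expr w (Bin Add a b) st = eval_expr w a st + eval_expr w b st"
  and eval_Sub: "eval_expr w a st < W \<Longrightarrow>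
    eval_expr w (Bin Sub a b) st = eval_expr w a st - eval_expr w b st"
  and eval_Mul: "eval_expr w a st * eval_expr w b st < W \<Longrightarrow>
    eval_expr w (Bin Mul a b) st = eval_expr w a st * eval_expr w b st"
  and eval_Div: "eval_expr w a st < W \<Longrightarrow>
    eval_expr w (Bin Div a b) st = eval_expr w a st div eval_expr w b st"
  and eval_Mod: "eval_expr w a st < W \<Longrightarrow>
    eval_expr w (Bin Mod a b) st = eval_expr w a st mod eval_expr w b st"
  and eval_Less: "eval_expr w (Bin Less a b) st = of_bool (eval_expr w a st < eval_expr w b st)"
  and eval_Equal: "eval_expr w (Bin Equal a b) st = of_bool (eval_expr w a st = eval_expr w b st)"
proof -
  have le: "x div y \<le> x" "x mod y \<le> x" "x - y \<le> x" for x y :: nat by auto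
  show "eval_expr w a st + eval_expr w b st < W \<Longrightarrow>
    eval_expr w (Bin Add a b) st = eval_expr w a st + eval_expr w b st"
    "eval_expr w a st * eval_expr w b st < W \<Longrightarrow>
    eval_expr w (Bin Mul a b) st = eval_expr w a st * eval_expr w b st"
    "eval_expr w (Bin Less a b) st = of_bool (eval_expr w a st < eval_expr w b st)"
    "eval_expr w (Bin Equal a b) st = of_bool (eval_expr w a st = eval_expr w b st)"
    using W_less(9) by (simp_all add: eval_expr.simps flip: W)
  show "eval_expr w (Bin Sub a b) st = eval_expr w a st - eval_expr w b st"
    "eval_expr w (Bin Div a b) st = eval_expr w a st div eval_expr w b st"
    "eval_expr w (Bin Mod a b) st = eval_expr w a st mod eval_expr w b st"
    if "eval_expr w a st < W"
    using le_less_trans[OF le(1) that] le_less_trans[OF le(2) that] le_less_trans[OF le(3) that]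
    by (simp_all add: eval_expr.simps flip: W)
qed

lemmas eval_Bin = eval_Add eval_Sub eval_Mul eval_Div eval_Mod eval_Less eval_Equal

lemma eval_adjA [simp]:
  assumes "env (fst st)" "fst st u < n" "fst st v < n"
  shows "eval_expr w (adjA u v) st = addr (Adj (fst st u) (fst st v))"
proof -
  \<comment> \<open>All intermediate sums and products are bounded by the final address, so this
    excludes wraparound at every node.\<close>
  have "addr (Adj (fst st u) (fst st v)) < W" using assms by (intro addr_less) simp
  then show ?thesis using assms by (simp add: adjA_def eval_Bin env_regs)
qed

lemma eval_posA [simp]:
  assumes "env (fst st)" "fst st u < n" "fst st v < n"
  shows "eval_expr w (posA u v) st = addr (Pos (fst st u) (fst st v))"
proof -
  have "addr (Pos (fst st u) (fst st v)) < W" using assms by (intro addr_less) simp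
  then show ?thesis using assms by (simp add: posA_def eval_Bin env_def)
qed

lemma eval_lstA [simp]:
  assumes "env (fst st)" "fst st q < n * n"
  shows "eval_expr w (lstA q) st = addr (Lst (fst st q))"
proof -
  have "addr (Lst (fst st q)) < W" using assms by (intro addr_less) simp
  then show ?thesis using assms by (simp add: lstA_def eval_Bin env_def)
qed

lemma eval_prdA [simp]:
  assumes "env (fst st)" "fst st q < T" "i < 3"
  shows "eval_expr w (prdA q i) st = addr (Prd (fst st q) i)"
proof -
  have "addr (Prd (fst st q) i) < W" using assms by (intro addr_less) simp
  then show ?thesis using assms by (simp add: prdA_def eval_Bin env_def)
qed

lemma eval_tabA [simp]:
  assumes "env (fst st)" "fst st t < T" "fst st v \<le> n"
  shows "eval_expr w (tabA t v) st = addr (Tab (fst st t) (fst st v))"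
proof -
  have "addr (Tab (fst st t) (fst st v)) < W" using assms by (intro addr_less) simp
  moreover have "eval_expr w (Bin Add (Reg 2) (Const 1)) st = n + 1"
    using assms W_less by (simp add: eval_Add env_def)
  ultimately show ?thesis using assms by (simp add: tabA_def eval_Add eval_Mul env_def del: mult_Suc_right)
qed

declare addr.simps [simp del]

section \<open>The data structure\<close>

definition predicted :: "nat \<Rightarrow> nat set set" where
  "predicted t = fold serve_request (take t pr) E"

definition matrix_ok :: "(nat \<Rightarrow> nat) \<Rightarrow> nat set set \<Rightarrow> bool" where
  "matrix_ok M G \<longleftrightarrow> (\<forall>u<n. \<forall>v<n. M (addr (Adj u v)) = of_bool ({u, v} \<in> G))"

text \<open>Positions are kept for both orders of the endpoints, so a lookup never has to sort
  them.\<close>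

definition list_ok :: "(nat \<Rightarrow> nat) \<Rightarrow> nat set list \<Rightarrow> bool" where
  "list_ok M L \<longleftrightarrow> (\<forall>q<length L. M (addr (Lst q)) = Min (L ! q) * n + Max (L ! q)) \<and>
     (\<forall>u<n. \<forall>v<n. (\<forall>q<length L. L ! q = {u, v} \<longrightarrow> M (addr (Pos u v)) = Suc q) \<and>
        ({u, v} \<notin> set L \<longrightarrow> M (addr (Pos u v)) = 0))"

definition prediction_ok :: "(nat \<Rightarrow> nat) \<Rightarrow> bool" where
  "prediction_ok M \<longleftrightarrow> (\<forall>q<T. \<forall>i<3. M (addr (Prd q i)) = encode_request (pr ! q) ! i)"

text \<open>The rows are filled from the last one downwards, and \<open>t0\<close> is the first
  finished row; a complete table has \<open>t0 = 0\<close>.\<close>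

definition table_ok :: "(nat \<Rightarrow> nat) \<Rightarrow> nat \<Rightarrow> bool" where
  "table_ok M t0 \<longleftrightarrow> (\<forall>t<T. t0 \<le> t \<longrightarrow> (\<forall>v<n. M (addr (Tab t v)) = codegree n (predicted t) s v) \<and>
     M (addr (Tab t n)) = triangles_at n s (predicted t))"

definition edge_list :: "nat set list \<Rightarrow> bool" where
  "edge_list L \<longleftrightarrow> distinct L \<and> set L \<subseteq> nsets {..<n} 2"

text \<open>The meaning of the list is left to \<open>diff_list\<close>, because list and matrix are
  updated one after the other. The content of \<open>rcnt\<close> is left open, because only one of
  the algorithms keeps it current.\<close>

definition rep :: "nat set set \<Rightarrow> nat set list \<Rightarrow> nat \<Rightarrow> ram_state \<Rightarrow> bool" where
  "rep G L t st \<longleftrightarrow> env (fst st) \<and> fst st rt = t \<and> fst st rm = length L \<and> is_graph n G \<and> edge_list L \<and>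
     matrix_ok (snd st) G \<and> list_ok (snd st) L \<and> prediction_ok (snd st) \<and> table_ok (snd st) 0"

definition diff_list :: "nat set set \<Rightarrow> nat set list \<Rightarrow> nat \<Rightarrow> bool" where
  "diff_list G L t \<longleftrightarrow> (\<forall>e. e \<in> set L \<longleftrightarrow> (e \<in> G) \<noteq> (e \<in> predicted t))"

text \<open>Interpolates between the predicted graph at \<open>q = 0\<close> and, for a correct
  difference list, the actual graph at \<open>q = length L\<close>.\<close>

definition corrected :: "nat set list \<Rightarrow> nat \<Rightarrow> nat \<Rightarrow> nat set set" where
  "corrected L t q = fold flip (take q L) (predicted t)"

definition scratch_only :: "ram_state \<Rightarrow> ram_state \<Rightarrow> bool" where
  "scratch_only st st' \<longleftrightarrow> snd st' = snd st \<and> (\<forall>r<16. fst st' r = fst st r)"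

lemma rep_cong: "rep G L t st \<Longrightarrow> snd st' = snd st \<Longrightarrow> (\<And>r. r < 11 \<Longrightarrow> fst st' r = fst st r) \<Longrightarrow> rep G L t st'"
  by (simp add: rep_def env_def)

lemma is_graph_predicted: "is_graph n (predicted t)"
proof -
  have "is_graph n (fold serve_request rs E)" if "valid_requests n rs" for rs
    using that
  proof (induction rs rule: rev_induct)
    case (snoc r rs)
    then show ?case by (cases r) (auto simp: valid_requests_def is_graph_flip)
  qed (use E in simp)
  moreover have "valid_requests n (take t pr)"
    using pr(2) set_take_subset[of t pr] by (auto simp: valid_requests_def)
  ultimately show ?thesis by (simp add: predicted_def)
qed

text \<open>Guarantees that the block reserved for the list cannot overflow.\<close>

lemma length_le: "edge_list L \<Longrightarrow> length L \<le> n * n"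
proof -
  assume "edge_list L"
  then have d: "distinct L" and sub: "set L \<subseteq> nsets {..<n} 2" by (auto simp: edge_list_def)
  have "length L = card (set L)" using d by (simp add: distinct_card)
  also have "\<dots> \<le> card ((\<lambda>(a, b). {a, b}) ` ({..<n} \<times> {..<n}))"
  proof (rule card_mono)
    show "set L \<subseteq> (\<lambda>(a, b). {a, b}) ` ({..<n} \<times> {..<n})"
    proof
      fix e assume "e \<in> set L"
      then obtain a b where "e = {a, b}" "a < b" "b < n" using sub edgeE[of e n] by blast
      then show "e \<in> (\<lambda>(a, b). {a, b}) ` ({..<n} \<times> {..<n})"
        by (intro rev_image_eqI[of "(a, b)"]) auto
    qed
  qed simp
  also have "\<dots> \<le> card ({..<n} \<times> {..<n})" by (intro card_image_le) simp
  finally show ?thesis by simp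
qed

lemma (in -) mem_fold_flip: "distinct es \<Longrightarrow> e \<in> fold flip es H \<longleftrightarrow> (e \<in> H) \<noteq> (e \<in> set es)"
  by (induction es arbitrary: H) (auto simp: mem_flip)

lemma mem_corrected: "edge_list L \<Longrightarrow> e \<in> corrected L t q \<longleftrightarrow> (e \<in> predicted t) \<noteq> (e \<in> set (take q L))"
  by (simp add: corrected_def mem_fold_flip edge_list_def)

lemma corrected_Suc: "q < length L \<Longrightarrow> corrected L t (Suc q) = flip (L ! q) (corrected L t q)"
  by (simp add: corrected_def take_Suc_conv_app_nth)

lemma corrected_length: "edge_list L \<Longrightarrow> diff_list G L t \<Longrightarrow> corrected L t (length L) = G"
  by (rule set_eqI, simp add: mem_corrected diff_list_def, blast)

lemma corrected_0 [simp]: "corrected L t 0 = predicted t"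
  by (simp add: corrected_def)

lemma is_graph_corrected:
  assumes "edge_list L"
  shows "is_graph n (corrected L t q)"
proof -
  have "e \<in> nsets {..<n} 2" if "e \<in> corrected L t q" for e
  proof (cases "e \<in> predicted t")
    case True
    then show ?thesis using is_graph_predicted[of t] by (auto simp: is_graph_def)
  next
    case False
    then show ?thesis using that assms set_take_subset[of q L] by (auto simp: mem_corrected edge_list_def)
  qed
  then show ?thesis by (auto simp: is_graph_def)
qed

text \<open>Modulo 2, the predicted graph plus the first \<open>q\<close> listed edges equals the
  actual graph plus the remaining ones. Distinctness of \<open>L\<close> makes the stored position
  the only index of an edge.\<close>

lemma eval_memE:
  assumes "rep G L t st" "diff_list G L t" "fst st u < n" "fst st v < n"
  shows "eval_expr w (memE u v q) st = of_bool ({fst st u, fst st v} \<in> corrected L t (fst st q))"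
proof -
  let ?e = "{fst st u, fst st v}" and ?q = "fst st q"
  have L: "edge_list L" and R: "env (fst st)" using assms by (auto simp: rep_def)
  have a: "snd st (addr (Adj (fst st u) (fst st v))) = of_bool (?e \<in> G)"
    using assms by (auto simp: rep_def matrix_ok_def)
  have b: "fst st q < snd st (addr (Pos (fst st u) (fst st v))) \<longleftrightarrow> ?e \<in> set L \<and> ?e \<notin> set (take ?q L)"
  proof (cases "?e \<in> set L")
    case False
    then show ?thesis using assms by (auto simp: rep_def list_ok_def)
  next
    case True
    then obtain r where r: "r < length L" "L ! r = ?e" by (metis in_set_conv_nth)
    then have "snd st (addr (Pos (fst st u) (fst st v))) = Suc r"
      using assms by (auto simp: rep_def list_ok_def)
    moreover have "?e \<in> set (take ?q L) \<longleftrightarrow> r < ?q"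
    proof
      assume "?e \<in> set (take ?q L)"
      then obtain i where "i < length L" "i < ?q" "L ! i = ?e" unfolding in_set_conv_nth by auto
      moreover from this have "i = r" using r L nth_eq_iff_index_eq[of L i r] by (simp add: edge_list_def)
      ultimately show "r < ?q" by simp
    next
      assume "r < ?q"
      then show "?e \<in> set (take ?q L)" unfolding in_set_conv_nth using r by (intro exI[of _ r]) simp
    qed
    ultimately show ?thesis using True by auto
  qed
  have "?e \<in> corrected L t ?q \<longleftrightarrow> (?e \<in> G) \<noteq> (?e \<in> set L \<and> ?e \<notin> set (take ?q L))"
    using assms(2)[unfolded diff_list_def, rule_format, of ?e] set_take_subset[of ?q L]
    unfolding mem_corrected[OF L] by blast
  then show ?thesis
    using assms(3,4) R W_less(9) by (simp add: memE_def eval_Sub eval_Less eval_Equal a b)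
qed

lemma sem_add_signed:
  assumes "eval_expr w g st = x" "eval_expr w m st = of_bool b" "fst st r + x < W"
  shows "sem w (add_signed r g m) st =
    ((fst st)(r := fst st r + x * (1 - of_bool b) - x * of_bool b), snd st)"
  using assms W_less(9) by (cases b) (auto simp: add_signed_def eval_Add eval_Sub eval_Mul)

text \<open>An edge is stored as \<open>a * n + b\<close>, whose quotient and remainder by
  \<open>n\<close> are its endpoints because \<open>b < n\<close>. The target \<open>u\<close> must
  spare \<open>rz\<close> and \<open>rn\<close>, which the second extraction still reads.\<close>

lemma sem_load_edge:
  assumes "rep G L t st" "fst st q < length L" "L ! fst st q = {a, b}" "a < b" "u > 10" "v > 10"
    "u \<noteq> rz" "v \<noteq> rz"
  shows "sem w (load_edge q u v) st = ((fst st)(rz := a * n + b, u := a, v := b), snd st)"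
proof -
  have "{a, b} \<in> nsets {..<n} 2" using assms by (auto simp: rep_def edge_list_def dest: nth_mem)
  then have ab: "a < n" "b < n" by (auto simp: doubleton_in_nsets)
  have q: "fst st q < n * n" using assms length_le by (fastforce simp: rep_def)
  have "Min {a, b} = a" "Max {a, b} = b" using assms(4) by auto
  then have "snd st (addr (Lst (fst st q))) = a * n + b" using assms by (auto simp: rep_def list_ok_def)
  moreover have "a * n + b < W" using pair_less[OF ab] W_less(6) by linarith
  moreover have "(a * n + b) div n = a" "(a * n + b) mod n = b" using ab by auto
  moreover have "env (fst st)" using assms by (simp add: rep_def)
  ultimately show ?thesis using q assms
    by (simp add: load_edge_def eval_Div eval_Mod env_regs)
qed

section \<open>Correcting the predicted counts\<close>

text \<open>Apart from the last case, this is \<open>codegree_flip\<close> at an endpoint equal to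
  \<open>s\<close> or \<open>v\<close>, with the other endpoint as candidate. The edge
  \<open>{s, v}\<close> itself is covered: \<open>{x, y}\<close> is then the loop at
  \<open>v\<close>, and the correction vanishes.\<close>

lemma codegree_flip_select:
  assumes "is_graph n H" "a < n" "b < n" "a \<noteq> b" "v \<noteq> s"
    "x = (if a = s then b else if b = s then a else if a = v then b else if b = v then a else s)"
    "y = (if a = s \<or> b = s then v else s)"
  shows "codegree n (flip {a, b} H) s v =
    codegree n H s v + of_bool ({x, y} \<in> H) * (1 - of_bool ({a, b} \<in> H))
      - of_bool ({x, y} \<in> H) * of_bool ({a, b} \<in> H)"
proof -
  consider "a = s" | "b = s" | "a = v" "b \<noteq> s" | "b = v" "a \<noteq> s" | "s \<notin> {a, b}" "v \<notin> {a, b}" by auto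
  then show ?thesis
  proof cases
    case 1
    then show ?thesis using codegree_flip[OF assms(1), of s v b] assms by simp
  next
    case 2
    then show ?thesis using codegree_flip[OF assms(1), of s v a] assms by (simp add: insert_commute)
  next
    case 3
    then show ?thesis using codegree_flip[OF assms(1), of v s b] assms
      by (simp add: codegree_commute[of n _ s v])
  next
    case 4
    then show ?thesis using codegree_flip[OF assms(1), of v s a] assms
      by (simp add: codegree_commute[of n _ s v] insert_commute)
  next
    case 5
    then show ?thesis using codegree_flip_other[of s "{a, b}" v n H] is_graph_no_loop[OF assms(1), of s] assms
      by simp
  qed
qed

lemma sem_codegree_select:
  assumes "env (fst st)" "fst st rp = a" "fst st rp' = b" "fst st rv = v"
  shows "sem w codegree_select st = ((fst st)
    (rx := if a = s then b else if b = s then a else if a = v then b else if b = v then a else s,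
     ry := if a = s \<or> b = s then v else s), snd st)"
  using assms by (simp add: codegree_select_def eval_Equal env_regs)

lemma obtain_edge:
  assumes "edge_list L" "q < length L"
  obtains a b where "L ! q = {a, b}" "a < b" "b < n" "a < n"
proof -
  have "L ! q \<in> nsets {..<n} 2" using assms by (auto simp: edge_list_def dest: nth_mem)
  then show ?thesis using that by (auto elim!: edgeE)
qed

lemma codegree_body_runs:
  assumes rep: "rep G L t st" and d: "diff_list G L t" and v: "fst st rv = v" "v < n" "v \<noteq> s"
    and q: "fst st rq = q" "q < length L" and c: "fst st rc = codegree n (corrected L t q) s v"
  shows "runs w codegree_body st 200 (\<lambda>st'. scratch_only st st' \<and> fst st' rq = Suc q \<and>
    fst st' rc = codegree n (corrected L t (Suc q)) s v)"
proof -
  have L: "edge_list L" and R: "env (fst st)" using rep by (auto simp: rep_def)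
  obtain a b where ab: "L ! q = {a, b}" "a < b" "b < n" "a < n" using obtain_edge[OF L q(2)] .
  define x where "x = (if a = s then b else if b = s then a else if a = v then b else if b = v then a else s)"
  define y where "y = (if a = s \<or> b = s then v else s)"
  have xy: "x < n" "y < n" using ab v s by (auto simp: x_def y_def)
  define st1 where "st1 = ((fst st)(rz := a * n + b, rp := a, rp' := b), snd st)"
  define st2 where "st2 = ((fst st1)(rx := x, ry := y), snd st)"
  have 1: "sem w (load_edge rq rp rp') st = st1"
    unfolding st1_def using ab q by (intro sem_load_edge[OF rep]) auto
  have R1: "env (fst st1)" using R by (simp add: st1_def)
  have 2: "sem w codegree_select st1 = st2"
    unfolding st2_def x_def y_def
    using sem_codegree_select[OF R1, of a b v] v by (simp add: st1_def)
  have rep2: "rep G L t st2"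
    using rep by (rule rep_cong) (auto simp: st2_def st1_def)
  have m1: "eval_expr w (memE rx ry rq) st2 = of_bool ({x, y} \<in> corrected L t q)"
    using eval_memE[OF rep2 d, of rx ry rq] xy q by (simp add: st2_def st1_def)
  have m2: "eval_expr w (memE rp rp' rq) st2 = of_bool ({a, b} \<in> corrected L t q)"
    using eval_memE[OF rep2 d, of rp rp' rq] ab q by (simp add: st2_def st1_def)
  have cc: "fst st2 rc = codegree n (corrected L t q) s v" using c by (simp add: st2_def st1_def)
  \<comment> \<open>The value before subtraction is at most \<open>n + 1\<close>, which excludes
    wraparound in \<open>add_signed\<close>.\<close>
  have "codegree n (corrected L t q) s v + of_bool ({x, y} \<in> corrected L t q) < W"
    using codegree_le[of n "corrected L t q" s v] W_less(2) by (auto simp: of_bool_def)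
  then have 3: "sem w (add_signed rc (memE rx ry rq) (memE rp rp' rq)) st2 =
      ((fst st2)(rc := codegree n (flip {a, b} (corrected L t q)) s v), snd st2)"
    using sem_add_signed[OF m1 m2, of rc] cc
      codegree_flip_select[OF is_graph_corrected[OF L] ab(4,3) _ v(3) x_def y_def, of t q] ab(2) by simp
  have "Suc q < W" using q length_le[OF L] W_less(6) s by linarith
  then have 4: "sem w codegree_body st =
      ((fst st2)(rc := codegree n (corrected L t (Suc q)) s v, rq := Suc q), snd st)"
    using q ab(1) by (simp add: codegree_body_def 1 2 3 corrected_Suc) (simp add: st2_def st1_def eval_Add)
  show ?thesis
    by (rule runs_straight)
      (simp_all add: 4 scratch_only_def, simp_all add: codegree_body_def codegree_select_def expr_defs st2_def st1_def)
qed

lemma codegree_prog_runs: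
  assumes rep: "rep G L t st" and d: "diff_list G L t" and t: "t < T"
    and v: "fst st rv = v" "v < n" "v \<noteq> s" and j: "fst st rj = j" "j \<le> length L"
  shows "runs w codegree_prog st (300 * (j + 1)) (\<lambda>st'. scratch_only st st' \<and>
    fst st' rc = codegree n (corrected L t j) s v)"
proof -
  have L: "edge_list L" and R: "env (fst st)" and rt: "fst st 9 = t"
    and tab: "snd st (addr (Tab t v)) = codegree n (predicted t) s v"
    using rep t v by (auto simp: rep_def table_ok_def)
  define I where "I i st' \<longleftrightarrow> scratch_only st st' \<and> fst st' rq = i \<and>
    fst st' rc = codegree n (corrected L t i) s v" for i st'
  have repI: "rep G L t st'" if "scratch_only st st'" for st'
    using rep by (rule rep_cong) (use that in \<open>auto simp: scratch_only_def\<close>)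
  show ?thesis unfolding codegree_prog_def
  proof (rule runs_Seq)
    show "runs w (Seq (Assign rc (Load (tabA rt rv))) (Assign rq (Const 0))) st 20 (I 0)"
      by (rule runs_straight)
        (use R rt t v tab in \<open>simp_all add: I_def scratch_only_def\<close>, simp_all add: expr_defs)
    show "runs w (While (Bin Less (Reg rq) (Reg rj)) codegree_body) st' (204 * j + 4)
        (\<lambda>st'. scratch_only st st' \<and> fst st' rc = codegree n (corrected L t j) s v)" if "I 0 st'" for st'
    proof (rule runs_While[where I = I and N = j and t = 200])
      show "eval_expr w (Bin Less (Reg rq) (Reg rj)) st' \<noteq> 0 \<and> runs w codegree_body st' 200 (I (Suc i))"
        if i: "i < j" "I i st'" for i st'
      proof
        have sc: "scratch_only st st'" using i by (simp add: I_def)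
        then show "eval_expr w (Bin Less (Reg rq) (Reg rj)) st' \<noteq> 0"
          using i j by (simp add: eval_Less I_def scratch_only_def)
        have "runs w codegree_body st' 200 (\<lambda>st''. scratch_only st' st'' \<and> fst st'' rq = Suc i \<and>
            fst st'' rc = codegree n (corrected L t (Suc i)) s v)"
          using i j v sc by (intro codegree_body_runs[OF repI[OF sc] d]) (auto simp: I_def scratch_only_def)
        then show "runs w codegree_body st' 200 (I (Suc i))"
          by (rule runs_mono) (use sc in \<open>auto simp: I_def scratch_only_def\<close>)
      qed
    qed (use that j in \<open>auto simp: I_def eval_Less scratch_only_def\<close>)
  qed simp
qed

text \<open>Time linear in \<open>j\<close> is spent on \<open>flip_gain\<close>; the count then
  changes by it, with the sign given by the presence of the edge. Memory stays untouched, since the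
  flip itself is recorded separately or, in a query, only imagined.\<close>

lemma count_flip_prog_runs:
  assumes rep: "rep G L t st" and d: "diff_list G L t" and t: "t < T"
    and ab: "fst st ra = a" "fst st rb = b" "a < n" "b < n" "a \<noteq> b"
    and j: "fst st rj = j" "j \<le> length L"
    and cnt: "fst st rcnt = triangles_at n s (corrected L t j)"
  shows "runs w count_flip_prog st (600 * (j + 1)) (\<lambda>st'. snd st' = snd st \<and>
    (\<forall>r<16. r \<noteq> rv \<and> r \<noteq> rcnt \<longrightarrow> fst st' r = fst st r) \<and>
    fst st' rcnt = triangles_at n s (flip {a, b} (corrected L t j)))"
proof -
  have L: "edge_list L" and R: "env (fst st)" using rep by (auto simp: rep_def)
  have H: "is_graph n (corrected L t j)" using is_graph_corrected[OF L] .
  let ?g = "flip_gain n s (corrected L t j) a b"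
  define Q where "Q st' \<longleftrightarrow> snd st' = snd st \<and> (\<forall>r<16. r \<noteq> rv \<longrightarrow> fst st' r = fst st r) \<and>
    fst st' rc = ?g" for st'
  have *: "runs w (Seq (Assign rv (Reg r)) codegree_prog) st (300 * (j + 1) + 2) Q"
    if r: "r \<in> {ra, rb}" "fst st r \<noteq> s" "codegree n (corrected L t j) s (fst st r) = ?g" for r
  proof (rule runs_Seq)
    let ?st = "((fst st)(rv := fst st r), snd st)"
    show "runs w (Assign rv (Reg r)) st 2 (\<lambda>st'. st' = ?st)"
      by (rule runs_straight) auto
    show "runs w codegree_prog st' (300 * (j + 1)) Q" if "st' = ?st" for st'
    proof (rule runs_mono)
      have "rep G L t ?st" using rep by (rule rep_cong) auto
      then show "runs w codegree_prog st' (300 * (j + 1)) (\<lambda>st''. scratch_only ?st st'' \<and>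
          fst st'' rc = codegree n (corrected L t j) s (fst st r))"
        unfolding that using r ab j by (intro codegree_prog_runs[OF _ d t]) auto
    qed (use r in \<open>auto simp: Q_def scratch_only_def\<close>)
  qed simp
  show ?thesis unfolding count_flip_prog_def
  proof (rule runs_Seq)
    show "runs w (If (Bin Equal (Reg ra) (Reg rs)) (Seq (Assign rv (Reg rb)) codegree_prog)
      (If (Bin Equal (Reg rb) (Reg rs)) (Seq (Assign rv (Reg ra)) codegree_prog)
         (Assign rc (Bin Mul (memE rs ra rj) (memE rs rb rj))))) st (300 * (j + 1) + 80) Q"
    proof (rule runs_If[where t = "300 * (j + 1) + 70"])
      assume "eval_expr w (Bin Equal (Reg ra) (Reg rs)) st \<noteq> 0"
      then have "a = s" using ab R by (simp add: eval_Equal env_regs)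
      then have "runs w (Seq (Assign rv (Reg rb)) codegree_prog) st (300 * (j + 1) + 2) Q"
        using ab by (intro *) (auto simp: flip_gain_def)
      then show "runs w (Seq (Assign rv (Reg rb)) codegree_prog) st (300 * (j + 1) + 70) Q"
        by (rule runs_mono) auto
    next
      assume "eval_expr w (Bin Equal (Reg ra) (Reg rs)) st = 0"
      then have as: "a \<noteq> s" using ab R by (simp add: eval_Equal env_regs)
      show "runs w (If (Bin Equal (Reg rb) (Reg rs)) (Seq (Assign rv (Reg ra)) codegree_prog)
         (Assign rc (Bin Mul (memE rs ra rj) (memE rs rb rj)))) st (300 * (j + 1) + 70) Q"
      proof (rule runs_If[where t = "300 * (j + 1) + 60"])
        assume "eval_expr w (Bin Equal (Reg rb) (Reg rs)) st \<noteq> 0"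
        then have "b = s" using ab R by (simp add: eval_Equal env_regs)
        then have "runs w (Seq (Assign rv (Reg ra)) codegree_prog) st (300 * (j + 1) + 2) Q"
          using ab as by (intro *) (auto simp: flip_gain_def)
        then show "runs w (Seq (Assign rv (Reg ra)) codegree_prog) st (300 * (j + 1) + 60) Q"
          by (rule runs_mono) auto
      next
        assume "eval_expr w (Bin Equal (Reg rb) (Reg rs)) st = 0"
        then have bs: "b \<noteq> s" using ab R by (simp add: eval_Equal env_regs)
        have "eval_expr w (memE rs ra rj) st = of_bool ({s, a} \<in> corrected L t j)"
          "eval_expr w (memE rs rb rj) st = of_bool ({s, b} \<in> corrected L t j)"
          using eval_memE[OF rep d, of rs ra rj] eval_memE[OF rep d, of rs rb rj] ab j s R
          by (simp_all add: env_regs)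
        then have "eval_expr w (Bin Mul (memE rs ra rj) (memE rs rb rj)) st = ?g"
          using as bs W_less(9) by (simp add: eval_Mul flip_gain_def)
        then show "runs w (Assign rc (Bin Mul (memE rs ra rj) (memE rs rb rj))) st (300 * (j + 1) + 60) Q"
          by (intro runs_straight) (auto simp: Q_def, simp add: expr_defs)
      qed simp
    qed simp
    show "runs w (add_signed rcnt (Reg rc) (memE ra rb rj)) st' 90 (\<lambda>st'. snd st' = snd st \<and>
      (\<forall>r<16. r \<noteq> rv \<and> r \<noteq> rcnt \<longrightarrow> fst st' r = fst st r) \<and>
      fst st' rcnt = triangles_at n s (flip {a, b} (corrected L t j)))" if Q: "Q st'" for st'
    proof -
      have rep': "rep G L t st'" using rep by (rule rep_cong) (use Q in \<open>auto simp: Q_def\<close>)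
      have m: "eval_expr w (memE ra rb rj) st' = of_bool ({a, b} \<in> corrected L t j)"
        using eval_memE[OF rep' d, of ra rb rj] ab j Q by (simp add: Q_def)
      have g: "eval_expr w (Reg rc) st' = ?g" using Q by (simp add: Q_def)
      have cnt': "fst st' rcnt = triangles_at n s (corrected L t j)" using Q cnt by (simp add: Q_def)
      \<comment> \<open>The value before subtraction is at most \<open>n * n + n\<close>.\<close>
      have "fst st' rcnt + ?g < W"
        using triangles_at_le[OF H s] flip_gain_le[OF s, of "corrected L t j" a b] W_less(6) cnt' by linarith
      from sem_add_signed[OF g m this]
      have "sem w (add_signed rcnt (Reg rc) (memE ra rb rj)) st' =
        ((fst st')(rcnt := triangles_at n s (flip {a, b} (corrected L t j))), snd st')"
        using triangles_at_flip[OF H s ab(3-5)] cnt' by simp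
      then show ?thesis
        by (intro runs_straight) (use Q in \<open>auto simp: Q_def\<close>, simp_all add: expr_defs)
    qed
  qed simp
qed


section \<open>Recording requests\<close>

lemma matrix_ok_upd [simp]:
  "q < n * n \<Longrightarrow> matrix_ok (M(addr (Lst q) := x)) G = matrix_ok M G"
  "u < n \<Longrightarrow> v < n \<Longrightarrow> matrix_ok (M(addr (Pos u v) := x)) G = matrix_ok M G"
  "t < T \<Longrightarrow> v \<le> n \<Longrightarrow> matrix_ok (M(addr (Tab t v) := x)) G = matrix_ok M G"
  by (simp_all add: matrix_ok_def)

lemma prediction_ok_upd [simp]:
  "u < n \<Longrightarrow> v < n \<Longrightarrow> prediction_ok (M(addr (Adj u v) := x)) = prediction_ok M"
  "q < n * n \<Longrightarrow> prediction_ok (M(addr (Lst q) := x)) = prediction_ok M"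
  "u < n \<Longrightarrow> v < n \<Longrightarrow> prediction_ok (M(addr (Pos u v) := x)) = prediction_ok M"
  "t < T \<Longrightarrow> v \<le> n \<Longrightarrow> prediction_ok (M(addr (Tab t v) := x)) = prediction_ok M"
  by (simp_all add: prediction_ok_def)

lemma table_ok_upd [simp]:
  "u < n \<Longrightarrow> v < n \<Longrightarrow> table_ok (M(addr (Adj u v) := x)) t0 = table_ok M t0"
  "q < n * n \<Longrightarrow> table_ok (M(addr (Lst q) := x)) t0 = table_ok M t0"
  "u < n \<Longrightarrow> v < n \<Longrightarrow> table_ok (M(addr (Pos u v) := x)) t0 = table_ok M t0"
  by (simp_all add: table_ok_def)

lemma list_ok_upd [simp]:
  "length L \<le> n * n \<Longrightarrow> u < n \<Longrightarrow> v < n \<Longrightarrow> list_ok (M(addr (Adj u v) := x)) L = list_ok M L"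
  "length L \<le> n * n \<Longrightarrow> t < T \<Longrightarrow> v \<le> n \<Longrightarrow> list_ok (M(addr (Tab t v) := x)) L = list_ok M L"
  by (simp_all add: list_ok_def)

lemma list_ok_append:
  assumes "list_ok M L" "{a, b} \<notin> set L" "a < b" "b < n" "length L < n * n"
  shows "list_ok (M(addr (Lst (length L)) := a * n + b, addr (Pos a b) := Suc (length L),
    addr (Pos b a) := Suc (length L))) (L @ [{a, b}])"
proof -
  have "a < n" "Min {a, b} = a" "Max {a, b} = b" using assms by auto
  moreover have "L ! q \<noteq> {a, b}" if "q < length L" for q using assms(2) that nth_mem by fastforce
  ultimately show ?thesis
    using assms by (auto simp: list_ok_def nth_append less_Suc_eq doubleton_eq_iff insert_commute)
qed

section \<open>Constant-time deletion from a list without order\<close>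

definition (in -) swap_delete :: "nat \<Rightarrow> 'a list \<Rightarrow> 'a list" where
  "swap_delete p L = butlast (L[p := last L])"

lemma (in -) length_swap_delete [simp]: "length (swap_delete p L) = length L - 1"
  by (simp add: swap_delete_def)

lemma (in -) nth_swap_delete:
  "q < length L - 1 \<Longrightarrow> swap_delete p L ! q = (if q = p then L ! (length L - 1) else L ! q)"
  by (cases "L = []") (auto simp: swap_delete_def nth_butlast last_conv_nth)

lemma (in -) set_swap_delete:
  assumes "distinct L" "p < length L"
  shows "set (swap_delete p L) = set L - {L ! p}"
proof (intro equalityI subsetI)
  fix x assume "x \<in> set (swap_delete p L)"
  then obtain q where "q < length L - 1" "x = swap_delete p L ! q"
    by (auto simp: in_set_conv_nth)
  then show "x \<in> set L - {L ! p}"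
    using assms nth_eq_iff_index_eq[OF assms(1), of "length L - 1" p] nth_eq_iff_index_eq[OF assms(1), of q p]
    by (auto simp: nth_swap_delete)
next
  fix x assume "x \<in> set L - {L ! p}"
  then obtain q where q: "q < length L" "x = L ! q" "q \<noteq> p" by (auto simp: in_set_conv_nth)
  show "x \<in> set (swap_delete p L)"
  proof (cases "q = length L - 1")
    case True
    \<comment> \<open>The last entry survives at position \<open>p\<close>, into which it has been
      moved.\<close>
    then have "p < length L - 1" "swap_delete p L ! p = x" using q assms by (auto simp: nth_swap_delete)
    then show ?thesis by (metis length_swap_delete nth_mem)
  next
    case False
    then have "q < length L - 1" "swap_delete p L ! q = x" using q by (auto simp: nth_swap_delete)
    then show ?thesis by (metis length_swap_delete nth_mem)
  qed
qed

text \<open>By counting: the list and its set both lose exactly one element.\<close>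

lemma (in -) distinct_swap_delete:
  assumes "distinct L" "p < length L"
  shows "distinct (swap_delete p L)"
proof -
  have "card (set (swap_delete p L)) = length (swap_delete p L)"
    using assms by (simp add: set_swap_delete distinct_card card_Diff_singleton)
  then show ?thesis by (rule card_distinct)
qed

text \<open>The writes overlap if the deleted edge is the last entry. The final zeros then prevail,
  as they should, and the write to entry \<open>p\<close> falls behind the end of the shortened
  list.\<close>

lemma list_ok_delete:
  assumes D: "list_ok M L" and L: "edge_list L" and p: "p < length L" "L ! p = {a, b}" and ab: "a < n" "b < n"
    and xy: "L ! (length L - 1) = {x, y}" "x < y" "y < n"
  shows "list_ok (M(addr (Lst p) := x * n + y, addr (Pos x y) := Suc p, addr (Pos y x) := Suc p,
    addr (Pos a b) := 0, addr (Pos b a) := 0)) (swap_delete p L)"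
    (is "list_ok ?M _")
proof -
  have d: "distinct L" using L by (simp add: edge_list_def)
  have len: "length L \<le> n * n" using length_le[OF L] .
  have valid: "valid_cell (Lst p)" "valid_cell (Pos x y)" "valid_cell (Pos y x)" "valid_cell (Pos a b)"
    "valid_cell (Pos b a)" using p ab xy len by auto
  have Mm: "Min {x, y} = x" "Max {x, y} = y" using xy by auto
  have inj: "L ! q = L ! q' \<longleftrightarrow> q = q'" if "q < length L" "q' < length L" for q q'
    using nth_eq_iff_index_eq[OF d] that .
  have 1: "?M (addr (Lst q)) = Min (swap_delete p L ! q) * n + Max (swap_delete p L ! q)"
    if "q < length L - 1" for q
  proof -
    have "valid_cell (Lst q)" using that len by simp
    moreover have "M (addr (Lst q)) = Min (L ! q) * n + Max (L ! q)"
      using D that unfolding list_ok_def by auto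
    ultimately show ?thesis using that valid xy Mm by (simp add: nth_swap_delete)
  qed
  \<comment> \<open>The order of the cases mirrors the order of the writes, latest first.\<close>
  have M: "?M (addr (Pos u v)) = (if {u, v} = {a, b} then 0 else if {u, v} = {x, y} then Suc p
      else M (addr (Pos u v)))" if "u < n" "v < n" for u v
  proof -
    have uv: "valid_cell (Pos u v)" using that by simp
    have eq: "{u, v} = {c, d} \<longleftrightarrow> addr (Pos u v) = addr (Pos c d) \<or> addr (Pos u v) = addr (Pos d c)"
      if "c < n" "d < n" for c d
      using that uv by (simp add: doubleton_eq_iff)
    have "x < n" using xy by simp
    then show ?thesis unfolding eq[OF ab] eq[OF \<open>x < n\<close> xy(3)]
      using uv valid(1) by (simp del: addr_eq_iff add: addr_eq_iff[OF uv valid(1)])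
  qed
  have 2: "?M (addr (Pos u v)) = Suc q"
    if "u < n" "v < n" "q < length L - 1" "swap_delete p L ! q = {u, v}" for u v q
  proof (cases "q = p")
    case True
    then have "{u, v} = {x, y}" using that xy by (simp add: nth_swap_delete)
    \<comment> \<open>Here \<open>p\<close> precedes the last index, so the moved and the deleted
      edge are different entries of a distinct list.\<close>
    moreover have "{x, y} \<noteq> {a, b}" using inj[of "length L - 1" p] xy p that True by auto
    ultimately show ?thesis using M[OF that(1,2)] True by simp
  next
    case False
    then have Lq: "L ! q = {u, v}" using that by (simp add: nth_swap_delete)
    then have "{u, v} \<noteq> {a, b}" "{u, v} \<noteq> {x, y}"
      using inj[of q p] inj[of q "length L - 1"] that False p xy by auto
    moreover have "M (addr (Pos u v)) = Suc q" using D that Lq unfolding list_ok_def by auto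
    ultimately show ?thesis using M[OF that(1,2)] by simp
  qed
  have 3: "?M (addr (Pos u v)) = 0" if "u < n" "v < n" "{u, v} \<notin> set (swap_delete p L)" for u v
  proof (cases "{u, v} = {a, b}")
    case True
    then show ?thesis using M[OF that(1,2)] by simp
  next
    case False
    then have "{u, v} \<notin> set L" using that(3) set_swap_delete[OF d p(1)] p(2) by auto
    moreover from this have "{u, v} \<noteq> {x, y}" using xy(1) p(1) by (metis diff_less length_greater_0_conv
          length_pos_if_in_set less_numeral_extra(1) nth_mem)
    moreover from \<open>{u, v} \<notin> set L\<close> have "M (addr (Pos u v)) = 0" using D that unfolding list_ok_def by auto
    ultimately show ?thesis using M[OF that(1,2)] False by simp
  qed
  show ?thesis unfolding list_ok_def length_swap_delete using 1 2 3 by blast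
qed

text \<open>The new list is specified only as a set, because deletion rearranges the
  entries.\<close>

lemma toggle_prog_runs:
  assumes rep: "rep G L t st" and ab: "fst st ra = a" "fst st rb = b" "a < b" "b < n"
  shows "runs w toggle_prog st 200 (\<lambda>st'. (\<exists>L'. rep G L' t st' \<and>
    (\<forall>e. e \<in> set L' \<longleftrightarrow> (e \<in> set L) \<noteq> (e = {a, b}))) \<and>
    (\<forall>r<16. r \<noteq> rm \<longrightarrow> fst st' r = fst st r))"
proof (rule runs_straight)
  show "straight toggle_prog" "cost toggle_prog \<le> 200"
    by (simp_all add: toggle_prog_def expr_defs)
  have L: "edge_list L" and R: "env (fst st)" and m: "fst st 10 = length L" and D: "list_ok (snd st) L"
    using rep by (auto simp: rep_def)
  have an: "a < n" using ab by simp
  have e: "{a, b} \<in> nsets {..<n} 2" using ab by (simp add: doubleton_in_nsets)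
  show "(\<exists>L'. rep G L' t (sem w toggle_prog st) \<and>
    (\<forall>e. e \<in> set L' \<longleftrightarrow> (e \<in> set L) \<noteq> (e = {a, b}))) \<and>
    (\<forall>r<16. r \<noteq> rm \<longrightarrow> fst (sem w toggle_prog st) r = fst st r)"
  proof (cases "{a, b} \<in> set L")
    case False
    then have p: "snd st (addr (Pos a b)) = 0" using D ab an unfolding list_ok_def by auto
    have L': "edge_list (L @ [{a, b}])" using L False e by (simp add: edge_list_def)
    have len: "length L < n * n" using length_le[OF L'] by simp
    then have lenW: "length L + 1 < W" using W_less(6) s by linarith
    have code: "a * n + b < W" using pair_less[OF an ab(4)] W_less(6) by linarith
    have eq: "sem w toggle_prog st = ((fst st)(rp := 0, rm := Suc (length L)),
      (snd st)(addr (Lst (length L)) := a * n + b, addr (Pos a b) := Suc (length L),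
        addr (Pos b a) := Suc (length L)))"
      using ab an R m p len lenW code by (simp add: toggle_prog_def eval_Equal eval_Add eval_Mul env_regs)
    have "rep G (L @ [{a, b}]) t (sem w toggle_prog st)"
      unfolding eq using rep L' list_ok_append[OF D False ab(3,4) len] ab an len by (simp add: rep_def)
    then show ?thesis using False eq by (intro conjI exI[of _ "L @ [{a, b}]"]) auto
  next
    case True
    then obtain p where p: "p < length L" "L ! p = {a, b}" by (auto simp: in_set_conv_nth)
    have d: "distinct L" using L by (simp add: edge_list_def)
    have pos: "snd st (addr (Pos a b)) = Suc p" using D ab an p unfolding list_ok_def by auto
    have len: "length L \<le> n * n" using length_le[OF L] .
    have lenW: "length L < W" "p < n * n" using len W_less(6) s p by linarith+
    let ?m = "length L - 1"
    have m': "?m < length L" using p by simp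
    obtain x y where xy: "L ! ?m = {x, y}" "x < y" "y < n" "x < n" using obtain_edge[OF L m'] .
    define st1 where "st1 = ((fst st)(rp := Suc p, rm := ?m), snd st)"
    have st1: "snd st1 (addr (Lst ?m)) = x * n + y"
    proof -
      have "Min {x, y} = x" "Max {x, y} = y" using xy by auto
      then show ?thesis using D m' xy(1) unfolding list_ok_def by (auto simp: st1_def)
    qed
    have mn: "?m < n * n" using m' len by linarith
    have code: "x * n + y < W" using pair_less[OF xy(4,3)] W_less(6) by linarith
    have dm: "(x * n + y) div n = x" "(x * n + y) mod n = y" using xy by auto
    have ld: "sem w (load_edge rm rx ry) st1 = ((fst st1)(rz := x * n + y, rx := x, ry := y), snd st)"
      using st1 mn code dm R by (simp add: load_edge_def eval_Div eval_Mod st1_def env_regs)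
    let ?M = "(snd st)(addr (Lst p) := x * n + y, addr (Pos x y) := Suc p, addr (Pos y x) := Suc p,
      addr (Pos a b) := 0, addr (Pos b a) := 0)"
    have eq: "sem w toggle_prog st = ((fst st1)(rz := x * n + y, rx := x, ry := y, rp' := p), ?M)"
    proof -
      have "sem w (Seq (Assign rp (Load (posA ra rb))) (Assign rm (Bin Sub (Reg rm) (Const 1)))) st = st1"
        using ab an R m pos lenW by (simp add: st1_def eval_Sub)
      moreover have "eval_expr w (Bin Equal (Reg rp) (Const 0)) ((fst st)(rp := Suc p), snd st) = 0"
        by (simp add: eval_Equal)
      ultimately have "sem w toggle_prog st = sem w (
        (Seq (load_edge rm rx ry)
       (Seq (Assign rp' (Bin Sub (Reg rp) (Const 1)))
       (Seq (Store (lstA rp') (Reg rz))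
       (Seq (Store (posA rx ry) (Reg rp))
       (Seq (Store (posA ry rx) (Reg rp))
       (Seq (Store (posA ra rb) (Const 0)) (Store (posA rb ra) (Const 0))))))))) st1"
        using ab an R pos by (simp add: toggle_prog_def)
      also have "\<dots> = ((fst st1)(rz := x * n + y, rx := x, ry := y, rp' := p), ?M)"
        using ab an R lenW xy p(1) by (simp add: ld) (simp add: st1_def eval_Sub)
      finally show ?thesis .
    qed
    have L': "edge_list (swap_delete p L)"
      using L distinct_swap_delete[OF d p(1)] by (auto simp: edge_list_def set_swap_delete[OF d p(1)])
    have "rep G (swap_delete p L) t (sem w toggle_prog st)"
      unfolding eq using rep L' list_ok_delete[OF D L p an ab(4) xy(1-3)] ab an xy lenW
      by (simp add: rep_def st1_def)
    then show ?thesis using True p(2) eq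
      by (intro conjI exI[of _ "swap_delete p L"]) (auto simp: set_swap_delete[OF d p(1)] st1_def)
  qed
qed

section \<open>Matrix flips and the passage to the next predicted graph\<close>

lemma sem_flip_prog:
  assumes "env (fst st)" "matrix_ok (snd st) G" "fst st ra = a" "fst st rb = b" "a < n" "b < n"
    "eval_expr w c st = of_bool f"
  shows "sem w (flip_prog c) st = ((fst st)(rz := of_bool (({a, b} \<in> G) \<noteq> f)),
    (snd st)(addr (Adj a b) := of_bool (({a, b} \<in> G) \<noteq> f), addr (Adj b a) := of_bool (({a, b} \<in> G) \<noteq> f)))"
proof -
  have "snd st (addr (Adj a b)) = of_bool ({a, b} \<in> G)" using assms by (simp add: matrix_ok_def)
  then show ?thesis using assms W_less(9) by (simp add: flip_prog_def eval_Sub eval_Equal)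
qed

lemma matrix_ok_flip:
  assumes "matrix_ok M G" "a < n" "b < n"
  shows "matrix_ok (M(addr (Adj a b) := of_bool (({a, b} \<in> G) \<noteq> f), addr (Adj b a) := of_bool (({a, b} \<in> G) \<noteq> f)))
    (if f then flip {a, b} G else G)"
  using assms by (auto simp: matrix_ok_def mem_flip doubleton_eq_iff insert_commute)

lemma pr_cases:
  assumes "t < T"
  obtains (Update) e a b where "pr ! t = Update e" "e = {a, b}" "a < b" "b < n" "Min e = a" "Max e = b"
  | (Query) "pr ! t = Query"
proof (cases "pr ! t")
  case (Update e)
  then have "Update e \<in> set pr" using assms pr(1) nth_mem by metis
  then have "e \<in> nsets {..<n} 2" using pr(2) by (simp add: valid_requests_def)
  then show ?thesis using Update that(1) by (metis edgeE)
qed (use that in simp)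

lemma predicted_Suc: "t < T \<Longrightarrow> predicted (Suc t) = serve_request (pr ! t) (predicted t)"
  using pr(1) by (simp add: predicted_def take_Suc_conv_app_nth)

text \<open>The next predicted request changes the difference at one edge at most. Registers 0 and
  \<open>rcnt\<close> are tracked because a query stores its answer before advancing and a
  maintained count has to reach the next request.\<close>

lemma advance_prog_runs:
  assumes rep: "rep G L t st" and d: "diff_list G L t" and t: "t < T"
  shows "runs w advance_prog st 300 (\<lambda>st'. (\<exists>L'. rep G L' (Suc t) st' \<and> diff_list G L' (Suc t)) \<and>
    (\<forall>r\<in>{0, rcnt}. fst st' r = fst st r))"
proof -
  have R: "env (fst st)" and rt: "fst st 9 = t"
    and P: "\<And>i. i < 3 \<Longrightarrow> snd st (addr (Prd t i)) = encode_request (pr ! t) ! i"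
    using rep t by (auto simp: rep_def prediction_ok_def)
  define Q where "Q st' \<longleftrightarrow> (\<exists>L'. rep G L' t st' \<and> diff_list G L' (Suc t)) \<and>
    (\<forall>r\<in>{0, rcnt}. fst st' r = fst st r)" for st'
  show ?thesis unfolding advance_prog_def
  proof (rule runs_Seq)
    show "runs w (If (Load (prdA rt 0))
        (Seq (Seq (Assign ra (Load (prdA rt 1))) (Assign rb (Load (prdA rt 2)))) toggle_prog) Skip) st 250 Q"
      using t
    proof (cases rule: pr_cases)
      case (Update e a b)
      have P': "snd st (addr (Prd t 0)) = 1" "snd st (addr (Prd t 1)) = a" "snd st (addr (Prd t 2)) = b"
        using P Update by auto
      let ?st = "((fst st)(ra := a, rb := b), snd st)"
      have rep': "rep G L t ?st" using rep by (rule rep_cong) auto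
      show ?thesis
      proof (rule runs_If[where t = 230])
        show "runs w (Seq (Seq (Assign ra (Load (prdA rt 1))) (Assign rb (Load (prdA rt 2)))) toggle_prog) st 230 Q"
        proof (rule runs_Seq)
          show "runs w (Seq (Assign ra (Load (prdA rt 1))) (Assign rb (Load (prdA rt 2)))) st 30 (\<lambda>st'. st' = ?st)"
            by (rule runs_straight) (use R rt t P' in \<open>simp_all\<close>, simp add: expr_defs)
          show "runs w toggle_prog st' 200 Q" if "st' = ?st" for st'
          proof (rule runs_mono)
            show "runs w toggle_prog st' 200 (\<lambda>st'. (\<exists>L'. rep G L' t st' \<and>
              (\<forall>e. e \<in> set L' \<longleftrightarrow> (e \<in> set L) \<noteq> (e = {a, b}))) \<and>
              (\<forall>r<16. r \<noteq> rm \<longrightarrow> fst st' r = fst ?st r))"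
              unfolding that using Update by (intro toggle_prog_runs[OF rep']) auto
            show "Q st'" if st': "(\<exists>L'. rep G L' t st' \<and>
              (\<forall>e. e \<in> set L' \<longleftrightarrow> (e \<in> set L) \<noteq> (e = {a, b}))) \<and>
              (\<forall>r<16. r \<noteq> rm \<longrightarrow> fst st' r = fst ?st r)" for st'
            proof -
              obtain L' where L': "rep G L' t st'" "\<And>e. e \<in> set L' \<longleftrightarrow> (e \<in> set L) \<noteq> (e = {a, b})"
                using st' by blast
              have "diff_list G L' (Suc t)"
                using d L'(2) Update unfolding diff_list_def predicted_Suc[OF t] by (simp add: mem_flip) blast
              then show ?thesis unfolding Q_def using L'(1) st' by auto
            qed
          qed simp
        qed simp
      qed (use R rt t P' in \<open>simp_all\<close>, simp add: expr_defs)
    next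
      case Query
      have P': "snd st (addr (Prd t 0)) = 0" using P Query by auto
      have "diff_list G L (Suc t)" using d Query by (simp add: diff_list_def predicted_Suc[OF t])
      then have "Q st" using rep by (auto simp: Q_def)
      show ?thesis
      proof (rule runs_If[where t = 1])
        show "runs w Skip st 1 Q" by (rule runs_straight) (use \<open>Q st\<close> in auto)
      qed (use R rt t P' in \<open>simp_all\<close>, simp add: expr_defs)
    qed
    show "runs w (Assign rt (Bin Add (Reg rt) (Const 1))) st' 10 (\<lambda>st'. (\<exists>L'. rep G L' (Suc t) st' \<and>
      diff_list G L' (Suc t)) \<and> (\<forall>r\<in>{0, rcnt}. fst st' r = fst st r))" if Q: "Q st'" for st'
    proof -
      obtain L' where L': "rep G L' t st'" "diff_list G L' (Suc t)"
        using Q unfolding Q_def by blast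
      have "t + 1 < W" using t W_less(4) by simp
      then have "sem w (Assign rt (Bin Add (Reg rt) (Const 1))) st' = ((fst st')(rt := Suc t), snd st')"
        using L' by (simp add: eval_Add rep_def)
      moreover have "rep G L' (Suc t) ((fst st')(rt := Suc t), snd st')" using L' by (simp add: rep_def)
      ultimately show ?thesis
        using L'(2) Q by (intro runs_straight) (auto simp: Q_def)
    qed
  qed simp
qed

text \<open>The actual flip toggles one listed edge, and the predicted request toggles at most one
  more; a correct prediction cancels the first toggle. Between the first toggle and the matrix flip,
  the list already belongs to the new graph while the matrix still holds the old one.\<close>

lemma record_update_runs:
  assumes rep: "rep G L t st" and d: "diff_list G L t" and t: "t < T"
    and ab: "fst st ra = a" "fst st rb = b" "a < b" "b < n"
  shows "runs w record_update st 600 (\<lambda>st'. (\<exists>L'. rep (flip {a, b} G) L' (Suc t) st' \<and>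
    diff_list (flip {a, b} G) L' (Suc t)) \<and> fst st' rcnt = fst st rcnt)"
  unfolding record_update_def
proof (rule runs_Seq)
  show "runs w toggle_prog st 200 (\<lambda>st'. (\<exists>L'. rep G L' t st' \<and>
    (\<forall>e. e \<in> set L' \<longleftrightarrow> (e \<in> set L) \<noteq> (e = {a, b}))) \<and>
    (\<forall>r<16. r \<noteq> rm \<longrightarrow> fst st' r = fst st r))"
    using ab by (rule toggle_prog_runs[OF rep])
  fix st1 assume st1: "(\<exists>L'. rep G L' t st1 \<and>
    (\<forall>e. e \<in> set L' \<longleftrightarrow> (e \<in> set L) \<noteq> (e = {a, b}))) \<and>
    (\<forall>r<16. r \<noteq> rm \<longrightarrow> fst st1 r = fst st r)"
  then obtain L' where L': "rep G L' t st1" "\<And>e. e \<in> set L' \<longleftrightarrow> (e \<in> set L) \<noteq> (e = {a, b})" by blast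
  have an: "a < n" using ab by simp
  have d': "diff_list (flip {a, b} G) L' t"
    using d L'(2) unfolding diff_list_def by (simp add: mem_flip) blast
  let ?st = "sem w (flip_prog (Const 1)) st1"
  have 1: "env (fst st1)" "matrix_ok (snd st1) G" "is_graph n G" "edge_list L'" using L'(1) by (auto simp: rep_def)
  have eq: "?st = ((fst st1)(rz := of_bool (({a, b} \<in> G) \<noteq> True)),
    (snd st1)(addr (Adj a b) := of_bool (({a, b} \<in> G) \<noteq> True), addr (Adj b a) := of_bool (({a, b} \<in> G) \<noteq> True)))"
    using st1 ab by (intro sem_flip_prog[OF 1(1,2)]) auto
  have "is_graph n (flip {a, b} G)" using 1 ab an by (intro is_graph_flip) (auto simp: doubleton_in_nsets)
  then have rep2: "rep (flip {a, b} G) L' t ?st"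
    using L'(1) matrix_ok_flip[OF 1(2) an ab(4), of True] ab an length_le[OF 1(4)] unfolding eq by (simp add: rep_def)
  show "runs w (Seq (flip_prog (Const 1)) advance_prog) st1 400 (\<lambda>st'. (\<exists>L'. rep (flip {a, b} G) L' (Suc t) st' \<and>
    diff_list (flip {a, b} G) L' (Suc t)) \<and> fst st' rcnt = fst st rcnt)"
  proof (rule runs_Seq)
    show "runs w (flip_prog (Const 1)) st1 100 (\<lambda>st'. st' = ?st)"
      by (rule runs_straight) (simp_all add: flip_prog_def expr_defs)
    show "runs w advance_prog st' 300 (\<lambda>st'. (\<exists>L'. rep (flip {a, b} G) L' (Suc t) st' \<and>
      diff_list (flip {a, b} G) L' (Suc t)) \<and> fst st' rcnt = fst st rcnt)" if "st' = ?st" for st'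
      using advance_prog_runs[OF rep2 d' t] unfolding that
      by (rule runs_mono) (use eq st1 in auto)
  qed simp
qed simp

text \<open>Round \<open>i\<close> works in the graph with \<open>i\<close> differences corrected
  and takes time linear in \<open>i + 1\<close>; there are \<open>length L\<close> rounds, after
  which the corrected graph is the actual one.\<close>

lemma replay_prog_runs:
  assumes rep: "rep G L t st" and d: "diff_list G L t" and t: "t < T"
  shows "runs w replay_prog st (2000 * (length L + 1)\<^sup>2) (\<lambda>st'. rep G L t st' \<and> fst st' rcnt = triangles_at n s G)"
proof -
  have L: "edge_list L" and R: "env (fst st)" and rt: "fst st 9 = t" and m: "fst st 10 = length L"
    and tab: "snd st (addr (Tab t n)) = triangles_at n s (predicted t)"
    using rep t by (auto simp: rep_def table_ok_def)
  define I where "I i st' \<longleftrightarrow> rep G L t st' \<and> fst st' rj = i \<and> fst st' rcnt = triangles_at n s (corrected L t i)" for i st'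
  let ?c = "Bin Less (Reg rj) (Reg rm)"
  let ?b = "Seq (load_edge rj ra rb) (Seq count_flip_prog (Assign rj (Bin Add (Reg rj) (Const 1))))"
  show ?thesis unfolding replay_prog_def
  proof (rule runs_Seq)
    let ?st = "((fst st)(rcnt := triangles_at n s (predicted t), rj := 0), snd st)"
    have "rep G L t ?st" using rep by (rule rep_cong) auto
    then have "I 0 ?st" by (simp add: I_def)
    then show "runs w (Seq (Assign rcnt (Load (tabA rt rn))) (Assign rj (Const 0))) st 20 (I 0)"
      by (intro runs_straight) (use R rt t tab in \<open>simp_all add: env_regs\<close>, simp add: expr_defs)
    show "runs w (While ?c ?b) st' (length L * (700 * (length L + 1)) + 4)
        (\<lambda>st'. rep G L t st' \<and> fst st' rcnt = triangles_at n s G)" if "I 0 st'" for st'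
    proof (rule runs_While[where I = I and N = "length L" and t = "600 * (length L + 1) + 50"])
      show "eval_expr w ?c st' \<noteq> 0 \<and> runs w ?b st' (600 * (length L + 1) + 50) (I (Suc i))"
        if i: "i < length L" "I i st'" for i st'
      proof
        have rep': "rep G L t st'" and j: "fst st' 15 = i" using i by (auto simp: I_def)
        then show "eval_expr w ?c st' \<noteq> 0" using i by (simp add: eval_Less rep_def)
        obtain a b where ab: "L ! i = {a, b}" "a < b" "b < n" "a < n" using obtain_edge[OF L i(1)] .
        let ?st = "((fst st')(rz := a * n + b, ra := a, rb := b), snd st')"
        have rep2: "rep G L t ?st" using rep' by (rule rep_cong) auto
        have ld: "sem w (load_edge rj ra rb) st' = ?st"
          using ab j i by (intro sem_load_edge[OF rep']) auto
        define Q where "Q st'' \<longleftrightarrow> rep G L t st'' \<and> fst st'' rj = i \<and>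
          fst st'' rcnt = triangles_at n s (corrected L t (Suc i))" for st''
        have cf: "runs w count_flip_prog ?st (600 * (i + 1)) (\<lambda>st''. snd st'' = snd ?st \<and>
          (\<forall>r<16. r \<noteq> rv \<and> r \<noteq> rcnt \<longrightarrow> fst st'' r = fst ?st r) \<and>
          fst st'' rcnt = triangles_at n s (flip {a, b} (corrected L t i)))"
          using ab i j by (intro count_flip_prog_runs[OF rep2 d t]) (auto simp: I_def)
        show "runs w ?b st' (600 * (length L + 1) + 50) (I (Suc i))"
        proof (rule runs_Seq)
          show "runs w (load_edge rj ra rb) st' 20 (\<lambda>st''. st'' = ?st)"
            by (rule runs_straight) (simp_all add: ld, simp_all add: expr_defs)
          show "runs w (Seq count_flip_prog (Assign rj (Bin Add (Reg rj) (Const 1)))) st'' (600 * (i + 1) + 10) (I (Suc i))"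
            if "st'' = ?st" for st''
            unfolding that
          proof (rule runs_Seq)
            show "runs w count_flip_prog ?st (600 * (i + 1)) Q"
              using cf
            proof (rule runs_mono)
              fix st2 assume *: "snd st2 = snd ?st \<and>
                (\<forall>r<16. r \<noteq> rv \<and> r \<noteq> rcnt \<longrightarrow> fst st2 r = fst ?st r) \<and>
                fst st2 rcnt = triangles_at n s (flip {a, b} (corrected L t i))"
              have "rep G L t st2" using rep2 by (rule rep_cong) (use * in auto)
              then show "Q st2" using * j ab(1) i(1) by (simp add: Q_def corrected_Suc)
            qed simp
            show "runs w (Assign rj (Bin Add (Reg rj) (Const 1))) st2 10 (I (Suc i))" if "Q st2" for st2
            proof (rule runs_straight)
              have "i + 1 < W" using i(1) length_le[OF L] W_less(6) s by linarith
              then have "sem w (Assign rj (Bin Add (Reg rj) (Const 1))) st2 = ((fst st2)(rj := Suc i), snd st2)"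
                using that by (simp add: eval_Add Q_def)
              moreover have "rep G L t ((fst st2)(rj := Suc i), snd st2)"
                by (rule rep_cong[of G L t st2]) (use that in \<open>auto simp: Q_def\<close>)
              ultimately show "I (Suc i) (sem w (Assign rj (Bin Add (Reg rj) (Const 1))) st2)"
                using that by (simp add: I_def Q_def)
            qed simp_all
          qed simp
        qed (use i in simp)
      qed
      show "eval_expr w ?c st' = 0" if "I (length L) st'" for st'
        using that by (simp add: I_def eval_Less rep_def)
      show "rep G L t st' \<and> fst st' rcnt = triangles_at n s G" if "I (length L) st'" for st'
        using that corrected_length[OF L d] by (simp add: I_def)
      have "1 + expr_cost ?c + (600 * (length L + 1) + 50) \<le> 700 * (length L + 1)" by simp
      from mult_left_mono[OF this, of "length L"]
      show "length L * (1 + expr_cost ?c + (600 * (length L + 1) + 50)) + (1 + expr_cost ?c)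
          \<le> length L * (700 * (length L + 1)) + 4" by simp
    qed (use that in simp)
    show "20 + (length L * (700 * (length L + 1)) + 4) \<le> 2000 * (length L + 1)\<^sup>2"
      by (simp add: power2_eq_square algebra_simps)
  qed
qed

section \<open>Serving the requests\<close>

lemma (in -) exec_of_runs: "runs w p st b Q \<Longrightarrow> (\<And>st'. Q st' \<Longrightarrow> P st') \<Longrightarrow> \<exists>t st'. exec w p st t st' \<and> t \<le> b \<and> P st'"
  unfolding runs_def by blast

lemma rep_pass_edge: "rep G L t st \<Longrightarrow> rep G L t (pass_edge e st)"
  by (simp add: rep_def pass_edge_def)

lemma load_args_runs:
  assumes "rep G L t st" "Min e = a" "Max e = b"
  shows "runs w load_args (pass_edge e st) 4 (\<lambda>st'. rep G L t st' \<and> fst st' ra = a \<and> fst st' rb = b \<and>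
    fst st' rcnt = fst st rcnt)"
proof (rule runs_straight)
  have "rep G L t (sem w load_args (pass_edge e st))"
    using rep_pass_edge[OF assms(1), of e] by (rule rep_cong) (auto simp: load_args_def)
  then show "rep G L t (sem w load_args (pass_edge e st)) \<and> fst (sem w load_args (pass_edge e st)) ra = a \<and>
    fst (sem w load_args (pass_edge e st)) rb = b \<and> fst (sem w load_args (pass_edge e st)) rcnt = fst st rcnt"
    using assms by (simp add: load_args_def pass_edge_def)
qed (simp_all add: load_args_def)

lemma fast_query_update_runs:
  assumes rep: "rep G L t st" and d: "diff_list G L t" and t: "t < T"
    and e: "e \<in> nsets {..<n} 2" and cnt: "fst st rcnt = triangles_at n s G"
  shows "runs w (update_prog fast_query_algorithm) (pass_edge e st) (1300 * (length L + 1))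
    (\<lambda>st'. \<exists>L'. rep (flip e G) L' (Suc t) st' \<and> diff_list (flip e G) L' (Suc t) \<and>
      fst st' rcnt = triangles_at n s (flip e G))"
proof -
  obtain a b where ab: "e = {a, b}" "a < b" "b < n" "Min e = a" "Max e = b" using e by (rule edgeE)
  have L: "edge_list L" using rep by (simp add: rep_def)
  define Q where "Q st' \<longleftrightarrow> rep G L t st' \<and> fst st' ra = a \<and> fst st' rb = b \<and> fst st' rj = length L \<and>
    fst st' rcnt = triangles_at n s G" for st'
  have "runs w (Seq (Seq load_args (Assign rj (Reg rm))) (Seq count_flip_prog record_update)) (pass_edge e st)
    (1300 * (length L + 1))
    (\<lambda>st'. \<exists>L'. rep (flip e G) L' (Suc t) st' \<and> diff_list (flip e G) L' (Suc t) \<and>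
      fst st' rcnt = triangles_at n s (flip e G))"
  proof (rule runs_Seq)
    show "runs w (Seq load_args (Assign rj (Reg rm))) (pass_edge e st) 6 Q"
    proof (rule runs_Seq[OF load_args_runs[OF rep ab(4,5)]])
      fix st' assume *: "rep G L t st' \<and> fst st' ra = a \<and> fst st' rb = b \<and> fst st' rcnt = fst st rcnt"
      have "rep G L t ((fst st')(rj := length L), snd st')"
        by (rule rep_cong[of G L t st']) (use * in auto)
      moreover have "fst st' rm = length L" using * by (simp add: rep_def)
      ultimately show "runs w (Assign rj (Reg rm)) st' 2 Q"
        by (intro runs_straight) (use * cnt in \<open>auto simp: Q_def\<close>)
    qed simp
    fix st1 assume Q: "Q st1"
    have rep1: "rep G L t st1" using Q by (simp add: Q_def)
    show "runs w (Seq count_flip_prog record_update) st1 (600 * (length L + 1) + 600)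
      (\<lambda>st'. \<exists>L'. rep (flip e G) L' (Suc t) st' \<and> diff_list (flip e G) L' (Suc t) \<and>
        fst st' rcnt = triangles_at n s (flip e G))"
    proof (rule runs_Seq)
      show "runs w count_flip_prog st1 (600 * (length L + 1)) (\<lambda>st'. snd st' = snd st1 \<and>
        (\<forall>r<16. r \<noteq> rv \<and> r \<noteq> rcnt \<longrightarrow> fst st' r = fst st1 r) \<and>
        fst st' rcnt = triangles_at n s (flip {a, b} (corrected L t (length L))))"
        using Q ab corrected_length[OF L d] by (intro count_flip_prog_runs[OF rep1 d t]) (auto simp: Q_def)
      fix st2 assume 2: "snd st2 = snd st1 \<and>
        (\<forall>r<16. r \<noteq> rv \<and> r \<noteq> rcnt \<longrightarrow> fst st2 r = fst st1 r) \<and>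
        fst st2 rcnt = triangles_at n s (flip {a, b} (corrected L t (length L)))"
      have rep2: "rep G L t st2" using rep1 by (rule rep_cong) (use 2 in auto)
      have "runs w record_update st2 600 (\<lambda>st'. (\<exists>L'. rep (flip {a, b} G) L' (Suc t) st' \<and>
        diff_list (flip {a, b} G) L' (Suc t)) \<and> fst st' rcnt = fst st2 rcnt)"
        using 2 Q ab by (intro record_update_runs[OF rep2 d t]) (auto simp: Q_def)
      then show "runs w record_update st2 600 (\<lambda>st'. \<exists>L'. rep (flip e G) L' (Suc t) st' \<and>
        diff_list (flip e G) L' (Suc t) \<and> fst st' rcnt = triangles_at n s (flip e G))"
        by (rule runs_mono) (use 2 ab(1) corrected_length[OF L d] in auto)
    qed simp
  qed simp
  then show ?thesis by (simp add: fast_query_algorithm_def)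
qed

text \<open>Queries move the predicted time as well, so the answer is followed by an advance; 302 is
  2 for the answer plus 300.\<close>

lemma answer_runs:
  assumes rep: "rep G L t st" and d: "diff_list G L t" and t: "t < T"
  shows "runs w (Seq (Assign 0 (Reg rcnt)) advance_prog) st 302
    (\<lambda>st'. \<exists>L'. rep G L' (Suc t) st' \<and> diff_list G L' (Suc t) \<and>
      fst st' 0 = fst st rcnt \<and> fst st' rcnt = fst st rcnt)"
proof (rule runs_Seq)
  let ?st = "((fst st)(0 := fst st rcnt), snd st)"
  show "runs w (Assign 0 (Reg rcnt)) st 2 (\<lambda>st'. st' = ?st)" by (rule runs_straight) auto
  have rep': "rep G L t ?st" using rep by (simp add: rep_def)
  show "runs w advance_prog st' 300 (\<lambda>st'. \<exists>L'. rep G L' (Suc t) st' \<and> diff_list G L' (Suc t) \<and>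
      fst st' 0 = fst st rcnt \<and> fst st' rcnt = fst st rcnt)" if "st' = ?st" for st'
    unfolding that using advance_prog_runs[OF rep' d t] by (rule runs_mono) auto
qed simp

text \<open>\<open>K\<close> abstracts the bound on the symmetric difference at every time, and the
  list is exactly this difference, so its length is at most \<open>K\<close>. The assumption on
  \<open>rcnt\<close> is conditional because for \<open>T = 0\<close> the preprocessing computes no
  row and hence no count.\<close>

lemma fast_query_serves:
  assumes len: "length \<rho> = T" and valid: "valid_requests n \<rho>"
    and K: "\<And>t D. t \<le> T \<Longrightarrow> (\<And>e. e \<in> D \<longleftrightarrow> (e \<in> fold serve_request (take t \<rho>) E) \<noteq> (e \<in> predicted t)) \<Longrightarrow> card D \<le> K"
    and t: "t \<le> T" and G: "G = fold serve_request (take t \<rho>) E"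
    and rep: "rep G L t st" and d: "diff_list G L t"
    and cnt: "t < T \<Longrightarrow> fst st rcnt = triangles_at n s G"
  shows "serves w fast_query_algorithm n s (1300 * (K + 1)) 302 G st (drop t \<rho>)"
  using t G rep d cnt
proof (induction "T - t" arbitrary: t G L st)
  case 0
  then show ?case using len by simp
next
  case (Suc k)
  then have t: "t < T" by simp
  have dr: "drop t \<rho> = \<rho> ! t # drop (Suc t) \<rho>" using t len by (simp add: Cons_nth_drop_Suc)
  have GS: "serve_request (\<rho> ! t) G = fold serve_request (take (Suc t) \<rho>) E"
    using Suc.prems(2) t len by (simp add: take_Suc_conv_app_nth)
  have IH: "serves w fast_query_algorithm n s (1300 * (K + 1)) 302 G' st' (drop (Suc t) \<rho>)"
    if "G' = serve_request (\<rho> ! t) G" "rep G' L' (Suc t) st'" "diff_list G' L' (Suc t)"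
      "fst st' rcnt = triangles_at n s G'" for G' L' st'
    using Suc.hyps(2) t that GS by (intro Suc.hyps(1)[of "Suc t" G' L']) auto
  have L: "edge_list L" using Suc.prems by (simp add: rep_def)
  have "card (set L) \<le> K"
    using Suc.prems(1,2,4) by (intro K[of t]) (auto simp: diff_list_def)
  then have lenL: "length L \<le> K" using L by (simp add: distinct_card edge_list_def)
  have cnt: "fst st rcnt = triangles_at n s G" using Suc.prems(5)[OF t] .
  show ?case
  proof (cases "\<rho> ! t")
    case (Update e)
    then have "e \<in> nsets {..<n} 2" using valid t len nth_mem[of t \<rho>] by (auto simp: valid_requests_def)
    from fast_query_update_runs[OF Suc.prems(3,4) t this cnt]
    have "\<exists>tm st'. exec w (update_prog fast_query_algorithm) (pass_edge e st) tm st' \<and>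
      tm \<le> 1300 * (length L + 1) \<and>
      serves w fast_query_algorithm n s (1300 * (K + 1)) 302 (flip e G) st' (drop (Suc t) \<rho>)"
      by (rule exec_of_runs) (use IH Update in auto)
    then obtain tm st' where "exec w (update_prog fast_query_algorithm) (pass_edge e st) tm st'"
      "tm \<le> 1300 * (length L + 1)"
      "serves w fast_query_algorithm n s (1300 * (K + 1)) 302 (flip e G) st' (drop (Suc t) \<rho>)"
      by blast
    moreover have "1300 * (length L + 1) \<le> 1300 * (K + 1)" using lenL by simp
    ultimately show ?thesis unfolding dr Update serves.simps using order_trans by blast
  next
    case Query
    have "\<exists>tm st'. exec w (Seq (Assign 0 (Reg rcnt)) advance_prog) st tm st' \<and> tm \<le> 302 \<and>
      (fst st' 0 = triangles_at n s G \<and>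
      serves w fast_query_algorithm n s (1300 * (K + 1)) 302 G st' (drop (Suc t) \<rho>))"
      using answer_runs[OF Suc.prems(3,4) t] by (rule exec_of_runs) (use IH Query cnt in auto)
    then show ?thesis unfolding dr Query by (simp add: fast_query_algorithm_def)
  qed
qed

text \<open>No count is carried between requests: each query rebuilds it from the table row of the
  current time, so an update only has to maintain matrix and list.\<close>

lemma fast_update_serves:
  assumes len: "length \<rho> = T" and valid: "valid_requests n \<rho>"
    and K: "\<And>t D. t \<le> T \<Longrightarrow> (\<And>e. e \<in> D \<longleftrightarrow> (e \<in> fold serve_request (take t \<rho>) E) \<noteq> (e \<in> predicted t)) \<Longrightarrow> card D \<le> K"
    and t: "t \<le> T" and G: "G = fold serve_request (take t \<rho>) E"
    and rep: "rep G L t st" and d: "diff_list G L t"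
  shows "serves w fast_update_algorithm n s 604 (2000 * (K + 1)\<^sup>2 + 302) G st (drop t \<rho>)"
  using t G rep d
proof (induction "T - t" arbitrary: t G L st)
  case 0
  then show ?case using len by simp
next
  case (Suc k)
  then have t: "t < T" by simp
  have dr: "drop t \<rho> = \<rho> ! t # drop (Suc t) \<rho>" using t len by (simp add: Cons_nth_drop_Suc)
  have GS: "serve_request (\<rho> ! t) G = fold serve_request (take (Suc t) \<rho>) E"
    using Suc.prems(2) t len by (simp add: take_Suc_conv_app_nth)
  have IH: "serves w fast_update_algorithm n s 604 (2000 * (K + 1)\<^sup>2 + 302) G' st' (drop (Suc t) \<rho>)"
    if "G' = serve_request (\<rho> ! t) G" "rep G' L' (Suc t) st'" "diff_list G' L' (Suc t)" for G' L' st'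
    using Suc.hyps(2) t that GS by (intro Suc.hyps(1)[of "Suc t" G' L']) auto
  have L: "edge_list L" using Suc.prems by (simp add: rep_def)
  have "card (set L) \<le> K"
    using Suc.prems(1,2,4) by (intro K[of t]) (auto simp: diff_list_def)
  then have lenL: "length L \<le> K" using L by (simp add: distinct_card edge_list_def)
  show ?case
  proof (cases "\<rho> ! t")
    case (Update e)
    then have "e \<in> nsets {..<n} 2" using valid t len nth_mem[of t \<rho>] by (auto simp: valid_requests_def)
    then obtain a b where ab: "e = {a, b}" "a < b" "b < n" "Min e = a" "Max e = b" by (rule edgeE)
    have "runs w (Seq load_args record_update) (pass_edge e st) 604
      (\<lambda>st'. (\<exists>L'. rep (flip {a, b} G) L' (Suc t) st' \<and> diff_list (flip {a, b} G) L' (Suc t)) \<and>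
        fst st' rcnt = fst st rcnt)"
    proof (rule runs_Seq[OF load_args_runs[OF Suc.prems(3) ab(4,5)]])
      fix st' assume *: "rep G L t st' \<and> fst st' ra = a \<and> fst st' rb = b \<and> fst st' rcnt = fst st rcnt"
      then show "runs w record_update st' 600
        (\<lambda>st'. (\<exists>L'. rep (flip {a, b} G) L' (Suc t) st' \<and> diff_list (flip {a, b} G) L' (Suc t)) \<and>
        fst st' rcnt = fst st rcnt)"
        using record_update_runs[of G L t st' a b] Suc.prems(4) t ab by simp
    qed simp
    then have "\<exists>tm st'. exec w (Seq load_args record_update) (pass_edge e st) tm st' \<and> tm \<le> 604 \<and>
      serves w fast_update_algorithm n s 604 (2000 * (K + 1)\<^sup>2 + 302) (flip e G) st' (drop (Suc t) \<rho>)"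
      by (rule exec_of_runs) (use IH Update ab(1) in auto)
    then show ?thesis unfolding dr Update by (simp add: fast_update_algorithm_def)
  next
    case Query
    have "(length L + 1)\<^sup>2 \<le> (K + 1)\<^sup>2" using lenL by (intro power_mono) auto
    then have le: "2000 * (length L + 1)\<^sup>2 + 302 \<le> 2000 * (K + 1)\<^sup>2 + 302" by linarith
    have "runs w (Seq replay_prog (Seq (Assign 0 (Reg rcnt)) advance_prog)) st (2000 * (K + 1)\<^sup>2 + 302)
      (\<lambda>st'. \<exists>L'. rep G L' (Suc t) st' \<and> diff_list G L' (Suc t) \<and> fst st' 0 = triangles_at n s G)"
    proof (rule runs_Seq[OF replay_prog_runs[OF Suc.prems(3,4) t] _ le])
      fix st' assume *: "rep G L t st' \<and> fst st' rcnt = triangles_at n s G"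
      then have "rep G L t st'" by simp
      from answer_runs[OF this Suc.prems(4) t]
      show "runs w (Seq (Assign 0 (Reg rcnt)) advance_prog) st' 302
        (\<lambda>st'. \<exists>L'. rep G L' (Suc t) st' \<and> diff_list G L' (Suc t) \<and> fst st' 0 = triangles_at n s G)"
        by (rule runs_mono) (use * in auto)
    qed
    then have "\<exists>tm st'. exec w (Seq replay_prog (Seq (Assign 0 (Reg rcnt)) advance_prog)) st tm st' \<and>
      tm \<le> 2000 * (K + 1)\<^sup>2 + 302 \<and> (fst st' 0 = triangles_at n s G \<and>
      serves w fast_update_algorithm n s 604 (2000 * (K + 1)\<^sup>2 + 302) G st' (drop (Suc t) \<rho>))"
      by (rule exec_of_runs) (use IH Query in auto)
    then show ?thesis unfolding dr Query by (simp add: fast_update_algorithm_def)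
  qed
qed

section \<open>Preprocessing\<close>

text \<open>Graph and time are independent parameters, because the backward loop decrements the time
  before it undoes the request.\<close>

definition prep :: "nat set set \<Rightarrow> nat \<Rightarrow> nat \<Rightarrow> ram_state \<Rightarrow> bool" where
  "prep G t t0 st \<longleftrightarrow> env (fst st) \<and> fst st rt = t \<and> fst st rm = 0 \<and>
     matrix_ok (snd st) G \<and> list_ok (snd st) [] \<and> prediction_ok (snd st) \<and> table_ok (snd st) t0"

lemma predicted_flip_runs:
  assumes prep: "prep G t t0 st" and t: "t < T"
  shows "runs w predicted_flip st 100 (prep (serve_request (pr ! t) G) t t0)"
proof (rule runs_straight)
  show "straight predicted_flip" "cost predicted_flip \<le> 100"
    by (simp_all add: predicted_flip_def flip_prog_def expr_defs)
  have R: "env (fst st)" and rt: "fst st 9 = t" and A: "matrix_ok (snd st) G"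
    and P: "\<And>i. i < 3 \<Longrightarrow> snd st (addr (Prd t i)) = encode_request (pr ! t) ! i"
    using prep t by (auto simp: prep_def prediction_ok_def)
  define a where "a = snd st (addr (Prd t 1))"
  define b where "b = snd st (addr (Prd t 2))"
  define f where "f \<longleftrightarrow> pr ! t \<noteq> Query"
  have *: "a < n \<and> b < n \<and> snd st (addr (Prd t 0)) = of_bool f \<and>
    serve_request (pr ! t) G = (if f then flip {a, b} G else G)"
    using t
  proof (cases rule: pr_cases)
    case (Update e x y)
    then show ?thesis using P by (auto simp: a_def b_def f_def)
  next
    case Query
    \<comment> \<open>Both endpoints decode to 0, which is a vertex because
      \<open>s < n\<close>.\<close>
    then show ?thesis using P s by (auto simp: a_def b_def f_def)
  qed
  let ?st = "((fst st)(ra := a, rb := b), snd st)"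
  have "sem w (Seq (Assign ra (Load (prdA rt 1))) (Assign rb (Load (prdA rt 2)))) st = ?st"
    using R rt t by (simp add: a_def b_def)
  moreover have "sem w (flip_prog (Load (prdA rt 0))) ?st =
    ((fst ?st)(rz := of_bool (({a, b} \<in> G) \<noteq> f)),
    (snd ?st)(addr (Adj a b) := of_bool (({a, b} \<in> G) \<noteq> f), addr (Adj b a) := of_bool (({a, b} \<in> G) \<noteq> f)))"
    using R rt t A * by (intro sem_flip_prog) auto
  ultimately have eq: "sem w predicted_flip st = ((fst ?st)(rz := of_bool (({a, b} \<in> G) \<noteq> f)),
    (snd st)(addr (Adj a b) := of_bool (({a, b} \<in> G) \<noteq> f), addr (Adj b a) := of_bool (({a, b} \<in> G) \<noteq> f)))"
    by (simp add: predicted_flip_def)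
  show "prep (serve_request (pr ! t) G) t t0 (sem w predicted_flip st)"
    unfolding eq using prep matrix_ok_flip[OF A, of a b f] * by (simp add: prep_def)
qed

abbreviation (input) entry :: "nat set set \<Rightarrow> nat \<Rightarrow> nat \<Rightarrow> nat" where
  "entry G v x \<equiv> of_bool ({s, x} \<in> G) * of_bool ({v, x} \<in> G) * of_bool ({s, v} \<in> G) * of_bool (x < v)"

lemma sum_entry_le: "(\<Sum>x<m. entry G v x) \<le> m"
proof -
  have "(\<Sum>x<m. entry G v x) \<le> (\<Sum>x<m. 1)" by (intro sum_mono) auto
  then show ?thesis by simp
qed

lemma sum_sum_entry_le: "(\<Sum>v<m. \<Sum>x<n. entry G v x) \<le> m * n"
proof -
  have "(\<Sum>v<m. \<Sum>x<n. entry G v x) \<le> (\<Sum>v<m. n)" by (intro sum_mono sum_entry_le)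
  then show ?thesis by simp
qed

lemma table_ok_upd_Tab [simp]:
  "t < T \<Longrightarrow> v \<le> n \<Longrightarrow> table_ok (M(addr (Tab t v) := x)) (Suc t) = table_ok M (Suc t)"
  by (auto simp: table_ok_def)

definition row_inv :: "nat set set \<Rightarrow> nat \<Rightarrow> nat \<Rightarrow> ram_state \<Rightarrow> bool" where
  "row_inv G t v st \<longleftrightarrow> prep G t (Suc t) st \<and> fst st rv = v \<and>
     (\<forall>v'<v. snd st (addr (Tab t v')) = codegree n G s v') \<and>
     fst st rcnt = (\<Sum>v'<v. \<Sum>x<n. entry G v' x)"

lemma entry_prog_runs:
  assumes inv: "row_inv G t v st" and t: "t < T" and v: "v < n"
  shows "runs w entry_prog st (104 * n + 100) (row_inv G t (Suc v))"
proof -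
  let ?cnt = "\<Sum>v'<v. \<Sum>x<n. entry G v' x"
  let ?g = "\<lambda>x. of_bool ({s, x} \<in> G) * of_bool ({v, x} \<in> G) :: nat"
  have cnt_le: "?cnt \<le> v * n" by (rule sum_sum_entry_le)
  have R: "env (fst st)" and A: "matrix_ok (snd st) G" using inv by (auto simp: row_inv_def prep_def)
  define I where "I x st' \<longleftrightarrow> snd st' = snd st \<and> (\<forall>r<16. r \<noteq> rcnt \<longrightarrow> fst st' r = fst st r) \<and>
    fst st' rx = x \<and> fst st' rc = (\<Sum>x'<x. ?g x') \<and> fst st' rcnt = ?cnt + (\<Sum>x'<x. entry G v x')" for x st'
  let ?b = "Seq (Assign rz (Bin Mul (Load (adjA rs rx)) (Load (adjA rv rx))))
       (Seq (Assign rc (Bin Add (Reg rc) (Reg rz)))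
       (Seq (Assign rcnt (Bin Add (Reg rcnt)
              (Bin Mul (Bin Mul (Reg rz) (Load (adjA rs rv))) (Bin Less (Reg rx) (Reg rv)))))
            (Assign rx (Bin Add (Reg rx) (Const 1)))))"
  show ?thesis unfolding entry_prog_def
  proof (rule runs_Seq)
    show "runs w (Seq (Assign rc (Const 0)) (Assign rx (Const 0))) st 4 (I 0)"
      by (rule runs_straight) (use inv in \<open>auto simp: I_def row_inv_def\<close>)
    show "runs w (Seq (While (Bin Less (Reg rx) (Reg rn)) ?b)
     (Seq (Store (tabA rt rv) (Reg rc)) (Assign rv (Bin Add (Reg rv) (Const 1))))) st0 (104 * n + 54) (row_inv G t (Suc v))"
      if "I 0 st0" for st0
    proof (rule runs_Seq)
      show "runs w (While (Bin Less (Reg rx) (Reg rn)) ?b) st0 (104 * n + 4) (I n)"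
      proof (rule runs_While[where I = I and N = n and t = 100])
        show "eval_expr w (Bin Less (Reg rx) (Reg rn)) st' \<noteq> 0 \<and> runs w ?b st' 100 (I (Suc x))"
          if x: "x < n" "I x st'" for x st'
        proof
          have R': "env (fst st')" using R x(2) by (simp add: I_def env_def)
          then show "eval_expr w (Bin Less (Reg rx) (Reg rn)) st' \<noteq> 0"
            using x by (simp add: eval_Less I_def env_regs)
          have regs: "fst st' rv = v" "fst st' rx = x" using x inv by (auto simp: I_def row_inv_def)
          have mem: "snd st' (addr (Adj u y)) = of_bool ({u, y} \<in> G)" if "u < n" "y < n" for u y
            using A that x by (simp add: I_def matrix_ok_def)
          \<comment> \<open>Bounds on the two running sums, which exclude wraparound in the
            additions below.\<close>
          have c1: "(\<Sum>x'<x. ?g x') + ?g x \<le> n"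
          proof -
            have "(\<Sum>x'<Suc x. ?g x') \<le> (\<Sum>x'<Suc x. 1)" by (intro sum_mono) auto
            then show ?thesis using x(1) by simp
          qed
          have c2: "?cnt + (\<Sum>x'<x. entry G v x') + entry G v x \<le> n * n"
          proof -
            have "(\<Sum>x'<x. entry G v x') + entry G v x \<le> n"
              using sum_entry_le[of G v "Suc x"] x(1) by simp
            moreover have "v * n + n \<le> n * n"
              using mult_right_mono[of "Suc v" n n] v by simp
            ultimately show ?thesis using cnt_le by linarith
          qed
          have e1: "eval_expr w (Bin Mul (Load (adjA rs rx)) (Load (adjA rv rx))) st' = ?g x"
            using R' regs x v s mem W_less(9) by (simp add: eval_Mul env_regs)
          let ?st1 = "((fst st')(rz := ?g x), snd st')"
          have e2: "eval_expr w (Bin Add (Reg rc) (Reg rz)) ?st1 = (\<Sum>x'<Suc x. ?g x')"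
            using x c1 W_less(1) by (simp add: eval_Add I_def)
          let ?st2 = "((fst st')(rz := ?g x, rc := \<Sum>x'<Suc x. ?g x'), snd st')"
          have e3: "eval_expr w (Bin Mul (Bin Mul (Reg rz) (Load (adjA rs rv))) (Bin Less (Reg rx) (Reg rv))) ?st2
            = entry G v x"
            using R' regs x v s mem W_less(9) by (simp add: eval_Mul eval_Less env_regs)
          have e4: "eval_expr w (Bin Add (Reg rcnt) (Bin Mul (Bin Mul (Reg rz) (Load (adjA rs rv))) (Bin Less (Reg rx) (Reg rv)))) ?st2
            = ?cnt + (\<Sum>x'<Suc x. entry G v x')"
          proof -
            have r: "eval_expr w (Reg rcnt) ?st2 = ?cnt + (\<Sum>x'<x. entry G v x')"
              using x(2) unfolding I_def by simp
            have "eval_expr w (Reg rcnt) ?st2 + eval_expr w (Bin Mul (Bin Mul (Reg rz) (Load (adjA rs rv)))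
                (Bin Less (Reg rx) (Reg rv))) ?st2 < W"
              unfolding r e3 using c2 W_less(6) by linarith
            from eval_Add[OF this] show ?thesis
              unfolding r e3 by (simp only: sum.lessThan_Suc add.assoc)
          qed
          let ?st3 = "((fst st')(rz := ?g x, rc := \<Sum>x'<Suc x. ?g x',
            rcnt := ?cnt + (\<Sum>x'<Suc x. entry G v x')), snd st')"
          have e5: "eval_expr w (Bin Add (Reg rx) (Const 1)) ?st3 = Suc x"
            using regs x W_less(1) by (simp add: eval_Add)
          have "sem w ?b st' = ((fst ?st3)(rx := Suc x), snd st')"
            using e1 e2 e4 e5 by (simp only: sem.simps fst_conv snd_conv)
          then show "runs w ?b st' 100 (I (Suc x))"
            by (intro runs_straight) (use x in \<open>auto simp: I_def\<close>, simp add: expr_defs)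
        qed
        show "eval_expr w (Bin Less (Reg rx) (Reg rn)) st' = 0" if "I n st'" for st'
          using that R by (simp add: eval_Less I_def env_regs)
      qed (use that in auto)
      show "runs w (Seq (Store (tabA rt rv) (Reg rc)) (Assign rv (Bin Add (Reg rv) (Const 1)))) st' 50 (row_inv G t (Suc v))"
        if "I n st'" for st'
      proof (rule runs_straight)
        have R': "env (fst st')" using R that by (simp add: I_def env_def)
        have regs: "fst st' 14 = v" "fst st' 9 = t" "fst st' 10 = 0" using that inv by (auto simp: I_def row_inv_def prep_def)
        have rc: "fst st' 16 = codegree n G s v" using that by (simp add: I_def codegree_sum)
        have "sem w (Seq (Store (tabA rt rv) (Reg rc)) (Assign rv (Bin Add (Reg rv) (Const 1)))) st' =
          ((fst st')(rv := Suc v), (snd st)(addr (Tab t v) := codegree n G s v))"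
          using R' regs rc t v that W_less(1) by (simp add: eval_Add I_def)
        moreover have "row_inv G t (Suc v) ((fst st')(rv := Suc v), (snd st)(addr (Tab t v) := codegree n G s v))"
          using inv R' regs that t v by (auto simp: row_inv_def prep_def I_def less_Suc_eq)
        ultimately show "row_inv G t (Suc v) (sem w (Seq (Store (tabA rt rv) (Reg rc)) (Assign rv (Bin Add (Reg rv) (Const 1)))) st')"
          by (simp only:)
      qed (simp_all add: expr_defs)
    qed simp
  qed simp
qed

text \<open>After the scan over all \<open>v\<close>, \<open>rcnt\<close> holds the double sum of
  \<open>triangles_at_sum\<close>; storing it in column \<open>n\<close> extends the finished part
  of the table from \<open>Suc t\<close> down to \<open>t\<close>.\<close>

lemma row_prog_runs:
  assumes prep: "prep (predicted t) t (Suc t) st" and t: "t < T"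
  shows "runs w row_prog st (n * (104 * n + 104) + 100) (\<lambda>st'. prep (predicted t) t t st' \<and>
    fst st' rcnt = triangles_at n s (predicted t))"
  unfolding row_prog_def
proof (rule runs_Seq)
  show "runs w (Seq (Assign rcnt (Const 0)) (Assign rv (Const 0))) st 4 (row_inv (predicted t) t 0)"
    by (rule runs_straight) (use prep in \<open>auto simp: row_inv_def prep_def\<close>)
  show "runs w (Seq (While (Bin Less (Reg rv) (Reg rn)) entry_prog) (Store (tabA rt rn) (Reg rcnt))) st'
    (n * (104 * n + 104) + 54) (\<lambda>st'. prep (predicted t) t t st' \<and> fst st' rcnt = triangles_at n s (predicted t))"
    if "row_inv (predicted t) t 0 st'" for st'
  proof (rule runs_Seq)
    show "runs w (While (Bin Less (Reg rv) (Reg rn)) entry_prog) st' (n * (104 * n + 104) + 4) (row_inv (predicted t) t n)"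
    proof (rule runs_While[where I = "row_inv (predicted t) t" and N = n and t = "104 * n + 100"])
      show "eval_expr w (Bin Less (Reg rv) (Reg rn)) st' \<noteq> 0 \<and> runs w entry_prog st' (104 * n + 100) (row_inv (predicted t) t (Suc v))"
        if "v < n" "row_inv (predicted t) t v st'" for v st'
        using entry_prog_runs[OF that(2) t that(1)] that
        by (simp add: eval_Less row_inv_def prep_def env_regs)
    qed (use that in \<open>auto simp: eval_Less row_inv_def prep_def env_regs\<close>)
    show "runs w (Store (tabA rt rn) (Reg rcnt)) st' 50 (\<lambda>st'. prep (predicted t) t t st' \<and>
      fst st' rcnt = triangles_at n s (predicted t))" if inv: "row_inv (predicted t) t n st'" for st'
    proof (rule runs_straight)
      have R: "env (fst st')" and rt: "fst st' 9 = t" using inv by (auto simp: row_inv_def prep_def)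
      have cnt: "fst st' 11 = triangles_at n s (predicted t)"
        using inv triangles_at_sum[OF is_graph_predicted s, of t] by (simp add: row_inv_def)
      have eq: "sem w (Store (tabA rt rn) (Reg rcnt)) st' =
        (fst st', (snd st')(addr (Tab t n) := triangles_at n s (predicted t)))"
        using R rt t cnt by (simp add: env_regs)
      have T0: "table_ok (snd st') (Suc t)" "\<And>v. v < n \<Longrightarrow> snd st' (addr (Tab t v)) = codegree n (predicted t) s v"
        using inv by (auto simp: row_inv_def prep_def)
      have "table_ok ((snd st')(addr (Tab t n) := triangles_at n s (predicted t))) t"
        unfolding table_ok_def
      proof (intro allI impI)
        fix t' assume t': "t' < T" "t \<le> t'"
        show "(\<forall>v<n. ((snd st')(addr (Tab t n) := triangles_at n s (predicted t))) (addr (Tab t' v)) = codegree n (predicted t') s v) \<and>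
          ((snd st')(addr (Tab t n) := triangles_at n s (predicted t))) (addr (Tab t' n)) = triangles_at n s (predicted t')"
        proof (cases "t' = t")
          case True
          then show ?thesis using T0(2) t by simp
        next
          case False
          then have "Suc t \<le> t'" using t' by simp
          then show ?thesis using T0(1) t t' False by (simp add: table_ok_def)
        qed
      qed
      then show "prep (predicted t) t t (sem w (Store (tabA rt rn) (Reg rcnt)) st') \<and>
        fst (sem w (Store (tabA rt rn) (Reg rcnt)) st') rcnt = triangles_at n s (predicted t)"
        unfolding eq using inv cnt t by (simp add: row_inv_def prep_def)
    qed (simp_all add: expr_defs)
  qed simp
qed simp

text \<open>A flip is its own inverse, so serving a predicted request once more undoes it; the
  backward loop rests on this.\<close>

lemma serve_request_predicted: "t < T \<Longrightarrow> serve_request (pr ! t) (predicted (Suc t)) = predicted t"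
  by (cases "pr ! t") (auto simp: predicted_Suc flip_def)

end

section \<open>Reading the flat encoding of the input\<close>

lemma nth_concat_uniform:
  "(\<And>xs. xs \<in> set xss \<Longrightarrow> length xs = m) \<Longrightarrow> i < length xss \<Longrightarrow> j < m \<Longrightarrow> concat xss ! (i * m + j) = xss ! i ! j"
proof (induction xss arbitrary: i)
  case (Cons xs xss)
  then show ?case
  proof (cases i)
    case (Suc k)
    then have "concat (xs # xss) ! (i * m + j) = concat xss ! (k * m + j)"
      using Cons.prems(1)[of xs] by (simp add: nth_append)
    then show ?thesis using Cons Suc by simp
  qed (simp add: nth_append)
qed simp

lemma length_concat_uniform:
  "(\<And>xs. xs \<in> set xss \<Longrightarrow> length xs = m) \<Longrightarrow> length (concat xss) = length xss * m"
  by (induction xss) auto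

lemma length_encode_request: "length (encode_request r) = 3"
  by (cases r) auto

context ram_instance begin

abbreviation (input) "input \<equiv> encode_input n s E pr"

lemma input_blocks:
  shows "length (concat (map (\<lambda>u. map (\<lambda>v. if {u, v} \<in> E then 1 else 0 :: nat) [0..<n]) [0..<n])) = n * n"
    and "length (concat (map encode_request pr)) = T * 3"
proof -
  show "length (concat (map (\<lambda>u. map (\<lambda>v. if {u, v} \<in> E then 1 else 0 :: nat) [0..<n]) [0..<n])) = n * n"
    by (subst length_concat_uniform[where m = n]) auto
  show "length (concat (map encode_request pr)) = T * 3"
    by (subst length_concat_uniform[where m = 3]) (auto simp: length_encode_request pr)
qed

lemma length_input: "length input = 3 + n * n + 3 * T"
  unfolding encode_input_def by (simp only: length_append input_blocks list.size)

lemma input_Adj: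
  assumes "u < n" "v < n"
  shows "input ! addr (Adj u v) = of_bool ({u, v} \<in> E)"
proof -
  let ?xs = "map (\<lambda>u. map (\<lambda>v. if {u, v} \<in> E then 1 else 0 :: nat) [0..<n]) [0..<n]"
  have "input ! addr (Adj u v) = (concat ?xs @ concat (map encode_request pr)) ! (u * n + v)"
    by (simp add: encode_input_def addr.simps)
  also have "\<dots> = concat ?xs ! (u * n + v)"
    using pair_less[OF assms] by (simp only: nth_append input_blocks if_True)
  also have "\<dots> = ?xs ! u ! v" using assms by (intro nth_concat_uniform) auto
  finally show ?thesis using assms by simp
qed

lemma input_Prd:
  assumes "q < T" "i < 3"
  shows "input ! addr (Prd q i) = encode_request (pr ! q) ! i"
proof -
  let ?xs = "map (\<lambda>u. map (\<lambda>v. if {u, v} \<in> E then 1 else 0 :: nat) [0..<n]) [0..<n]"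
  have "input ! addr (Prd q i) = (concat ?xs @ concat (map encode_request pr)) ! (n * n + (q * 3 + i))"
    by (simp add: encode_input_def addr.simps mult.commute)
  also have "\<dots> = concat (map encode_request pr) ! (q * 3 + i)"
    by (simp only: nth_append input_blocks) simp
  also have "\<dots> = map encode_request pr ! q ! i"
    using assms pr by (intro nth_concat_uniform) (auto simp: length_encode_request)
  finally show ?thesis using assms pr by simp
qed

lemma input_less: "set input \<subseteq> {..<W}"
proof -
  have lt: "encode_request r ! i < W" if "r \<in> set pr" "i < 3" for r i
  proof (cases r)
    case (Update e)
    then have "e \<in> nsets {..<n} 2" using pr(2) that by (auto simp: valid_requests_def)
    then obtain a b where "e = {a, b}" "a < b" "b < n" "Min e = a" "Max e = b" by (rule edgeE)
    moreover have "i = 0 \<or> i = 1 \<or> i = 2" using that by auto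
    ultimately show ?thesis using Update W_less by auto
  next
    case Query
    moreover have "i = 0 \<or> i = 1 \<or> i = 2" using that by auto
    ultimately show ?thesis using W_less by auto
  qed
  have "set (encode_request r) \<subseteq> {..<W}" if "r \<in> set pr" for r
    using lt[OF that] length_encode_request[of r] by (auto simp: in_set_conv_nth[of _ "encode_request r"])
  moreover have "(if c then 1 else 0 :: nat) < W" for c using W_less by auto
  ultimately show ?thesis using W_less pr(1) by (auto simp: encode_input_def)
qed

lemma setup_prog_runs:
  "runs w setup_prog (initial_state input) 60 (prep E 0 T)"
proof (rule runs_straight)
  let ?M = "snd (initial_state input)"
  have M: "?M a = (if a < 3 + n * n + 3 * T then input ! a else 0)" for a
    by (simp add: initial_state_def length_input)
  have M0: "?M 0 = n" "?M 1 = s" "?M 2 = T"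
    unfolding M by (simp_all add: encode_input_def pr)
  have e: "(T + 1) * (n + 1) = T * n + T + n + 1" by simp
  have big': "3 + 3 * (n * n) + 3 * T < W" using big unfolding e by linarith
  have fst0: "fst (initial_state input) r = 0" for r by (simp add: initial_state_def)
  have eq: "sem w setup_prog (initial_state input) = ((fst (initial_state input))(rn := n, rs := s, rT := T,
     rP := 3 + n * n, rD := 3 + n * n + 3 * T, rL := 3 + 2 * (n * n) + 3 * T, rX := 3 + 3 * (n * n) + 3 * T), ?M)"
    using big' M0 by (simp add: setup_prog_def eval_Add eval_Mul) (simp add: ac_simps)
  have "matrix_ok ?M E"
    unfolding matrix_ok_def
  proof (intro allI impI)
    fix u v assume "u < n" "v < n"
    moreover have "addr (Adj u v) < 3 + n * n + 3 * T"
      using addr_bounds[of "Adj u v"] calculation by simp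
    ultimately show "?M (addr (Adj u v)) = of_bool ({u, v} \<in> E)" by (simp add: M input_Adj)
  qed
  moreover have "prediction_ok ?M"
    unfolding prediction_ok_def
  proof (intro allI impI)
    fix q i :: nat assume "q < T" "i < 3"
    moreover have "addr (Prd q i) < 3 + n * n + 3 * T"
      using addr_bounds[of "Prd q i"] calculation by simp
    ultimately show "?M (addr (Prd q i)) = encode_request (pr ! q) ! i" by (simp add: M input_Prd)
  qed
  \<comment> \<open>Memory behind the input is 0, so the position matrix represents the empty list
    without any initialisation.\<close>
  moreover have "list_ok ?M []"
    unfolding list_ok_def M by (auto simp: addr.simps)
  moreover have "table_ok ?M T" by (simp add: table_ok_def)
  ultimately show "prep E 0 T (sem w setup_prog (initial_state input))"
    unfolding eq by (simp add: prep_def env_def fst0)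
qed (simp_all add: setup_prog_def)

lemma table_prog_runs:
  "runs w table_prog (initial_state input) (200 + T * (500 + n * (104 * n + 104)))
    (\<lambda>st. rep E [] 0 st \<and> (0 < T \<longrightarrow> fst st rcnt = triangles_at n s E))"
  unfolding table_prog_def
proof (rule runs_Seq[OF setup_prog_runs])
  let ?c1 = "Bin Less (Reg rt) (Reg rT)"
  let ?b1 = "Seq predicted_flip (Assign rt (Bin Add (Reg rt) (Const 1)))"
  let ?c2 = "Bin Less (Const 0) (Reg rt)"
  let ?b2 = "Seq (Assign rt (Bin Sub (Reg rt) (Const 1))) (Seq predicted_flip row_prog)"
  fix st0 assume st0: "prep E 0 T st0"
  show "runs w (Seq (While ?c1 ?b1) (While ?c2 ?b2)) st0 (140 + T * (500 + n * (104 * n + 104)))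
    (\<lambda>st. rep E [] 0 st \<and> (0 < T \<longrightarrow> fst st rcnt = triangles_at n s E))"
  proof (rule runs_Seq)
    show "runs w (While ?c1 ?b1) st0 (T * 114 + 4) (prep (predicted T) T T)"
    proof (rule runs_While[where I = "\<lambda>t. prep (predicted t) t T" and N = T and t = 110])
      show "eval_expr w ?c1 st \<noteq> 0 \<and> runs w ?b1 st 110 (prep (predicted (Suc t)) (Suc t) T)"
        if t: "t < T" and st: "prep (predicted t) t T st" for t st
      proof
        show "eval_expr w ?c1 st \<noteq> 0" using t st by (simp add: eval_Less prep_def env_regs)
        show "runs w ?b1 st 110 (prep (predicted (Suc t)) (Suc t) T)"
        proof (rule runs_Seq[OF predicted_flip_runs[OF st t]])
          fix st' assume "prep (serve_request (pr ! t) (predicted t)) t T st'"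
          then show "runs w (Assign rt (Bin Add (Reg rt) (Const 1))) st' 10 (prep (predicted (Suc t)) (Suc t) T)"
            using t W_less(4) by (intro runs_straight) (auto simp: eval_Add prep_def predicted_Suc)
        qed simp
      qed
      show "prep (predicted 0) 0 T st0" using st0 by (simp add: predicted_def)
      show "eval_expr w ?c1 st = 0" if "prep (predicted T) T T st" for st
        using that by (simp add: eval_Less prep_def env_regs)
    qed auto
    fix st1 assume st1: "prep (predicted T) T T st1"
    \<comment> \<open>\<open>i\<close> counts the finished rows, which are those with the largest
      times; the count is available once a row is finished.\<close>
    define I where "I i st \<longleftrightarrow> prep (predicted (T - i)) (T - i) (T - i) st \<and>
      (0 < i \<longrightarrow> fst st rcnt = triangles_at n s (predicted (T - i)))" for i st
    show "runs w (While ?c2 ?b2) st1 (T * (n * (104 * n + 104) + 300) + 4)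
      (\<lambda>st. rep E [] 0 st \<and> (0 < T \<longrightarrow> fst st rcnt = triangles_at n s E))"
    proof (rule runs_While[where I = I and N = T and t = "n * (104 * n + 104) + 250"])
      show "eval_expr w ?c2 st \<noteq> 0 \<and> runs w ?b2 st (n * (104 * n + 104) + 250) (I (Suc i))"
        if i: "i < T" and st: "I i st" for i st
      proof
        define t where "t = T - Suc i"
        have t: "t < T" "T - i = Suc t" using i by (auto simp: t_def)
        have p: "prep (predicted (Suc t)) (Suc t) (Suc t) st" using st t by (simp add: I_def)
        then show "eval_expr w ?c2 st \<noteq> 0" by (simp add: eval_Less prep_def)
        show "runs w ?b2 st (n * (104 * n + 104) + 250) (I (Suc i))"
        proof (rule runs_Seq)
          show "runs w (Assign rt (Bin Sub (Reg rt) (Const 1))) st 10 (prep (predicted (Suc t)) t (Suc t))"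
            using p t(1) W_less(4) by (intro runs_straight) (auto simp: eval_Sub prep_def)
          fix st' assume st': "prep (predicted (Suc t)) t (Suc t) st'"
          show "runs w (Seq predicted_flip row_prog) st' (n * (104 * n + 104) + 200) (I (Suc i))"
          proof (rule runs_Seq[OF predicted_flip_runs[OF st' t(1)]])
            fix st2 assume "prep (serve_request (pr ! t) (predicted (Suc t))) t (Suc t) st2"
            then have "prep (predicted t) t (Suc t) st2" by (simp add: serve_request_predicted[OF t(1)])
            from row_prog_runs[OF this t(1)]
            show "runs w row_prog st2 (n * (104 * n + 104) + 100) (I (Suc i))"
              by (rule runs_mono) (auto simp: I_def t_def)
          qed simp
        qed simp
      qed
      show "I 0 st1" using st1 by (simp add: I_def)
      show "eval_expr w ?c2 st = 0" if "I T st" for st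
        using that by (simp add: eval_Less prep_def I_def)
      show "rep E [] 0 st \<and> (0 < T \<longrightarrow> fst st rcnt = triangles_at n s E)" if "I T st" for st
        using that E by (simp add: I_def prep_def rep_def edge_list_def predicted_def)
      have "1 + expr_cost ?c2 + (n * (104 * n + 104) + 250) \<le> n * (104 * n + 104) + 300" by simp
      from mult_left_mono[OF this, of T]
      show "T * (1 + expr_cost ?c2 + (n * (104 * n + 104) + 250)) + (1 + expr_cost ?c2)
        \<le> T * (n * (104 * n + 104) + 300) + 4" by simp
    qed
  qed (simp add: add_mult_distrib2)
qed simp

end

section \<open>Running times\<close>

text \<open>Isolates what both algorithms share: preprocessing, encoding bounds and the size of the
  difference. Their time bounds depend only on \<open>K\<close>, which is instantiated with
  \<open>2 * (d + k)\<close> here.\<close>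

lemma solves_with_predictionI:
  assumes large: "\<And>n. n \<ge> 1 \<Longrightarrow> 10 + 3 * (n * n) + 3 * T n + (T n + 1) * (n + 1) < 2 ^ word_length c n"
    and pre: "preprocess_prog A = table_prog"
    and serves: "\<And>n s E pr \<rho> K st. ram_instance n s (T n) (word_length c n) (2 ^ word_length c n) E pr \<Longrightarrow>
      length \<rho> = T n \<Longrightarrow> valid_requests n \<rho> \<Longrightarrow>
      (\<And>t D. t \<le> T n \<Longrightarrow> (\<And>e. e \<in> D \<longleftrightarrow> (e \<in> fold serve_request (take t \<rho>) E) \<noteq>
         (e \<in> fold serve_request (take t pr) E)) \<Longrightarrow> card D \<le> K) \<Longrightarrow>
      ram_instance.rep n s (T n) E pr E [] 0 st \<Longrightarrow> (0 < T n \<Longrightarrow> fst st rcnt = triangles_at n s E) \<Longrightarrow>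
      serves (word_length c n) A n s (U K) (Q K) E st \<rho>"
  shows "solves_with_prediction A c T (\<lambda>n. 200 + T n * (500 + n * (104 * n + 104)))
    (\<lambda>n d k. U (2 * (d + k))) (\<lambda>n d k. Q (2 * (d + k)))"
  unfolding solves_with_prediction_def Let_def
proof (intro allI impI)
  fix n s E \<rho> \<rho>' d k
  assume a: "s < n" "is_graph n E" "length \<rho> = T n" "valid_requests n \<rho>" "valid_requests n \<rho>'"
    "delayed_prediction d k \<rho> \<rho>'"
  let ?w = "word_length c n" and ?xs = "encode_input n s E \<rho>'"
  have "length \<rho>' = T n" using a by (simp add: delayed_prediction_def)
  then interpret ram_instance n s "T n" ?w "2 ^ ?w" E \<rho>'
    using a large[of n] by unfold_locales auto
  have "3 + n * n + 3 * T n \<le> 2 ^ ?w" using large[of n] a(1) by linarith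
  then have 1: "length ?xs \<le> 2 ^ ?w" by (simp add: length_input)
  have "\<exists>t st. exec ?w table_prog (initial_state ?xs) t st \<and>
    t \<le> 200 + T n * (500 + n * (104 * n + 104)) \<and>
    (rep E [] 0 st \<and> (0 < T n \<longrightarrow> fst st rcnt = triangles_at n s E))"
    using table_prog_runs unfolding runs_def .
  then obtain t st where st: "exec ?w table_prog (initial_state ?xs) t st"
    "t \<le> 200 + T n * (500 + n * (104 * n + 104))"
    "rep E [] 0 st" "0 < T n \<longrightarrow> fst st rcnt = triangles_at n s E"
    by (elim exE conjE)
  have "serves ?w A n s (U (2 * (d + k))) (Q (2 * (d + k))) E st \<rho>"
  proof (rule serves[OF ram_instance_axioms a(3,4) _ st(3)])
    fix t D
    assume "t \<le> T n" and D: "\<And>e. e \<in> D \<longleftrightarrow> (e \<in> fold serve_request (take t \<rho>) E) \<noteq>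
      (e \<in> fold serve_request (take t \<rho>') E)"
    then have "t \<le> length \<rho>" using a(3) by simp
    then show "card D \<le> 2 * (d + k)" using D by (rule card_graph_difference_le[OF a(6)])
  qed (use st(4) in simp)
  then show "length ?xs \<le> 2 ^ ?w \<and> set ?xs \<subseteq> {..<2 ^ ?w} \<and>
    (\<exists>t st. exec ?w (preprocess_prog A) (initial_state ?xs) t st \<and>
      t \<le> 200 + T n * (500 + n * (104 * n + 104)) \<and>
      serves ?w A n s (U (2 * (d + k))) (Q (2 * (d + k))) E st \<rho>)"
    unfolding pre by (intro conjI exI[of _ t] exI[of _ st] 1 input_less st(1,2))
qed

theorem theorem8p7:
  fixes T :: "nat \<Rightarrow> nat"
  assumes "polynomially_bounded T"
  shows
    "(\<exists>A c P U Q. solves_with_prediction A c T P U Q \<and> polynomially_bounded P \<and>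
        time_bigo U (\<lambda>d k. d + k) \<and> time_bigo Q (\<lambda>d k. 1)) \<and>
     (\<exists>A c P U Q. solves_with_prediction A c T P U Q \<and> polynomially_bounded P \<and>
        time_bigo U (\<lambda>d k. 1) \<and> time_bigo Q (\<lambda>d k. (d + k)\<^sup>2))"
proof -
  \<comment> \<open>All requirements on the word size form one polynomial in \<open>n\<close>,
    because \<open>T\<close> is polynomial; this fixes the factor \<open>c\<close>.\<close>
  have "polynomially_bounded (\<lambda>n. 10 + 3 * (n * n) + 3 * T n + (T n + 1) * (n + 1))"
    by (intro polynomially_bounded_intros assms)
  then obtain c where c: "\<And>n. n \<ge> 1 \<Longrightarrow>
      10 + 3 * (n * n) + 3 * T n + (T n + 1) * (n + 1) < 2 ^ word_length c n"
    using polynomially_bounded_word_length by blast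
  let ?P = "\<lambda>n. 200 + T n * (500 + n * (104 * n + 104))"
  have P: "polynomially_bounded ?P"
    by (intro polynomially_bounded_intros assms)
  have "solves_with_prediction fast_query_algorithm c T ?P
    (\<lambda>n d k. 1300 * (2 * (d + k) + 1)) (\<lambda>n d k. 302)"
  proof (rule solves_with_predictionI[OF c])
    fix n s E pr \<rho> K st
    assume i: "ram_instance n s (T n) (word_length c n) (2 ^ word_length c n) E pr"
      and *: "length \<rho> = T n" "valid_requests n \<rho>"
      and K: "\<And>t D. t \<le> T n \<Longrightarrow> (\<And>e. e \<in> D \<longleftrightarrow> (e \<in> fold serve_request (take t \<rho>) E) \<noteq>
         (e \<in> fold serve_request (take t pr) E)) \<Longrightarrow> card D \<le> K"
      and st: "ram_instance.rep n s (T n) E pr E [] 0 st" "0 < T n \<Longrightarrow> fst st rcnt = triangles_at n s E"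
    interpret ram_instance n s "T n" "word_length c n" "2 ^ word_length c n" E pr by (rule i)
    have "serves (word_length c n) fast_query_algorithm n s (1300 * (K + 1)) 302 E st (drop 0 \<rho>)"
      using * st K by (intro fast_query_serves[where L = "[]"]) (auto simp: diff_list_def predicted_def)
    then show "serves (word_length c n) fast_query_algorithm n s (1300 * (K + 1)) 302 E st \<rho>" by simp
  qed (simp_all add: fast_query_algorithm_def)
  moreover have "solves_with_prediction fast_update_algorithm c T ?P
    (\<lambda>n d k. 604) (\<lambda>n d k. 2000 * (2 * (d + k) + 1)\<^sup>2 + 302)"
  proof (rule solves_with_predictionI[OF c])
    fix n s E pr \<rho> K st
    assume i: "ram_instance n s (T n) (word_length c n) (2 ^ word_length c n) E pr"
      and *: "length \<rho> = T n" "valid_requests n \<rho>"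
      and K: "\<And>t D. t \<le> T n \<Longrightarrow> (\<And>e. e \<in> D \<longleftrightarrow> (e \<in> fold serve_request (take t \<rho>) E) \<noteq>
         (e \<in> fold serve_request (take t pr) E)) \<Longrightarrow> card D \<le> K"
      and st: "ram_instance.rep n s (T n) E pr E [] 0 st"
    interpret ram_instance n s "T n" "word_length c n" "2 ^ word_length c n" E pr by (rule i)
    have "serves (word_length c n) fast_update_algorithm n s 604 (2000 * (K + 1)\<^sup>2 + 302) E st (drop 0 \<rho>)"
      using * st K by (intro fast_update_serves[where L = "[]"]) (auto simp: diff_list_def predicted_def)
    then show "serves (word_length c n) fast_update_algorithm n s 604 (2000 * (K + 1)\<^sup>2 + 302) E st \<rho>" by simp
  qed (simp_all add: fast_update_algorithm_def)
  moreover have "time_bigo (\<lambda>n d k. 1300 * (2 * (d + k) + 1)) (\<lambda>d k. d + k)"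
    \<comment> \<open>3900 is 3 * 1300, since \<open>2 * m + 1 \<le> 3 * max 1 m\<close>.\<close>
    unfolding time_bigo_def by (rule exI[of _ 3900]) (auto simp: max_def)
  moreover have "time_bigo (\<lambda>n d k. C) (\<lambda>d k. 1)" for C
    unfolding time_bigo_def by auto
  moreover have "time_bigo (\<lambda>n d k. 2000 * (2 * (d + k) + 1)\<^sup>2 + 302) (\<lambda>d k. (d + k)\<^sup>2)"
    unfolding time_bigo_def
  proof (intro exI allI)
    fix n d k :: nat
    \<comment> \<open>With \<open>m \<ge> 1\<close> one has
      \<open>2 * (d + k) + 1 \<le> 3 * m\<close>, even for \<open>d = k = 0\<close>; the constant
      18302 is 9 * 2000 + 302.\<close>
    define m where "m = max 1 (d + k)"
    have "(2 * (d + k) + 1)\<^sup>2 \<le> (3 * m)\<^sup>2" by (intro power_mono) (auto simp: m_def max_def)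
    moreover have "m\<^sup>2 = max 1 ((d + k)\<^sup>2)"
      by (cases "d + k = 0") (auto simp: m_def max_def power_le_one_iff)
    moreover have "1 \<le> m\<^sup>2" by (simp add: m_def)
    ultimately show "2000 * (2 * (d + k) + 1)\<^sup>2 + 302 \<le> 18302 * max 1 ((d + k)\<^sup>2)"
      by (simp add: power_mult_distrib)
  qed
  ultimately show ?thesis using P by blast
qed

end
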